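(* Let $P$ be a non-abelian finite $p$-group, $p$ a prime. Then $P$ is a $\mathbf{GC}^*$-group if and only if $\mathbf{Z}(P)$ is cyclic and $|P'| = p$.
   Context: Galois automorphisms act on characters by $\chi^\alpha(g)=\chi(g)^\alpha$; two irreducible characters of $G$ are Galois conjugate if one is the image of the other under some element of $\mathrm{Gal}(\mathbb{Q}_n|\mathbb{Q})$ with $|G|$ dividing $n$. A finite group is a $\mathbf{GC}^*$-group if any two of its non-linear irreducible characters of the same degree are Galois conjugate. *)

theory Defs
  imports "HOL-Algebra.Generated_Groups" "Jordan_Normal_Form.Matrix" "HOL-Computational_Algebra.Polynomial"
begin

text \<open>A complex representation of degree d of the group G: a homomorphism
  from G into the invertible d x d complex matrices (multiplicativity and
  identity-preservation imply invertibility).\<close>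
definition is_rep :: "('a, 'b) monoid_scheme \<Rightarrow> nat \<Rightarrow> ('a \<Rightarrow> complex mat) \<Rightarrow> bool" where
  "is_rep G d \<rho> \<longleftrightarrow> 0 < d \<and>
     (\<forall>g \<in> carrier G. \<rho> g \<in> carrier_mat d d) \<and>
     (\<forall>g \<in> carrier G. \<forall>h \<in> carrier G. \<rho> (g \<otimes>\<^bsub>G\<^esub> h) = \<rho> g * \<rho> h) \<and>
     \<rho> \<one>\<^bsub>G\<^esub> = 1\<^sub>m d"

definition is_subspace :: "nat \<Rightarrow> complex vec set \<Rightarrow> bool" where
  "is_subspace d W \<longleftrightarrow> W \<subseteq> carrier_vec d \<and> 0\<^sub>v d \<in> W \<and>
     (\<forall>v \<in> W. \<forall>w \<in> W. v + w \<in> W) \<and> (\<forall>c. \<forall>v \<in> W. c \<cdot>\<^sub>v v \<in> W)"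

definition is_irr_rep :: "('a, 'b) monoid_scheme \<Rightarrow> nat \<Rightarrow> ('a \<Rightarrow> complex mat) \<Rightarrow> bool" where
  "is_irr_rep G d \<rho> \<longleftrightarrow> is_rep G d \<rho> \<and>
     (\<forall>W. is_subspace d W \<and> (\<forall>g \<in> carrier G. \<forall>w \<in> W. \<rho> g *\<^sub>v w \<in> W)
          \<longrightarrow> W = {0\<^sub>v d} \<or> W = carrier_vec d)"

definition mat_trace :: "complex mat \<Rightarrow> complex" where
  "mat_trace A = (\<Sum>i < dim_row A. A $$ (i, i))"

definition irr_char :: "('a, 'b) monoid_scheme \<Rightarrow> ('a \<Rightarrow> complex) \<Rightarrow> bool" where
  "irr_char G \<chi> \<longleftrightarrow> (\<exists>d \<rho>. is_irr_rep G d \<rho> \<and> (\<forall>g \<in> carrier G. \<chi> g = mat_trace (\<rho> g)))"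

definition cyclotomic_field :: "nat \<Rightarrow> complex set" where
  "cyclotomic_field n = {poly (map_poly of_rat p) (cis (2 * pi / real n)) | p. True}"

definition gal_cyclotomic :: "nat \<Rightarrow> (complex \<Rightarrow> complex) set" where
  "gal_cyclotomic n = {\<sigma>. bij_betw \<sigma> (cyclotomic_field n) (cyclotomic_field n) \<and>
     (\<forall>x \<in> cyclotomic_field n. \<forall>y \<in> cyclotomic_field n.
        \<sigma> (x + y) = \<sigma> x + \<sigma> y \<and> \<sigma> (x * y) = \<sigma> x * \<sigma> y) \<and> \<sigma> 1 = 1}"

definition galois_conjugate :: "('a, 'b) monoid_scheme \<Rightarrow> ('a \<Rightarrow> complex) \<Rightarrow> ('a \<Rightarrow> complex) \<Rightarrow> bool" where
  "galois_conjugate G \<chi> \<psi> \<longleftrightarrow>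
     (\<exists>n \<sigma>. 0 < n \<and> card (carrier G) dvd n \<and> \<sigma> \<in> gal_cyclotomic n \<and>
        (\<forall>g \<in> carrier G. \<psi> g = \<sigma> (\<chi> g)))"

definition GC_star :: "('a, 'b) monoid_scheme \<Rightarrow> bool" where
  "GC_star G \<longleftrightarrow> (\<forall>\<chi> \<psi>. irr_char G \<chi> \<and> irr_char G \<psi> \<and>
       \<chi> \<one>\<^bsub>G\<^esub> \<noteq> 1 \<and> \<psi> \<one>\<^bsub>G\<^esub> \<noteq> 1 \<and> \<chi> \<one>\<^bsub>G\<^esub> = \<psi> \<one>\<^bsub>G\<^esub>
       \<longrightarrow> galois_conjugate G \<chi> \<psi>)"

definition group_center :: "('a, 'b) monoid_scheme \<Rightarrow> 'a set" where
  "group_center G = {z \<in> carrier G. \<forall>g \<in> carrier G. z \<otimes>\<^bsub>G\<^esub> g = g \<otimes>\<^bsub>G\<^esub> z}"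

definition cyclic_subset :: "('a, 'b) monoid_scheme \<Rightarrow> 'a set \<Rightarrow> bool" where
  "cyclic_subset G H \<longleftrightarrow> (\<exists>z \<in> H. H = generate G {z})"

end

theory Submission
  imports Defs "Jordan_Normal_Form.Spectral_Radius" "Jordan_Normal_Form.DL_Rank"
    "Berlekamp_Zassenhaus.Square_Free_Int_To_Square_Free_GFp"
    "HOL-Algebra.Group_Action" "HOL-Number_Theory.Cong"
begin

text \<open>
  Galois conjugate characters have the same kernel, and twisting by linear characters shows that
  in a \<open>GC*\<close>-group kernels of nonlinear irreducible characters lie in \<open>G'\<close>. A representation in
  which all of \<open>G'\<close> acts by scalars has a character vanishing off the group \<open>Z\<close> of scalar elements,
  and so has degree \<open>d\<close> with \<open>d\<^sup>2 |Z| = |G|\<close>.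

  Let \<open>G\<close> be a \<open>GC*\<close>-group of order a power of \<open>p\<close>. If \<open>|G'| > p\<close>, pass to a quotient with
  \<open>|G'| = p\<^sup>2\<close>, choose \<open>N \<le> G' \<inter> Z(G)\<close> of order \<open>p\<close>, and compare a nonlinear irreducible
  representation of degree \<open>d\<close> with kernel \<open>N\<close> and scalar elements \<open>K\<close>, where \<open>|K : Z(G)| \<le> p\<close>, with
  one of degree \<open>e\<close> that is nontrivial on \<open>N\<close>. If \<open>G'\<close> is central, the degree formula gives
  \<open>e\<^sup>2 \<in> {d\<^sup>2, p d\<^sup>2, d\<^sup>2/p}\<close>, so \<open>e = d\<close>. Otherwise the centralizer \<open>C\<close> of an element of \<open>G' - Z(G)\<close>
  has index \<open>p\<close> and \<open>C' \<le> N\<close>; this bounds \<open>d\<close> by \<open>p\<close>, forces \<open>C\<close> to be abelian, and again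
  \<open>e = d = p\<close>. Both cases contradict that the two kernels differ. Hence \<open>|G'| = p\<close>, and then a
  nonlinear irreducible representation is faithful on \<open>Z(G)\<close>, which is therefore cyclic.

  Conversely, if \<open>|G'| = p\<close> and \<open>Z(G)\<close> is cyclic, a nonlinear irreducible character is determined by
  its faithful central character, and two such central characters are Galois conjugate because the
  cyclotomic polynomial \<open>\<Phi>\<close> of prime power order is irreducible: \<open>\<Phi>\<close> divides the product of the
  \<open>f(x\<^sup>k)\<close> over \<open>k\<close> prime to \<open>p\<close> for every nonconstant factor \<open>f\<close>, so that \<open>p\<close> divides \<open>f(1)\<close>, while
  \<open>\<Phi>(1) = p\<close>.

  An irreducible representation nontrivial at a central \<open>a \<noteq> 1\<close> is found inside the range of
  \<open>\<rho>(a) - 1\<close>, where \<open>\<rho>\<close> is the regular representation: a vector \<open>w = \<rho>(a)x - x\<close> fixed by \<open>\<rho>(a)\<close>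
  vanishes, because \<open>x = \<rho>(a\<^sup>|\<^sup>G\<^sup>|)x = x + |G|w\<close>.
\<close>

section \<open>Roots of unity\<close>

hide_const (open) up_ring.coeff up_ring.monom

lemma power_gcd_eq_1:
  fixes x :: "'a :: monoid_mult"
  assumes "x ^ m = 1" "x ^ n = 1"
  shows "x ^ gcd m n = 1"
proof (cases "m = 0")
  case False
  obtain s t where "m * s = n * t + gcd m n" using bezout_nat[OF False] by blast
  then have "x ^ (m * s) = x ^ (n * t) * x ^ gcd m n" by (simp add: power_add)
  then show ?thesis using assms by (simp add: power_mult)
qed (use assms in simp)

definition primitive_root_of_unity :: "nat \<Rightarrow> 'a :: monoid_mult \<Rightarrow> bool" where
  "primitive_root_of_unity n z \<longleftrightarrow> (\<forall>i. z ^ i = 1 \<longleftrightarrow> n dvd i)"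

lemma primitive_root_power_eq_1_iff: "primitive_root_of_unity n z \<Longrightarrow> z ^ i = 1 \<longleftrightarrow> n dvd i"
  unfolding primitive_root_of_unity_def by blast

lemma primitive_root_cis:
  assumes "n > 0"
  shows "primitive_root_of_unity n (cis (2 * pi / real n))"
  unfolding primitive_root_of_unity_def
proof
  fix i
  have "cis (2 * pi / real n) ^ i = cis (2 * pi * real i / real n)"
    by (simp add: DeMoivre field_simps)
  moreover have "cis x = 1 \<longleftrightarrow> cos x = 1" for x
    using sin_cos_squared_add[of x] by (auto simp: complex_eq_iff power2_eq_square)
  moreover have "cos (2 * pi * real i / real n) = 1 \<longleftrightarrow> (\<exists>k::int. real i = real_of_int k * real n)"
    unfolding cos_one_2pi_int using assms by (simp add: field_simps)
  moreover have "(\<exists>k::int. real i = real_of_int k * real n) \<longleftrightarrow> int n dvd int i"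
    by (metis dvd_def mult.commute of_int_eq_iff of_int_mult of_int_of_nat_eq)
  ultimately show "cis (2 * pi / real n) ^ i = 1 \<longleftrightarrow> n dvd i" by simp
qed

lemma primitive_root_power_iff:
  assumes n: "n > 0" and z: "primitive_root_of_unity n z"
  shows "primitive_root_of_unity n (z ^ l) \<longleftrightarrow> coprime l n"
proof
  assume prim: "primitive_root_of_unity n (z ^ l)"
  let ?g = "gcd l n"
  have "l * (n div ?g) = (l div ?g) * n"
    by (metis dvd_div_mult dvd_mult_div_cancel gcd_dvd1 gcd_dvd2 mult.commute)
  then have "n dvd n div ?g"
    using primitive_root_power_eq_1_iff[OF prim] primitive_root_power_eq_1_iff[OF z]
    by (metis dvd_triv_right power_mult)
  then have "n div ?g = n"
    using n by (metis dvd_antisym div_dvd_iff_mult dvd_triv_left gcd_dvd2 gcd_pos_nat not_gr0)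
  then show "coprime l n" using n by (metis coprime_iff_gcd_eq_1 div_eq_dividend_iff)
next
  assume "coprime l n"
  then show "primitive_root_of_unity n (z ^ l)"
    using z unfolding primitive_root_of_unity_def
    by (simp add: power_mult[symmetric] coprime_dvd_mult_right_iff coprime_commute)
qed

lemma primitive_root_prime_power_iff:
  assumes p: "prime p"
  shows "primitive_root_of_unity (p ^ Suc a) z \<longleftrightarrow> z ^ (p ^ Suc a) = 1 \<and> z ^ (p ^ a) \<noteq> 1"
proof
  assume z: "z ^ (p ^ Suc a) = 1 \<and> z ^ (p ^ a) \<noteq> 1"
  show "primitive_root_of_unity (p ^ Suc a) z"
    unfolding primitive_root_of_unity_def
  proof (intro allI iffI)
    fix i assume i: "z ^ i = 1"
    obtain j where j: "j \<le> Suc a" "gcd i (p ^ Suc a) = p ^ j"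
      using divides_primepow_nat[OF p] by (metis gcd_dvd2)
    have "z ^ (p ^ j) = 1" using power_gcd_eq_1[OF i] z j(2) by metis
    moreover have "z ^ (p ^ a) = (z ^ (p ^ j)) ^ (p ^ (a - j))" if "j \<le> a"
      using that by (simp add: power_mult[symmetric] power_add[symmetric])
    ultimately have "j = Suc a" using z j(1) by fastforce
    then show "p ^ Suc a dvd i" using j(2) by (metis gcd_dvd1)
  next
    fix i assume "p ^ Suc a dvd i"
    then show "z ^ i = 1" using z by (metis dvdE power_mult power_one)
  qed
next
  assume "primitive_root_of_unity (p ^ Suc a) z"
  then show "z ^ (p ^ Suc a) = 1 \<and> z ^ (p ^ a) \<noteq> 1"
    using prime_gt_1_nat[OF p] by (auto simp: primitive_root_power_eq_1_iff dest: dvd_imp_le)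
qed

lemma roots_of_unity_eq_powers:
  fixes z :: complex
  assumes n: "n > 0" and z: "primitive_root_of_unity n z"
  shows "{w. w ^ n = 1} = (\<lambda>i. z ^ i) ` {..<n}"
proof -
  note iff = primitive_root_power_eq_1_iff[OF z]
  have z_nonzero: "z \<noteq> 0" using iff[of n] n by (auto simp: power_0_left)
  have "inj_on (\<lambda>i. z ^ i) {..<n}"
  proof (rule linorder_inj_onI')
    fix i j assume ij: "i \<in> {..<n}" "j \<in> {..<n}" "i < j"
    have "z ^ j = z ^ i * z ^ (j - i)" using ij by (simp add: power_add[symmetric])
    moreover have "z ^ (j - i) \<noteq> 1" using ij iff by (auto dest: dvd_imp_le)
    ultimately show "z ^ i \<noteq> z ^ j" using z_nonzero by simp
  qed
  then have "card ((\<lambda>i. z ^ i) ` {..<n}) = card {w::complex. w ^ n = 1}"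
    using card_nth_roots[of 1 n] n by (simp add: card_image)
  moreover have "(z ^ i) ^ n = 1" for i using iff by (simp add: power_mult[symmetric])
  then have "(\<lambda>i. z ^ i) ` {..<n} \<subseteq> {w. w ^ n = 1}" by auto
  ultimately show ?thesis using card_subset_eq finite_nth_roots[OF n] by metis
qed

lemma primitive_roots_are_powers:
  fixes z w :: complex
  assumes n: "n > 0" and z: "primitive_root_of_unity n z" and w: "primitive_root_of_unity n w"
  obtains l where "coprime l n" "l < n" "w = z ^ l"
proof -
  have "w ^ n = 1" using primitive_root_power_eq_1_iff[OF w] by simp
  then obtain l where "l < n" "w = z ^ l" using roots_of_unity_eq_powers[OF n z] by blast
  then show thesis using that w primitive_root_power_iff[OF n z] by blast
qed

section \<open>Cyclotomic polynomials of prime power order\<close>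

interpretation of_rat_poly_hom: map_poly_comm_ring_hom of_rat ..

abbreviation rat_eval :: "rat poly \<Rightarrow> complex \<Rightarrow> complex" where
  "rat_eval q z \<equiv> poly (map_poly of_rat q) z"

lemma rat_eval_hom:
  "rat_eval (q + r) z = rat_eval q z + rat_eval r z"
  "rat_eval (q - r) z = rat_eval q z - rat_eval r z"
  "rat_eval (q * r) z = rat_eval q z * rat_eval r z"
  by (simp_all add: of_rat_poly_hom.hom_add of_rat_poly_hom.hom_minus of_rat_poly_hom.hom_mult)

lemma rat_eval_of_int_poly: "rat_eval (of_int_poly q) z = poly (of_int_poly q) z"
proof -
  have "map_poly of_rat (of_int_poly q) = (of_int_poly q :: complex poly)"
    by (rule poly_eqI) (simp add: coeff_map_poly)
  then show ?thesis by simp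
qed

lemma monic_int_poly_dvd_if_roots:
  fixes f h :: "int poly"
  assumes monic: "lead_coeff f = 1"
    and card: "card {z::complex. poly (of_int_poly f) z = 0} = degree f"
    and roots: "\<And>z::complex. poly (of_int_poly f) z = 0 \<Longrightarrow> poly (of_int_poly h) z = 0"
  shows "f dvd h"
proof -
  let ?f = "of_int_poly f :: rat poly" and ?h = "of_int_poly h :: rat poly"
  let ?r = "map_poly of_rat (?h mod ?f) :: complex poly"
  have f_nonzero: "f \<noteq> 0" using monic by auto
  have "poly ?r z = 0" if "poly (of_int_poly f) z = 0" for z
  proof -
    have "rat_eval ?h z = rat_eval (?h div ?f) z * rat_eval ?f z + poly ?r z"
      by (metis div_mult_mod_eq rat_eval_hom(1,3))
    then show ?thesis using that roots by (simp add: rat_eval_of_int_poly)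
  qed
  then have "{z. poly (of_int_poly f) z = 0} \<subseteq> {z. poly ?r z = 0}" by auto
  moreover have "degree ?r < degree f" if "?r \<noteq> 0"
    using that f_nonzero degree_mod_less[of ?f ?h] by auto
  ultimately have "?r = 0"
    using card by (metis card_mono card_poly_roots_bound leD le_trans poly_roots_finite)
  then have "?f dvd ?h" by (simp add: mod_eq_0_iff_dvd)
  moreover have "content f = 1" using monic by (metis content_dvd_coeff is_unit_content_iff)
  ultimately show ?thesis using dvd_poly_int_content_1 by blast
qed

text \<open>The cyclotomic polynomial of order \<open>p ^ (a + 1)\<close>, not \<open>p ^ a\<close>.\<close>

definition prime_power_cyclotomic :: "nat \<Rightarrow> nat \<Rightarrow> int poly" where
  "prime_power_cyclotomic p a = (\<Sum>i<p. monom 1 (i * p ^ a))"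

lemma prime_power_cyclotomic_degree:
  assumes "prime p"
  shows "degree (prime_power_cyclotomic p a) = (p - 1) * p ^ a"
    and "lead_coeff (prime_power_cyclotomic p a) = 1"
proof -
  let ?\<Phi> = "prime_power_cyclotomic p a"
  have "degree ?\<Phi> = (p - 1) * p ^ a \<and> coeff ?\<Phi> ((p - 1) * p ^ a) = 1"
    unfolding prime_power_cyclotomic_def
    by (rule degree_lcoeff_sum[of _ "p - 1"])
      (use prime_gt_0_nat[OF assms] in \<open>auto simp: degree_monom_eq\<close>)
  then show "degree ?\<Phi> = (p - 1) * p ^ a" "lead_coeff ?\<Phi> = 1" by auto
qed

lemma prime_power_cyclotomic_at_1: "poly (prime_power_cyclotomic p a) 1 = int p"
  unfolding prime_power_cyclotomic_def by (simp add: poly_sum poly_monom)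

lemma prime_power_cyclotomic_root_iff:
  fixes z :: complex
  assumes p: "prime p"
  shows "poly (of_int_poly (prime_power_cyclotomic p a)) z = 0 \<longleftrightarrow>
    primitive_root_of_unity (p ^ Suc a) z"
proof -
  let ?u = "z ^ (p ^ a)"
  have "poly (of_int_poly (prime_power_cyclotomic p a)) z = (\<Sum>i<p. ?u ^ i)"
    unfolding prime_power_cyclotomic_def
    by (simp add: of_int_poly_hom.hom_sum poly_sum poly_monom power_mult[symmetric] mult.commute)
  moreover have "?u ^ p - 1 = (?u - 1) * (\<Sum>i<p. ?u ^ i)" by (rule power_diff_1_eq)
  moreover have "(\<Sum>i<p. ?u ^ i) \<noteq> 0" if "?u = 1" using that prime_gt_0_nat[OF p] by simp
  moreover have "?u ^ p = z ^ (p ^ Suc a)" by (simp add: power_mult[symmetric] mult.commute)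
  ultimately show ?thesis
    unfolding primitive_root_prime_power_iff[OF p] by (metis right_minus_eq mult_eq_0_iff)
qed

lemma card_primitive_roots_prime_power:
  assumes p: "prime p"
  shows "card {z::complex. primitive_root_of_unity (p ^ Suc a) z} = (p - 1) * p ^ a"
proof -
  have pow_pos: "p ^ a > 0" "p ^ Suc a > 0" using prime_gt_0_nat[OF p] by simp_all
  have "{z::complex. primitive_root_of_unity (p ^ Suc a) z} =
      {z. z ^ (p ^ Suc a) = 1} - {z. z ^ (p ^ a) = 1}"
    using primitive_root_prime_power_iff[OF p] by auto
  moreover have "{z::complex. z ^ (p ^ a) = 1} \<subseteq> {z. z ^ (p ^ Suc a) = 1}"
    by (auto simp: power_mult mult.commute[of p])
  ultimately show ?thesis
    using pow_pos
    by (simp add: card_Diff_subset finite_nth_roots card_nth_roots diff_mult_distrib del: power_Suc)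
      (simp add: mult.commute)
qed

lemma prime_power_cyclotomic_factor_at_1:
  assumes p: "prime p" and f: "f dvd prime_power_cyclotomic p a" "degree f > 0"
  shows "int p dvd poly f 1"
proof -
  let ?\<Phi> = "prime_power_cyclotomic p a" and ?n = "p ^ Suc a"
  have n: "?n > 0" using prime_gt_0_nat[OF p] by simp
  have eval_monom: "poly (of_int_poly (f \<circ>\<^sub>p monom 1 k)) z = poly (of_int_poly f) (z ^ k)"
    for k and z :: complex
    by (simp add: of_int_hom.map_poly_pcompose poly_pcompose poly_monom)
  define h where "h = (\<Prod>k | k < ?n \<and> coprime k ?n. f \<circ>\<^sub>p monom 1 k)"
  obtain z :: complex where fz: "poly (of_int_poly f) z = 0"
    using fundamental_theorem_of_algebra[of "of_int_poly f"] f(2) constant_degree by force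
  then have "poly (of_int_poly ?\<Phi>) z = 0" using f(1) by (auto simp: of_int_poly_hom.hom_mult)
  then have z: "primitive_root_of_unity ?n z" using prime_power_cyclotomic_root_iff[OF p] by blast
  have "poly (of_int_poly h) w = 0" if "poly (of_int_poly ?\<Phi>) w = 0" for w :: complex
  proof -
    have w: "primitive_root_of_unity ?n w" using that prime_power_cyclotomic_root_iff[OF p] by blast
    obtain k where k: "coprime k ?n" "k < ?n" "z = w ^ k"
      by (rule primitive_roots_are_powers[OF n w z])
    then show ?thesis
      unfolding h_def using k fz by (auto simp: of_int_poly_hom.hom_prod poly_prod eval_monom)
  qed
  then have "?\<Phi> dvd h"
    using monic_int_poly_dvd_if_roots[of ?\<Phi> h] prime_power_cyclotomic_degree[OF p]
      card_primitive_roots_prime_power[OF p] prime_power_cyclotomic_root_iff[OF p] by simp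
  then have "int p dvd poly h 1"
    unfolding prime_power_cyclotomic_at_1[of p a, symmetric] by (auto elim: dvdE)
  moreover have "poly h 1 = (\<Prod>k | k < ?n \<and> coprime k ?n. poly f 1)"
    unfolding h_def by (simp add: poly_prod poly_pcompose poly_monom)
  ultimately show ?thesis using p by (simp add: prime_dvd_power)
qed

lemma prime_power_cyclotomic_irreducible:
  assumes p: "prime p"
  shows "irreducible\<^sub>d (prime_power_cyclotomic p a)"
proof (rule irreducible\<^sub>dI)
  let ?\<Phi> = "prime_power_cyclotomic p a"
  show "degree ?\<Phi> > 0" using prime_power_cyclotomic_degree[OF p] prime_gt_1_nat[OF p] by simp
  fix f g assume deg: "degree f > 0" "degree g > 0" and fg: "?\<Phi> = f * g"
  have "int p * int p dvd poly f 1 * poly g 1"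
    using prime_power_cyclotomic_factor_at_1[OF p, of f a]
      prime_power_cyclotomic_factor_at_1[OF p, of g a] deg fg
    by (intro mult_dvd_mono) auto
  also have "\<dots> = int p" using prime_power_cyclotomic_at_1[of p a] by (simp add: fg)
  finally show False using prime_gt_1_nat[OF p] by auto
qed

section \<open>Galois automorphisms\<close>

lemma irreducible_dvd_if_common_root:
  assumes q: "irreducible q" "rat_eval q z = 0" and f: "rat_eval f z = 0"
  shows "q dvd f"
proof (rule ccontr)
  assume "\<not> q dvd f"
  then have "coprime q f"
    using q by (intro prime_elem_imp_coprime) (simp_all add: irreducible_imp_prime_elem)
  then obtain u v where "u * q + v * f = 1"
    using bezout_coefficients_fst_snd[of q f] by auto
  then have "rat_eval 1 z = rat_eval u z * rat_eval q z + rat_eval v z * rat_eval f z"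
    by (metis rat_eval_hom(1,3))
  then show False using q f by simp
qed

lemma primitive_roots_conjugate:
  fixes z w :: complex
  assumes p: "prime p" and z: "primitive_root_of_unity (p ^ Suc a) z"
    and w: "primitive_root_of_unity (p ^ Suc a) w" and f: "rat_eval f z = 0"
  shows "rat_eval f w = 0"
proof -
  let ?\<Phi> = "of_int_poly (prime_power_cyclotomic p a) :: rat poly"
  have root: "rat_eval ?\<Phi> x = 0 \<longleftrightarrow> primitive_root_of_unity (p ^ Suc a) x" for x
    unfolding rat_eval_of_int_poly by (rule prime_power_cyclotomic_root_iff[OF p])
  have "irreducible ?\<Phi>"
    using irreducible\<^sub>d_int_rat[OF prime_power_cyclotomic_irreducible[OF p]] by simp
  then have "?\<Phi> dvd f" using irreducible_dvd_if_common_root root z f by blast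
  then show ?thesis using root[of w] w by (metis dvdE mult_zero_left rat_eval_hom(3))
qed

lemma cyclotomic_field_eq: "cyclotomic_field n = range (\<lambda>q. rat_eval q (cis (2 * pi / real n)))"
  unfolding cyclotomic_field_def by auto

lemma of_nat_in_cyclotomic_field: "of_nat k \<in> cyclotomic_field n"
proof -
  have "of_nat k = rat_eval [:of_nat k:] (cis (2 * pi / real n))"
    by (simp add: of_rat_hom.map_poly_pCons_hom)
  then show ?thesis unfolding cyclotomic_field_eq by blast
qed

lemma cis_power_in_cyclotomic_field: "cis (2 * pi / real n) ^ k \<in> cyclotomic_field n"
proof -
  have "cis (2 * pi / real n) ^ k = rat_eval (monom 1 k) (cis (2 * pi / real n))"
    by (simp add: map_poly_monom poly_monom)
  then show ?thesis unfolding cyclotomic_field_eq by blast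
qed

lemma cyclotomic_field_mult:
  assumes "x \<in> cyclotomic_field n" "y \<in> cyclotomic_field n"
  shows "x * y \<in> cyclotomic_field n"
  using assms unfolding cyclotomic_field_eq by (auto simp: rat_eval_hom(3)[symmetric])

lemma gal_cyclotomicD:
  assumes "\<sigma> \<in> gal_cyclotomic n" "x \<in> cyclotomic_field n" "y \<in> cyclotomic_field n"
  shows "\<sigma> (x + y) = \<sigma> x + \<sigma> y" "\<sigma> (x * y) = \<sigma> x * \<sigma> y"
  using assms unfolding gal_cyclotomic_def by auto

lemma gal_cyclotomic_of_nat:
  assumes "\<sigma> \<in> gal_cyclotomic n"
  shows "\<sigma> (of_nat k) = of_nat k"
proof (induction k)
  case 0
  show ?case using gal_cyclotomicD(1)[OF assms, of 0 0] of_nat_in_cyclotomic_field[of 0 n] by simp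
next
  case (Suc k)
  moreover have "\<sigma> 1 = 1" using assms unfolding gal_cyclotomic_def by blast
  ultimately show ?case
    using gal_cyclotomicD(1)[OF assms of_nat_in_cyclotomic_field[of 1]
          of_nat_in_cyclotomic_field[of k]]
    by simp
qed

lemma gal_cyclotomic_power:
  assumes "\<sigma> \<in> gal_cyclotomic n" "x \<in> cyclotomic_field n"
  shows "x ^ i \<in> cyclotomic_field n" "\<sigma> (x ^ i) = \<sigma> x ^ i"
proof (induction i)
  case 0
  show "x ^ 0 \<in> cyclotomic_field n" "\<sigma> (x ^ 0) = \<sigma> x ^ 0"
    using of_nat_in_cyclotomic_field[of 1 n] gal_cyclotomic_of_nat[OF assms(1), of 1] by simp_all
next
  case (Suc i)
  then show "x ^ Suc i \<in> cyclotomic_field n" "\<sigma> (x ^ Suc i) = \<sigma> x ^ Suc i"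
    using cyclotomic_field_mult[OF assms(2)] gal_cyclotomicD(2)[OF assms] by simp_all
qed

lemma rat_eval_power: "rat_eval q (z ^ k) = rat_eval (q \<circ>\<^sub>p monom 1 k) z"
  by (simp add: of_rat_hom.map_poly_pcompose poly_pcompose poly_monom map_poly_monom)

lemma gal_cyclotomic_if_conjugate:
  assumes n: "n > 0" and w: "primitive_root_of_unity n w"
    and conj: "\<And>q. rat_eval q (cis (2 * pi / real n)) = 0 \<longleftrightarrow> rat_eval q w = 0"
  obtains \<sigma> where "\<sigma> \<in> gal_cyclotomic n" "\<sigma> (cis (2 * pi / real n)) = w"
proof
  let ?\<zeta> = "cis (2 * pi / real n)"
  note \<zeta> = primitive_root_cis[OF n]
  have eq_iff: "rat_eval q ?\<zeta> = rat_eval r ?\<zeta> \<longleftrightarrow> rat_eval q w = rat_eval r w" for q r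
    using conj[of "q - r"] by (simp add: rat_eval_hom)
  define \<sigma> where "\<sigma> x = rat_eval (SOME q. x = rat_eval q ?\<zeta>) w" for x
  have \<sigma>: "\<sigma> (rat_eval q ?\<zeta>) = rat_eval q w" for q
    unfolding \<sigma>_def using eq_iff someI[of "\<lambda>r. rat_eval q ?\<zeta> = rat_eval r ?\<zeta>" q] by simp
  have image: "\<sigma> ` cyclotomic_field n = range (\<lambda>q. rat_eval q w)"
    unfolding cyclotomic_field_eq image_image \<sigma> ..
  have powers: "range (\<lambda>q. rat_eval q (x ^ k)) \<subseteq> range (\<lambda>q. rat_eval q x)" for x k
    by (auto simp: rat_eval_power)
  obtain k where k: "w = ?\<zeta> ^ k" using primitive_roots_are_powers[OF n \<zeta> w] .
  obtain l where l: "?\<zeta> = w ^ l" using primitive_roots_are_powers[OF n w \<zeta>] .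
  have "\<sigma> ` cyclotomic_field n = cyclotomic_field n"
    unfolding image unfolding cyclotomic_field_eq
    using powers[of ?\<zeta> k] powers[of w l] unfolding k[symmetric] l[symmetric]
    by (rule subset_antisym)
  moreover have "inj_on \<sigma> (cyclotomic_field n)"
    unfolding cyclotomic_field_eq by (rule inj_onI) (auto simp: \<sigma> eq_iff)
  moreover have "\<sigma> (x + y) = \<sigma> x + \<sigma> y \<and> \<sigma> (x * y) = \<sigma> x * \<sigma> y"
    if xy: "x \<in> cyclotomic_field n" "y \<in> cyclotomic_field n" for x y
  proof -
    obtain q r where "x = rat_eval q ?\<zeta>" "y = rat_eval r ?\<zeta>"
      using xy unfolding cyclotomic_field_eq by auto
    then show ?thesis using \<sigma>[of "q + r"] \<sigma>[of "q * r"] \<sigma>[of q] \<sigma>[of r] by (simp add: rat_eval_hom)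
  qed
  moreover have "\<sigma> 1 = 1" using \<sigma>[of 1] by simp
  ultimately show "\<sigma> \<in> gal_cyclotomic n" unfolding gal_cyclotomic_def bij_betw_def by blast
  show "\<sigma> ?\<zeta> = w" using \<sigma>[of "[:0, 1:]"] by (simp add: map_poly_pCons)
qed

lemma primitive_roots_are_coprime_powers:
  fixes u w :: complex
  assumes p: "prime p" and m: "m dvd p ^ k"
    and u: "primitive_root_of_unity m u" and w: "primitive_root_of_unity m w"
  obtains l where "coprime l (p ^ k)" "w = u ^ l"
proof (cases "m = 1")
  case True
  then have "u = 1" "w = 1"
    using primitive_root_power_eq_1_iff[OF u, of 1] primitive_root_power_eq_1_iff[OF w, of 1] by auto
  then show thesis using that[of 1] by simp
next
  case False
  have "m > 0" using prime_gt_0_nat[OF p] dvd_pos_nat[OF _ m] by simp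
  then obtain l where l: "coprime l m" "w = u ^ l" using primitive_roots_are_powers[OF _ u w] by blast
  obtain b where "m = p ^ b" using divides_primepow_nat[OF p] m by blast
  then have "coprime l p" using l(1) False by (cases b) auto
  then show thesis using that[of l] l(2) by simp
qed

lemma gal_cyclotomic_maps_primitive_root:
  fixes u w :: complex
  assumes p: "prime p" and m: "m dvd p ^ k"
    and u: "primitive_root_of_unity m u" and w: "primitive_root_of_unity m w"
  obtains \<sigma> where "\<sigma> \<in> gal_cyclotomic (p ^ k)" "u \<in> cyclotomic_field (p ^ k)" "\<sigma> u = w"
proof -
  let ?n = "p ^ k" and ?\<zeta> = "cis (2 * pi / real (p ^ k))"
  have n: "?n > 0" using prime_gt_0_nat[OF p] by simp
  note \<zeta> = primitive_root_cis[OF n]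
  have "u ^ ?n = 1" using primitive_root_power_eq_1_iff[OF u] m by blast
  then obtain s where s: "u = ?\<zeta> ^ s" using roots_of_unity_eq_powers[OF n \<zeta>] by blast
  obtain l where l: "coprime l ?n" "w = u ^ l" by (rule primitive_roots_are_coprime_powers[OF p m u w])
  have \<zeta>l: "primitive_root_of_unity ?n (?\<zeta> ^ l)"
    using primitive_root_power_iff[OF n \<zeta>] l(1) by blast
  have "rat_eval q ?\<zeta> = 0 \<longleftrightarrow> rat_eval q (?\<zeta> ^ l) = 0" for q
  proof (cases k)
    case 0
    then show ?thesis by simp
  next
    case (Suc a)
    then show ?thesis using primitive_roots_conjugate[OF p, of a] \<zeta> \<zeta>l by metis
  qed
  then obtain \<sigma> where \<sigma>: "\<sigma> \<in> gal_cyclotomic ?n" "\<sigma> ?\<zeta> = ?\<zeta> ^ l"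
    using gal_cyclotomic_if_conjugate[OF n \<zeta>l] by blast
  have "\<sigma> u = (?\<zeta> ^ l) ^ s"
    unfolding s using gal_cyclotomic_power(2)[OF \<sigma>(1) cis_power_in_cyclotomic_field[of _ 1]] \<sigma>(2)
    by simp
  then have "\<sigma> u = w" unfolding l(2) s by (simp add: power_mult[symmetric] mult.commute)
  then show thesis using that[OF \<sigma>(1)] cis_power_in_cyclotomic_field unfolding s by blast
qed

section \<open>Subspaces and matrices\<close>

lemma eq_mat_if_mult_vec_eq:
  fixes A B :: "complex mat"
  assumes A: "A \<in> carrier_mat n m" and B: "B \<in> carrier_mat n m"
    and eq: "\<And>v. v \<in> carrier_vec m \<Longrightarrow> A *\<^sub>v v = B *\<^sub>v v"
  shows "A = B"
proof (rule eq_matI)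
  fix i j assume ij: "i < dim_row B" "j < dim_col B"
  have "(A *\<^sub>v unit_vec m j) $ i = (B *\<^sub>v unit_vec m j) $ i" using eq[of "unit_vec m j"] by simp
  then show "A $$ (i, j) = B $$ (i, j)" using ij A B by (simp add: scalar_prod_right_unit)
qed (use A B in auto)

lemma smult_one_mult_vec:
  fixes w :: "complex vec"
  assumes "w \<in> carrier_vec d"
  shows "(\<mu> \<cdot>\<^sub>m 1\<^sub>m d) *\<^sub>v w = \<mu> \<cdot>\<^sub>v w"
  using assms by (intro eq_vecI) (auto simp: row_smult smult_scalar_prod_distrib[of _ d])

lemma is_subspace_iff_submodule:
  "is_subspace d W \<longleftrightarrow> submodule class_ring W (module_vec TYPE(complex) d)"
proof -
  interpret vec_space "TYPE(complex)" d .
  show ?thesis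
    unfolding is_subspace_def submodule_def using module_axioms by (auto simp: class_ring_simps)
qed

lemma is_subspace_carrier_vec: "is_subspace d (carrier_vec d)"
  unfolding is_subspace_def by auto

lemma is_subspace_eigenspace:
  fixes A :: "complex mat"
  assumes "A \<in> carrier_mat d d"
  shows "is_subspace d {v \<in> carrier_vec d. A *\<^sub>v v = \<mu> \<cdot>\<^sub>v v}"
  unfolding is_subspace_def using assms
  by (auto simp: mult_add_distrib_mat_vec[OF assms] smult_add_distrib_vec mult_mat_vec
      smult_smult_assoc mult.commute)

lemma is_subspace_range:
  fixes A :: "complex mat"
  assumes A: "A \<in> carrier_mat n m"
  shows "is_subspace n ((\<lambda>v. A *\<^sub>v v) ` carrier_vec m)"
  unfolding is_subspace_def
proof (intro conjI ballI allI)
  show "(\<lambda>v. A *\<^sub>v v) ` carrier_vec m \<subseteq> carrier_vec n" using A by auto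
  have "A *\<^sub>v 0\<^sub>v m = 0\<^sub>v n" using A by (intro eq_vecI) auto
  then show "0\<^sub>v n \<in> (\<lambda>v. A *\<^sub>v v) ` carrier_vec m" by (metis image_eqI zero_carrier_vec)
qed (auto simp: mult_add_distrib_mat_vec[OF A, symmetric] mult_mat_vec[OF A, symmetric])

lemma is_subspace_preimage:
  fixes A :: "complex mat"
  assumes A: "A \<in> carrier_mat n m" and W: "is_subspace n W"
  shows "is_subspace m {v \<in> carrier_vec m. A *\<^sub>v v \<in> W}"
proof -
  have "A *\<^sub>v 0\<^sub>v m = 0\<^sub>v n" using A by (intro eq_vecI) auto
  then show ?thesis
    using W unfolding is_subspace_def
    by (auto simp: mult_add_distrib_mat_vec[OF A] mult_mat_vec[OF A])
qed

definition vec_span :: "nat \<Rightarrow> complex vec set \<Rightarrow> complex vec set" where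
  "vec_span d S = LinearCombinations.module.span class_ring (module_vec TYPE(complex) d) S"

lemma is_subspace_vec_span: "S \<subseteq> carrier_vec d \<Longrightarrow> is_subspace d (vec_span d S)"
  and vec_span_superset: "S \<subseteq> carrier_vec d \<Longrightarrow> S \<subseteq> vec_span d S"
  and vec_span_minimal: "is_subspace d W \<Longrightarrow> S \<subseteq> W \<Longrightarrow> vec_span d S \<subseteq> W"
  and card_ge_if_vec_span_eq:
    "finite S \<Longrightarrow> S \<subseteq> carrier_vec d \<Longrightarrow> vec_span d S = carrier_vec d \<Longrightarrow> d \<le> card S"
proof -
  interpret vec_space "TYPE(complex)" d .
  show "is_subspace d (vec_span d S)" if "S \<subseteq> carrier_vec d"
    unfolding is_subspace_iff_submodule vec_span_def using span_is_submodule[of S] that by blast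
  show "S \<subseteq> vec_span d S" if "S \<subseteq> carrier_vec d"
    unfolding vec_span_def using in_own_span that by simp
  show "vec_span d S \<subseteq> W" if "is_subspace d W" "S \<subseteq> W"
    unfolding vec_span_def using span_is_subset that by (simp add: is_subspace_iff_submodule)
  show "d \<le> card S" if "finite S" "S \<subseteq> carrier_vec d" "vec_span d S = carrier_vec d"
    using gen_ge_dim[of S] that unfolding vec_span_def by (simp add: dim_is_n)
qed

definition inj_mat :: "nat \<Rightarrow> nat \<Rightarrow> complex mat \<Rightarrow> bool" where
  "inj_mat n m B \<longleftrightarrow> B \<in> carrier_mat n m \<and> (\<forall>v \<in> carrier_vec m. B *\<^sub>v v = 0\<^sub>v n \<longrightarrow> v = 0\<^sub>v m)"

lemma inj_mat_mult_vec_cancel: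
  assumes B: "inj_mat n m B" and x: "x \<in> carrier_vec m" and y: "y \<in> carrier_vec m"
    and eq: "B *\<^sub>v x = B *\<^sub>v y"
  shows "x = y"
proof -
  have Bc: "B \<in> carrier_mat n m" using B unfolding inj_mat_def by auto
  have "B *\<^sub>v (x - y) = 0\<^sub>v n"
    using x y eq Bc by (simp add: mult_minus_distrib_mat_vec[OF Bc] minus_cancel_vec[of _ n])
  then have "x - y = 0\<^sub>v m" using B x y unfolding inj_mat_def by simp
  then have "(x - y) $ i = 0" if "i < m" for i using that by simp
  then show ?thesis using x y by (intro eq_vecI) auto
qed

lemma inj_mat_mult_cancel:
  assumes B: "inj_mat n m B" and S: "S \<in> carrier_mat m k" and T: "T \<in> carrier_mat m k"
    and eq: "B * S = B * T"
  shows "S = T"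
proof (rule eq_mat_if_mult_vec_eq[OF S T])
  fix v :: "complex vec" assume v: "v \<in> carrier_vec k"
  have Bc: "B \<in> carrier_mat n m" using B unfolding inj_mat_def by auto
  have "B *\<^sub>v (S *\<^sub>v v) = B *\<^sub>v (T *\<^sub>v v)" using eq Bc S T v by (metis assoc_mult_mat_vec)
  then show "S *\<^sub>v v = T *\<^sub>v v" using inj_mat_mult_vec_cancel[OF B] S T v by simp
qed

lemma inj_mat_mult:
  assumes "inj_mat n m A" "inj_mat m k B"
  shows "inj_mat n k (A * B)"
  using assms unfolding inj_mat_def by auto

lemma (in vec_space) subspace_basis_exists:
  assumes W: "submodule class_ring W V"
  obtains S where "finite S" "S \<subseteq> W" "lin_indpt S" "span S = W"
proof -
  have Wc: "W \<subseteq> carrier_vec n" using submodule.subset[OF W] by simp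
  let ?P = "\<lambda>S. S \<subseteq> W \<and> lin_indpt S"
  have "\<exists>S. finite S \<and> maximal S ?P"
  proof (rule maximal_exists)
    show "finite S \<and> card S \<le> dim" if "?P S" for S using li_le_dim[OF fin_dim] that Wc by auto
    show "?P {}" by (simp add: lin_dep_def)
  qed
  then obtain S where fin: "finite S" and max: "maximal S ?P" by blast
  have S: "S \<subseteq> W" "lin_indpt S" using max unfolding maximal_def by auto
  have Sc: "S \<subseteq> carrier_vec n" using S(1) Wc by (rule order.trans)
  have "W \<subseteq> span S"
  proof
    fix w assume w: "w \<in> W"
    show "w \<in> span S"
    proof (cases "w \<in> S")
      case True
      then show ?thesis by (rule subsetD[OF in_own_span[OF Sc]])
    next
      case False
      then have "insert w S \<noteq> S" by blast
      then have "\<not> ?P (insert w S)" using max unfolding maximal_def by blast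
      then have "lin_dep (S \<union> {w})" using w S(1) by simp
      then show ?thesis
        using lin_dep_iff_in_span[OF Sc S(2) subsetD[OF Wc w] False] by (rule iffD2[rotated])
    qed
  qed
  moreover have "span S \<subseteq> W" by (rule span_is_subset[OF S(1) W])
  ultimately show thesis using that[OF fin S] by blast
qed

lemma subspace_eq_range_inj_mat:
  assumes W: "is_subspace d W"
  obtains f B where "inj_mat d f B" "(\<lambda>v. B *\<^sub>v v) ` carrier_vec f = W" "W \<noteq> carrier_vec d \<Longrightarrow> f < d"
proof -
  interpret vec_space "TYPE(complex)" d .
  have Wc: "W \<subseteq> carrier_vec d" using W unfolding is_subspace_def by blast
  obtain S where fin: "finite S" and S: "S \<subseteq> W" "lin_indpt S" "span S = W"
    by (rule subspace_basis_exists[OF W[unfolded is_subspace_iff_submodule]])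
  obtain ws where ws: "set ws = S" "distinct ws" using finite_distinct_list[OF fin] by blast
  define B where "B = mat_of_cols d ws"
  have cols: "cols B = ws" using ws S Wc unfolding B_def by simp
  have Bc: "B \<in> carrier_mat d (length ws)" unfolding B_def by simp
  show thesis
  proof
    show "inj_mat d (length ws) B"
      unfolding inj_mat_def using lin_depI[OF Bc] S(2) Bc ws unfolding cols by metis
    show "(\<lambda>v. B *\<^sub>v v) ` carrier_vec (length ws) = W"
      using col_space_eq[OF Bc] Bc Wc S(3) ws unfolding col_space_def cols by auto
    show "length ws < d" if "W \<noteq> carrier_vec d"
    proof (rule ccontr)
      assume "\<not> length ws < d"
      then have "basis S"
        using dim_li_is_basis[OF fin_dim fin] S(1,2) Wc ws distinct_card[OF ws(2)]
        by (auto simp: dim_is_n)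
      then show False using that S(3) unfolding basis_def by simp
    qed
  qed
qed

lemma mat_factors_through_range:
  fixes A B :: "complex mat"
  assumes B: "B \<in> carrier_mat n f" and A: "A \<in> carrier_mat n m"
    and im: "\<And>v. v \<in> carrier_vec m \<Longrightarrow> A *\<^sub>v v \<in> (\<lambda>x. B *\<^sub>v x) ` carrier_vec f"
  obtains T where "T \<in> carrier_mat f m" "A = B * T"
proof -
  have "\<exists>x \<in> carrier_vec f. B *\<^sub>v x = col A j" if "j < m" for j
  proof -
    have "A *\<^sub>v unit_vec m j = col A j"
      using A that by (intro eq_vecI) (auto simp: scalar_prod_right_unit)
    then show ?thesis using im[of "unit_vec m j"] by (metis image_iff unit_vec_carrier)
  qed
  then obtain X where X: "\<And>j. j < m \<Longrightarrow> X j \<in> carrier_vec f \<and> B *\<^sub>v X j = col A j" by metis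
  show thesis
  proof
    let ?T = "mat_of_cols f (map X [0..<m])"
    show T: "?T \<in> carrier_mat f m" by (metis length_map length_upt diff_zero mat_of_cols_carrier(1))
    have col: "col ?T j = X j" if "j < m" for j using that X by simp
    show "A = B * ?T"
    proof (rule eq_matI)
      fix i j assume "i < dim_row (B * ?T)" "j < dim_col (B * ?T)"
      then have ij: "i < n" "j < m" using B T by auto
      then have "(B * ?T) $$ (i, j) = (B *\<^sub>v X j) $ i" using B T col by simp
      then show "A $$ (i, j) = (B * ?T) $$ (i, j)" using X ij A by simp
    qed (use A B T in auto)
  qed
qed

section \<open>Matrix representations\<close>

lemma is_repD:
  assumes "is_rep G d \<rho>"
  shows "0 < d" "g \<in> carrier G \<Longrightarrow> \<rho> g \<in> carrier_mat d d"
    "g \<in> carrier G \<Longrightarrow> h \<in> carrier G \<Longrightarrow> \<rho> (g \<otimes>\<^bsub>G\<^esub> h) = \<rho> g * \<rho> h"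
    "\<rho> \<one>\<^bsub>G\<^esub> = 1\<^sub>m d"
  using assms unfolding is_rep_def by auto

definition invariant_subspace ::
    "('a, 'b) monoid_scheme \<Rightarrow> nat \<Rightarrow> ('a \<Rightarrow> complex mat) \<Rightarrow> complex vec set \<Rightarrow> bool" where
  "invariant_subspace G d \<rho> W \<longleftrightarrow> is_subspace d W \<and> (\<forall>g \<in> carrier G. \<forall>w \<in> W. \<rho> g *\<^sub>v w \<in> W)"

lemma is_irr_rep_iff:
  "is_irr_rep G d \<rho> \<longleftrightarrow>
    is_rep G d \<rho> \<and> (\<forall>W. invariant_subspace G d \<rho> W \<longrightarrow> W = {0\<^sub>v d} \<or> W = carrier_vec d)"
  unfolding is_irr_rep_def invariant_subspace_def ..

lemma rep_mult_commuting_vec: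
  assumes rep: "is_rep G d \<rho>" and A: "A \<in> carrier_mat d d" and comm: "A * \<rho> g = \<rho> g * A"
    and g: "g \<in> carrier G" and v: "v \<in> carrier_vec d"
  shows "\<rho> g *\<^sub>v (A *\<^sub>v v) = A *\<^sub>v (\<rho> g *\<^sub>v v)"
  using assoc_mult_mat_vec[OF is_repD(2)[OF rep g] A v]
    assoc_mult_mat_vec[OF A is_repD(2)[OF rep g] v] comm
  by simp

lemma invariant_subspace_eigenspace:
  assumes rep: "is_rep G d \<rho>" and A: "A \<in> carrier_mat d d"
    and comm: "\<And>g. g \<in> carrier G \<Longrightarrow> A * \<rho> g = \<rho> g * A"
  shows "invariant_subspace G d \<rho> {v \<in> carrier_vec d. A *\<^sub>v v = \<mu> \<cdot>\<^sub>v v}"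
  unfolding invariant_subspace_def
proof (intro conjI ballI is_subspace_eigenspace[OF A])
  fix g w assume g: "g \<in> carrier G" and "w \<in> {v \<in> carrier_vec d. A *\<^sub>v v = \<mu> \<cdot>\<^sub>v v}"
  then have w: "w \<in> carrier_vec d" "A *\<^sub>v w = \<mu> \<cdot>\<^sub>v w" by auto
  note \<rho>g = is_repD(2)[OF rep g]
  have "A *\<^sub>v (\<rho> g *\<^sub>v w) = \<mu> \<cdot>\<^sub>v (\<rho> g *\<^sub>v w)"
    using rep_mult_commuting_vec[OF rep A comm[OF g] g w(1)] w(2) mult_mat_vec[OF \<rho>g w(1)] by simp
  then show "\<rho> g *\<^sub>v w \<in> {v \<in> carrier_vec d. A *\<^sub>v v = \<mu> \<cdot>\<^sub>v v}" using \<rho>g w(1) by simp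
qed

lemma invariant_subspace_range:
  assumes rep: "is_rep G d \<rho>" and A: "A \<in> carrier_mat d d"
    and comm: "\<And>g. g \<in> carrier G \<Longrightarrow> A * \<rho> g = \<rho> g * A"
  shows "invariant_subspace G d \<rho> ((\<lambda>v. A *\<^sub>v v) ` carrier_vec d)"
  unfolding invariant_subspace_def
proof (intro conjI ballI is_subspace_range[OF A])
  fix g w assume g: "g \<in> carrier G" and "w \<in> (\<lambda>v. A *\<^sub>v v) ` carrier_vec d"
  then obtain v where v: "v \<in> carrier_vec d" "w = A *\<^sub>v v" by blast
  then show "\<rho> g *\<^sub>v w \<in> (\<lambda>v. A *\<^sub>v v) ` carrier_vec d"
    using rep_mult_commuting_vec[OF rep A comm[OF g] g v(1)] is_repD(2)[OF rep g] by simp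
qed

lemma schur:
  assumes irr: "is_irr_rep G d \<rho>" and A: "A \<in> carrier_mat d d"
    and comm: "\<And>g. g \<in> carrier G \<Longrightarrow> A * \<rho> g = \<rho> g * A"
  obtains \<mu> where "A = \<mu> \<cdot>\<^sub>m 1\<^sub>m d"
proof -
  have rep: "is_rep G d \<rho>" using irr unfolding is_irr_rep_def by blast
  obtain \<mu> v where v: "v \<in> carrier_vec d" "v \<noteq> 0\<^sub>v d" "A *\<^sub>v v = \<mu> \<cdot>\<^sub>v v"
    using spectrum_non_empty[OF A is_repD(1)[OF rep]] A
    unfolding spectrum_def eigenvalue_def eigenvector_def by auto
  let ?W = "{w \<in> carrier_vec d. A *\<^sub>v w = \<mu> \<cdot>\<^sub>v w}"
  have "?W = {0\<^sub>v d} \<or> ?W = carrier_vec d"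
    using irr invariant_subspace_eigenspace[OF rep A comm] unfolding is_irr_rep_iff by blast
  then have "w \<in> ?W" if "w \<in> carrier_vec d" for w using that v by blast
  then have "A = \<mu> \<cdot>\<^sub>m 1\<^sub>m d"
    using A by (intro eq_mat_if_mult_vec_eq[of _ d d]) (auto simp: smult_one_mult_vec)
  then show thesis by (rule that)
qed

definition rep_embedding ::
    "('a, 'b) monoid_scheme \<Rightarrow> nat \<Rightarrow> ('a \<Rightarrow> complex mat) \<Rightarrow> nat \<Rightarrow>
      ('a \<Rightarrow> complex mat) \<Rightarrow> complex mat \<Rightarrow> bool" where
  "rep_embedding G d \<rho> f \<tau> B \<longleftrightarrow>
    is_rep G f \<tau> \<and> inj_mat d f B \<and> (\<forall>g \<in> carrier G. \<rho> g * B = B * \<tau> g)"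

lemma rep_embeddingD:
  assumes "rep_embedding G d \<rho> f \<tau> B"
  shows "is_rep G f \<tau>" "inj_mat d f B" "B \<in> carrier_mat d f" "g \<in> carrier G \<Longrightarrow> \<rho> g * B = B * \<tau> g"
  using assms unfolding rep_embedding_def inj_mat_def by auto

lemma rep_embedding_refl: "is_rep G d \<rho> \<Longrightarrow> rep_embedding G d \<rho> d \<rho> (1\<^sub>m d)"
  unfolding rep_embedding_def inj_mat_def using is_repD(2) by fastforce

lemma rep_embedding_trans:
  assumes rep: "is_rep G d \<rho>" and B: "rep_embedding G d \<rho> e \<tau> B" and C: "rep_embedding G e \<tau> f \<upsilon> C"
  shows "rep_embedding G d \<rho> f \<upsilon> (B * C)"
proof -
  note Bc = rep_embeddingD(3)[OF B] and Cc = rep_embeddingD(3)[OF C]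
  have "\<rho> g * (B * C) = (B * C) * \<upsilon> g" if g: "g \<in> carrier G" for g
  proof -
    note \<rho>g = is_repD(2)[OF rep g]
      and \<tau>g = is_repD(2)[OF rep_embeddingD(1)[OF B] g]
      and \<upsilon>g = is_repD(2)[OF rep_embeddingD(1)[OF C] g]
    have "\<rho> g * (B * C) = (B * \<tau> g) * C"
      using assoc_mult_mat[OF \<rho>g Bc Cc] rep_embeddingD(4)[OF B g] by simp
    also have "\<dots> = B * (C * \<upsilon> g)"
      using assoc_mult_mat[OF Bc \<tau>g Cc] rep_embeddingD(4)[OF C g] by simp
    finally show ?thesis using assoc_mult_mat[OF Bc Cc \<upsilon>g] by simp
  qed
  then show ?thesis
    using B C inj_mat_mult unfolding rep_embedding_def by blast
qed

lemma rep_embeddingI: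
  assumes "group G" and rep: "is_rep G d \<rho>" and f: "0 < f" and B: "inj_mat d f B"
    and \<tau>: "\<And>g. g \<in> carrier G \<Longrightarrow> \<tau> g \<in> carrier_mat f f" "\<And>g. g \<in> carrier G \<Longrightarrow> \<rho> g * B = B * \<tau> g"
  shows "rep_embedding G d \<rho> f \<tau> B"
proof -
  interpret group G by fact
  note \<rho> = is_repD[OF rep]
  have Bc: "B \<in> carrier_mat d f" using B unfolding inj_mat_def by blast
  note cancel = inj_mat_mult_cancel[OF B]
  have "is_rep G f \<tau>" unfolding is_rep_def
  proof (intro conjI ballI f)
    show "\<tau> g \<in> carrier_mat f f" if "g \<in> carrier G" for g using \<tau>(1)[OF that] .
    have "B * \<tau> \<one>\<^bsub>G\<^esub> = B * 1\<^sub>m f" using \<tau>(2)[OF one_closed] \<rho>(4) Bc by simp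
    then show "\<tau> \<one>\<^bsub>G\<^esub> = 1\<^sub>m f" using cancel \<tau>(1)[OF one_closed] by simp
    fix g h assume g: "g \<in> carrier G" and h: "h \<in> carrier G"
    have "B * \<tau> (g \<otimes>\<^bsub>G\<^esub> h) = (\<rho> g * \<rho> h) * B" using \<tau>(2)[of "g \<otimes>\<^bsub>G\<^esub> h"] \<rho>(3) g h by simp
    also have "\<dots> = \<rho> g * (B * \<tau> h)"
      using assoc_mult_mat[OF \<rho>(2)[OF g] \<rho>(2)[OF h] Bc] \<tau>(2)[OF h] by simp
    also have "\<dots> = (B * \<tau> g) * \<tau> h"
      using assoc_mult_mat[OF \<rho>(2)[OF g] Bc \<tau>(1)[OF h]] \<tau>(2)[OF g] by simp
    also have "\<dots> = B * (\<tau> g * \<tau> h)" by (rule assoc_mult_mat[OF Bc \<tau>(1)[OF g] \<tau>(1)[OF h]])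
    finally show "\<tau> (g \<otimes>\<^bsub>G\<^esub> h) = \<tau> g * \<tau> h"
      using cancel \<tau>(1) mult_carrier_mat[OF \<tau>(1)[OF g] \<tau>(1)[OF h]] m_closed[OF g h] by blast
  qed
  then show ?thesis unfolding rep_embedding_def using B \<tau>(2) by blast
qed

lemma rep_restrict:
  assumes G: "group G" and rep: "is_rep G d \<rho>" and W: "invariant_subspace G d \<rho> W" "W \<noteq> {0\<^sub>v d}"
  obtains f \<tau> B where "rep_embedding G d \<rho> f \<tau> B" "(\<lambda>v. B *\<^sub>v v) ` carrier_vec f = W"
    "W \<noteq> carrier_vec d \<Longrightarrow> f < d"
proof -
  obtain f B where B: "inj_mat d f B" and im: "(\<lambda>v. B *\<^sub>v v) ` carrier_vec f = W"
    and fd: "W \<noteq> carrier_vec d \<Longrightarrow> f < d"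
    using subspace_eq_range_inj_mat W(1) unfolding invariant_subspace_def by blast
  have Bc: "B \<in> carrier_mat d f" using B unfolding inj_mat_def by blast
  have "\<exists>T. T \<in> carrier_mat f f \<and> \<rho> g * B = B * T" if g: "g \<in> carrier G" for g
  proof -
    note \<rho>g = is_repD(2)[OF rep g]
    have "(\<rho> g * B) *\<^sub>v v \<in> W" if "v \<in> carrier_vec f" for v
      using W(1) im that g \<rho>g Bc unfolding invariant_subspace_def by auto
    then show ?thesis
      using mat_factors_through_range[OF Bc mult_carrier_mat[OF \<rho>g Bc]] im by metis
  qed
  then obtain \<tau> where \<tau>: "\<And>g. g \<in> carrier G \<Longrightarrow> \<tau> g \<in> carrier_mat f f \<and> \<rho> g * B = B * \<tau> g" by metis
  have "f \<noteq> 0"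
  proof
    assume "f = 0"
    then have "B *\<^sub>v v = 0\<^sub>v d" if "v \<in> carrier_vec f" for v
      using Bc that by (intro eq_vecI) (auto simp: scalar_prod_def)
    then show False using im W unfolding invariant_subspace_def is_subspace_def by auto
  qed
  then show thesis using that[of f \<tau> B] rep_embeddingI[OF G rep _ B] \<tau> im fd by blast
qed

lemma irr_subrep_exists:
  assumes G: "group G" and rep: "is_rep G d \<rho>" and W: "invariant_subspace G d \<rho> W" "W \<noteq> {0\<^sub>v d}"
  obtains f \<tau> B where "is_irr_rep G f \<tau>" "rep_embedding G d \<rho> f \<tau> B"
    "(\<lambda>v. B *\<^sub>v v) ` carrier_vec f \<subseteq> W"
proof -
  have "\<exists>f \<tau> B. is_irr_rep G f \<tau> \<and> rep_embedding G d \<rho> f \<tau> B \<and> (\<lambda>v. B *\<^sub>v v) ` carrier_vec f \<subseteq> W"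
    using rep W
  proof (induction d arbitrary: \<rho> W rule: less_induct)
    case (less d)
    show ?case
    proof (cases "is_irr_rep G d \<rho> \<and> W = carrier_vec d")
      case True
      then show ?thesis
        using rep_embedding_refl[OF less.prems(1)] by (intro exI[of _ d] exI[of _ \<rho>] exI) auto
    next
      case False
      then obtain W' where W': "invariant_subspace G d \<rho> W'" "W' \<noteq> {0\<^sub>v d}"
          "W' \<subseteq> W" "W' \<noteq> carrier_vec d"
        using less.prems unfolding is_irr_rep_iff invariant_subspace_def is_subspace_def
        by (metis order_refl)
      obtain e \<tau> B where B: "rep_embedding G d \<rho> e \<tau> B" "(\<lambda>v. B *\<^sub>v v) ` carrier_vec e = W'"
        and ed: "e < d"
        using rep_restrict[OF G less.prems(1) W'(1,2)] W'(4) by metis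
      note \<tau> = rep_embeddingD(1)[OF B(1)]
      have "unit_vec e 0 \<noteq> (0\<^sub>v e :: complex vec)" using is_repD(1)[OF \<tau>] by simp
      then have "carrier_vec e \<noteq> {0\<^sub>v e :: complex vec}" by (metis singletonD unit_vec_carrier)
      moreover have "invariant_subspace G e \<tau> (carrier_vec e)"
        unfolding invariant_subspace_def
        using is_subspace_carrier_vec mult_mat_vec_carrier[OF is_repD(2)[OF \<tau>]] by blast
      ultimately obtain f \<upsilon> C where C: "is_irr_rep G f \<upsilon>" "rep_embedding G e \<tau> f \<upsilon> C"
        using less.IH[OF ed \<tau>] by blast
      have "(B * C) *\<^sub>v v \<in> W" if "v \<in> carrier_vec f" for v
        using that rep_embeddingD(3)[OF B(1)] rep_embeddingD(3)[OF C(2)] B(2) W'(3) by auto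
      then show ?thesis using C(1) rep_embedding_trans[OF less.prems(1) B(1) C(2)] by blast
    qed
  qed
  then show thesis using that by blast
qed

lemma rep_nat_pow_unipotent:
  assumes "group G" and rep: "is_rep G n \<rho>" and a: "a \<in> carrier G"
    and x: "x \<in> carrier_vec n" and w: "w \<in> carrier_vec n"
    and eq: "\<rho> a *\<^sub>v x = x + w" "\<rho> a *\<^sub>v w = w"
  shows "\<rho> (a [^]\<^bsub>G\<^esub> (m::nat)) *\<^sub>v x = x + of_nat m \<cdot>\<^sub>v w"
proof (induction m)
  case 0
  show ?case using x w is_repD(4)[OF rep] by auto
next
  case (Suc m)
  interpret group G by fact
  note \<rho>a = is_repD(2)[OF rep a]
  have "\<rho> (a [^]\<^bsub>G\<^esub> Suc m) = \<rho> a * \<rho> (a [^]\<^bsub>G\<^esub> m)"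
    using is_repD(3)[OF rep a, of "a [^]\<^bsub>G\<^esub> m"] nat_pow_Suc2[OF a] a by simp
  then have "\<rho> (a [^]\<^bsub>G\<^esub> Suc m) *\<^sub>v x = \<rho> a *\<^sub>v (x + of_nat m \<cdot>\<^sub>v w)"
    using Suc assoc_mult_mat_vec[OF \<rho>a is_repD(2)[OF rep] x] a by simp
  also have "\<dots> = x + w + of_nat m \<cdot>\<^sub>v w"
    using x w eq by (simp add: mult_add_distrib_mat_vec[OF \<rho>a] mult_mat_vec[OF \<rho>a])
  also have "\<dots> = x + of_nat (Suc m) \<cdot>\<^sub>v w"
    using x w by (intro eq_vecI) (auto simp: algebra_simps)
  finally show ?case .
qed

lemma rep_fixed_displacement_eq_zero:
  assumes G: "group G" and fin: "finite (carrier G)" and rep: "is_rep G n \<rho>" and a: "a \<in> carrier G"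
    and x: "x \<in> carrier_vec n" and w: "w \<in> carrier_vec n"
    and eq: "\<rho> a *\<^sub>v x = x + w" "\<rho> a *\<^sub>v w = w"
  shows "w = 0\<^sub>v n"
proof -
  interpret group G by fact
  have x_eq: "x = x + of_nat (card (carrier G)) \<cdot>\<^sub>v w"
    using rep_nat_pow_unipotent[OF G rep a x w eq, of "card (carrier G)"]
      pow_order_eq_1[OF a] is_repD(4)[OF rep] x by (simp add: Coset.order_def)
  have "card (carrier G) \<noteq> 0" using fin one_closed by auto
  moreover have "x $ i = x $ i + of_nat (card (carrier G)) * w $ i" if "i < n" for i
    by (subst x_eq) (use w x that in simp)
  ultimately show ?thesis using w by (intro eq_vecI) auto
qed

lemma central_displacement_commutes:
  assumes rep: "is_rep G n \<rho>" and a: "a \<in> group_center G" and g: "g \<in> carrier G"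
  shows "(\<rho> a - 1\<^sub>m n) * \<rho> g = \<rho> g * (\<rho> a - 1\<^sub>m n)"
proof -
  have ac: "a \<in> carrier G" and ag: "a \<otimes>\<^bsub>G\<^esub> g = g \<otimes>\<^bsub>G\<^esub> a"
    using a g unfolding group_center_def by auto
  note \<rho>a = is_repD(2)[OF rep ac] and \<rho>g = is_repD(2)[OF rep g]
  have "\<rho> a * \<rho> g = \<rho> g * \<rho> a" using is_repD(3)[OF rep] ac g ag by metis
  then show ?thesis
    unfolding mult_minus_distrib_mat[OF \<rho>g \<rho>a one_carrier_mat]
      minus_mult_distrib_mat[OF \<rho>a one_carrier_mat \<rho>g]
    using \<rho>g by simp
qed

lemma mult_vec_eq_add_displacement:
  fixes A :: "complex mat"
  assumes A: "A \<in> carrier_mat n n" and v: "v \<in> carrier_vec n"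
  shows "A *\<^sub>v v = v + (A - 1\<^sub>m n) *\<^sub>v v"
proof -
  have "(A - 1\<^sub>m n) *\<^sub>v v = A *\<^sub>v v - v"
    by (simp add: minus_mult_distrib_mat_vec[OF A one_carrier_mat v] v)
  then show ?thesis using v A by (intro eq_vecI) auto
qed

lemma rep_embedding_in_displacement_nontrivial:
  assumes G: "group G" and fin: "finite (carrier G)" and rep: "is_rep G n \<rho>" and a: "a \<in> carrier G"
    and B: "rep_embedding G n \<rho> f \<tau> B"
    and im: "(\<lambda>v. B *\<^sub>v v) ` carrier_vec f \<subseteq> (\<lambda>v. (\<rho> a - 1\<^sub>m n) *\<^sub>v v) ` carrier_vec n"
  shows "\<tau> a \<noteq> 1\<^sub>m f"
proof
  assume "\<tau> a = 1\<^sub>m f"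
  note \<rho>a = is_repD(2)[OF rep a] and Bc = rep_embeddingD(3)[OF B]
  have fixed: "\<rho> a * B = B" using rep_embeddingD(4)[OF B a] Bc \<open>\<tau> a = 1\<^sub>m f\<close> by simp
  define w where "w = B *\<^sub>v unit_vec f 0"
  have wc: "w \<in> carrier_vec n" unfolding w_def using Bc by simp
  have w: "\<rho> a *\<^sub>v w = w"
    unfolding w_def using assoc_mult_mat_vec[OF \<rho>a Bc, of "unit_vec f 0"] fixed by simp
  have "w \<in> (\<lambda>v. (\<rho> a - 1\<^sub>m n) *\<^sub>v v) ` carrier_vec n"
    unfolding w_def by (rule subsetD[OF im imageI[OF unit_vec_carrier]])
  then obtain x where x: "x \<in> carrier_vec n" "w = (\<rho> a - 1\<^sub>m n) *\<^sub>v x" by blast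
  have "\<rho> a *\<^sub>v x = x + w" unfolding x(2) by (rule mult_vec_eq_add_displacement[OF \<rho>a x(1)])
  then have "w = 0\<^sub>v n" by (rule rep_fixed_displacement_eq_zero[OF G fin rep a x(1) wc _ w])
  then show False
    using rep_embeddingD(2)[OF B] is_repD(1)[OF rep_embeddingD(1)[OF B]] unfolding inj_mat_def w_def
    by (metis unit_vec_carrier unit_vec_nonzero)
qed

lemma irr_subrep_nontrivial_on_central:
  assumes G: "group G" and fin: "finite (carrier G)" and rep: "is_rep G n \<rho>"
    and a: "a \<in> group_center G" "\<rho> a \<noteq> 1\<^sub>m n"
  obtains f \<tau> where "is_irr_rep G f \<tau>" "\<tau> a \<noteq> 1\<^sub>m f"
proof -
  have ac: "a \<in> carrier G" using a(1) unfolding group_center_def by auto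
  note \<rho>a = is_repD(2)[OF rep ac]
  let ?W = "(\<lambda>v. (\<rho> a - 1\<^sub>m n) *\<^sub>v v) ` carrier_vec n"
  have W: "invariant_subspace G n \<rho> ?W"
    using invariant_subspace_range[OF rep _ central_displacement_commutes[OF rep a(1)]] \<rho>a
    by (simp add: minus_carrier_mat)
  have "?W \<noteq> {0\<^sub>v n}"
  proof
    assume "?W = {0\<^sub>v n}"
    then have "(\<rho> a - 1\<^sub>m n) *\<^sub>v v = 0\<^sub>v n" if "v \<in> carrier_vec n" for v using that by blast
    then have "\<rho> a *\<^sub>v v = 1\<^sub>m n *\<^sub>v v" if "v \<in> carrier_vec n" for v
      using that mult_vec_eq_add_displacement[OF \<rho>a that] by simp
    then show False using a(2) eq_mat_if_mult_vec_eq[OF \<rho>a one_carrier_mat] by blast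
  qed
  then obtain f \<tau> B where \<tau>: "is_irr_rep G f \<tau>" and "rep_embedding G n \<rho> f \<tau> B"
    "(\<lambda>v. B *\<^sub>v v) ` carrier_vec f \<subseteq> ?W"
    using irr_subrep_exists[OF G rep W] by blast
  then show thesis using that rep_embedding_in_displacement_nontrivial[OF G fin rep ac] by blast
qed

definition regular_rep :: "('a, 'b) monoid_scheme \<Rightarrow> (nat \<Rightarrow> 'a) \<Rightarrow> 'a \<Rightarrow> complex mat" where
  "regular_rep G e g =
    mat (card (carrier G)) (card (carrier G)) (\<lambda>(i, j). if e i = g \<otimes>\<^bsub>G\<^esub> e j then 1 else 0)"

lemma is_rep_regular_rep:
  assumes "group G" and fin: "finite (carrier G)"
    and e: "bij_betw e {..<card (carrier G)} (carrier G)"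
  shows "is_rep G (card (carrier G)) (regular_rep G e)"
  unfolding is_rep_def
proof (intro conjI ballI)
  interpret group G by fact
  let ?n = "card (carrier G)"
  have ec: "e j \<in> carrier G" if "j < ?n" for j using e that unfolding bij_betw_def by auto
  show "0 < ?n" using fin one_closed by (metis card_gt_0_iff empty_iff)
  show "regular_rep G e g \<in> carrier_mat ?n ?n" for g unfolding regular_rep_def by simp
  show "regular_rep G e \<one>\<^bsub>G\<^esub> = 1\<^sub>m ?n"
    unfolding regular_rep_def using ec e by (intro eq_matI) (auto simp: bij_betw_def inj_on_def)
  fix g h assume g: "g \<in> carrier G" and h: "h \<in> carrier G"
  show "regular_rep G e (g \<otimes>\<^bsub>G\<^esub> h) = regular_rep G e g * regular_rep G e h"
  proof (rule eq_matI)
    fix i j assume "i < dim_row (regular_rep G e g * regular_rep G e h)"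
    "j < dim_col (regular_rep G e g * regular_rep G e h)"
    then have ij: "i < ?n" "j < ?n" unfolding regular_rep_def by auto
    obtain l where l: "l < ?n" "e l = h \<otimes>\<^bsub>G\<^esub> e j"
      using e ec[OF ij(2)] h m_closed[of h "e j"] unfolding bij_betw_def
      by (metis imageE lessThan_iff)
    have "k = l \<longleftrightarrow> e k = h \<otimes>\<^bsub>G\<^esub> e j" if "k < ?n" for k
      using e that l unfolding bij_betw_def inj_on_def by auto
    then have "(regular_rep G e g * regular_rep G e h) $$ (i, j) =
        (\<Sum>k<?n. if k = l then (if e i = g \<otimes>\<^bsub>G\<^esub> e k then 1 else 0) else 0)"
      unfolding regular_rep_def using ij
      by (auto simp: scalar_prod_def atLeast0LessThan intro!: sum.cong)
    also have "\<dots> = regular_rep G e (g \<otimes>\<^bsub>G\<^esub> h) $$ (i, j)"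
      unfolding regular_rep_def using ij l g h ec[OF ij(2)] by (simp add: m_assoc)
    finally show "regular_rep G e (g \<otimes>\<^bsub>G\<^esub> h) $$ (i, j) =
        (regular_rep G e g * regular_rep G e h) $$ (i, j)" by simp
  qed (auto simp: regular_rep_def)
qed

lemma irr_rep_nontrivial_on_central:
  assumes G: "group G" and fin: "finite (carrier G)" and a: "a \<in> group_center G" "a \<noteq> \<one>\<^bsub>G\<^esub>"
  obtains d \<rho> where "is_irr_rep G d \<rho>" "\<rho> a \<noteq> 1\<^sub>m d"
proof -
  interpret group G by fact
  let ?n = "card (carrier G)"
  obtain e where e: "bij_betw e {..<?n} (carrier G)"
    using ex_bij_betw_nat_finite[OF fin] by (auto simp: atLeast0LessThan)
  have ac: "a \<in> carrier G" using a(1) unfolding group_center_def by auto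
  obtain i where i: "i < ?n" "e i = a"
    using e ac unfolding bij_betw_def by (metis imageE lessThan_iff)
  obtain j where j: "j < ?n" "e j = \<one>\<^bsub>G\<^esub>"
    using e one_closed unfolding bij_betw_def by (metis imageE lessThan_iff)
  have "regular_rep G e a $$ (i, j) \<noteq> 1\<^sub>m ?n $$ (i, j)"
    unfolding regular_rep_def using i j a(2) ac by auto
  then have "regular_rep G e a \<noteq> 1\<^sub>m ?n" by auto
  then show thesis
    using irr_subrep_nontrivial_on_central[OF G fin is_rep_regular_rep[OF G fin e] a(1)] that
    by blast
qed

section \<open>Commutators, centralizers and quotients\<close>

definition commutator :: "('a, 'b) monoid_scheme \<Rightarrow> 'a \<Rightarrow> 'a \<Rightarrow> 'a" where
  "commutator G x y = x \<otimes>\<^bsub>G\<^esub> y \<otimes>\<^bsub>G\<^esub> inv\<^bsub>G\<^esub> x \<otimes>\<^bsub>G\<^esub> inv\<^bsub>G\<^esub> y"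

definition centralizer :: "('a, 'b) monoid_scheme \<Rightarrow> 'a \<Rightarrow> 'a set" where
  "centralizer G w = {x \<in> carrier G. x \<otimes>\<^bsub>G\<^esub> w = w \<otimes>\<^bsub>G\<^esub> x}"

definition center_mod :: "('a, 'b) monoid_scheme \<Rightarrow> 'a set \<Rightarrow> 'a set" where
  "center_mod G M = {x \<in> carrier G. \<forall>g \<in> carrier G. commutator G x g \<in> M}"

lemma (in group_hom) hom_commutator:
  "x \<in> carrier G \<Longrightarrow> y \<in> carrier G \<Longrightarrow> h (commutator G x y) = commutator H (h x) (h y)"
  unfolding commutator_def by simp

context group
begin

lemma commutator_closed [simp]:
  "x \<in> carrier G \<Longrightarrow> y \<in> carrier G \<Longrightarrow> commutator G x y \<in> carrier G"
  unfolding commutator_def by simp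

lemma commutator_mult:
  "x \<in> carrier G \<Longrightarrow> y \<in> carrier G \<Longrightarrow> commutator G x y \<otimes> (y \<otimes> x) = x \<otimes> y"
  unfolding commutator_def by (simp add: m_assoc inv_solve_left')

lemma commutator_eq_one_iff:
  assumes "x \<in> carrier G" "y \<in> carrier G"
  shows "commutator G x y = \<one> \<longleftrightarrow> x \<otimes> y = y \<otimes> x"
  using commutator_mult[OF assms] assms by (metis commutator_closed l_one m_closed r_cancel_one')

lemma inv_commutator:
  "x \<in> carrier G \<Longrightarrow> y \<in> carrier G \<Longrightarrow> inv (commutator G x y) = commutator G y x"
  unfolding commutator_def by (simp add: inv_mult_group m_assoc)

lemma conj_eq_commutator_mult:
  "x \<in> carrier G \<Longrightarrow> y \<in> carrier G \<Longrightarrow> x \<otimes> y \<otimes> inv x = commutator G x y \<otimes> y"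
  unfolding commutator_def by (simp add: m_assoc)

lemma conj_eq_self_iff:
  assumes x: "x \<in> carrier G" and y: "y \<in> carrier G"
  shows "x \<otimes> y \<otimes> inv x = y \<longleftrightarrow> x \<otimes> y = y \<otimes> x"
  using conj_eq_commutator_mult[OF x y] commutator_eq_one_iff[OF x y] x y by simp

lemma conj_commutator:
  assumes "w \<in> carrier G" "x \<in> carrier G" "y \<in> carrier G"
  shows "w \<otimes> commutator G x y \<otimes> inv w = commutator G (w \<otimes> x \<otimes> inv w) (w \<otimes> y \<otimes> inv w)"
  unfolding commutator_def using assms
  by (simp add: inv_mult_group m_assoc) (simp add: m_assoc[symmetric])

lemma commutator_one_left: "g \<in> carrier G \<Longrightarrow> commutator G \<one> g = \<one>"
  unfolding commutator_def by simp

lemma commutator_mult_left: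
  assumes "x \<in> carrier G" "y \<in> carrier G" "g \<in> carrier G"
  shows "commutator G (x \<otimes> y) g = x \<otimes> commutator G y g \<otimes> inv x \<otimes> commutator G x g"
  unfolding commutator_def using assms
  by (simp add: inv_mult_group m_assoc) (simp add: m_assoc[symmetric])

lemma commutator_inv_left:
  assumes "x \<in> carrier G" "g \<in> carrier G"
  shows "commutator G (inv x) g = inv x \<otimes> inv (commutator G x g) \<otimes> x"
  unfolding commutator_def using assms by (simp add: inv_mult_group m_assoc)

lemma commutator_restrict_carrier:
  assumes "subgroup H G" "x \<in> H" "y \<in> H"
  shows "commutator (G\<lparr>carrier := H\<rparr>) x y = commutator G x y"
  unfolding commutator_def using assms m_inv_consistent[OF assms(1)] by simp

lemma commutator_in_subgroup_sym:
  assumes "subgroup M G" "x \<in> carrier G" "y \<in> carrier G"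
  shows "commutator G x y \<in> M \<longleftrightarrow> commutator G y x \<in> M"
  using assms inv_commutator subgroup.m_inv_closed by metis

lemma commutator_in_derived:
  "x \<in> carrier G \<Longrightarrow> y \<in> carrier G \<Longrightarrow> commutator G x y \<in> derived G (carrier G)"
  unfolding derived_def commutator_def by (rule generate.incl) blast

lemma derived_subset_iff:
  assumes "subgroup H G"
  shows "derived G (carrier G) \<subseteq> H \<longleftrightarrow> (\<forall>x \<in> carrier G. \<forall>y \<in> carrier G. commutator G x y \<in> H)"
proof
  assume "\<forall>x \<in> carrier G. \<forall>y \<in> carrier G. commutator G x y \<in> H"
  then show "derived G (carrier G) \<subseteq> H"
    unfolding derived_def using assms by (intro generate_subgroup_incl) (auto simp: commutator_def)
qed (use commutator_in_derived in blast)

lemma derived_subgroup: "subgroup (derived G (carrier G)) G"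
  using derived_is_subgroup[OF subset_refl] .

lemma right_transversal_exists:
  assumes C: "subgroup C G" and fin: "finite (carrier G)"
  obtains R where "finite R" "R \<subseteq> carrier G" "card R \<le> card (rcosets C)"
    "\<And>x. x \<in> carrier G \<Longrightarrow> \<exists>c \<in> C. \<exists>r \<in> R. x = c \<otimes> r"
proof
  let ?r = "\<lambda>K. SOME x. x \<in> K"
  have r: "?r (C #> x) \<in> C #> x" if "x \<in> carrier G" for x
    using rcos_self[OF that C] by (rule someI)
  have "finite (rcosets C)" using fin unfolding RCOSETS_def by simp
  then show "finite (?r ` (rcosets C))" "card (?r ` (rcosets C)) \<le> card (rcosets C)"
    by (simp_all add: card_image_le)
  show "?r ` (rcosets C) \<subseteq> carrier G"
    unfolding RCOSETS_def using r r_coset_subset_G[OF subgroup.subset[OF C]] by blast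
  fix x assume x: "x \<in> carrier G"
  then have "x \<in> C #> ?r (C #> x)" using repr_independence[OF r[OF x] x C] rcos_self[OF x C] by simp
  then show "\<exists>c \<in> C. \<exists>y \<in> ?r ` (rcosets C). x = c \<otimes> y"
    unfolding r_coset_def RCOSETS_def using x by blast
qed

lemma subgroup_nat_pow_closed: "subgroup H G \<Longrightarrow> x \<in> H \<Longrightarrow> x [^] (n::nat) \<in> H"
  by (induction n) (auto simp: subgroup.one_closed subgroup.m_closed)

lemma center_mod_subset: "center_mod G M \<subseteq> carrier G"
  unfolding center_mod_def by auto

lemma center_mod_subgroup:
  assumes "M \<lhd> G"
  shows "subgroup (center_mod G M) G"
proof -
  interpret M: normal M G by fact
  show ?thesis
  proof (rule subgroupI)
    have "\<one> \<in> center_mod G M" unfolding center_mod_def by (simp add: commutator_one_left)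
    then show "center_mod G M \<noteq> {}" by blast
    show "inv x \<in> center_mod G M" if "x \<in> center_mod G M" for x
      using that M.inv_op_closed1 unfolding center_mod_def by (simp add: commutator_inv_left)
    show "x \<otimes> y \<in> center_mod G M" if "x \<in> center_mod G M" "y \<in> center_mod G M" for x y
      using that M.inv_op_closed2 unfolding center_mod_def by (simp add: commutator_mult_left)
  qed (rule center_mod_subset)
qed

lemma group_center_eq_center_mod: "group_center G = center_mod G {\<one>}"
  unfolding group_center_def center_mod_def using commutator_eq_one_iff by auto

lemma group_center_subgroup: "subgroup (group_center G) G"
  unfolding group_center_eq_center_mod by (rule center_mod_subgroup[OF one_is_normal])

lemma group_center_closed: "z \<in> group_center G \<Longrightarrow> z \<in> carrier G"
  unfolding group_center_def by auto

lemma group_center_commutes: "z \<in> group_center G \<Longrightarrow> g \<in> carrier G \<Longrightarrow> z \<otimes> g = g \<otimes> z"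
  unfolding group_center_def by auto

lemma central_subgroup_normal:
  assumes H: "subgroup H G" "H \<subseteq> group_center G"
  shows "H \<lhd> G"
proof (rule normal_invI[OF H(1)])
  fix x h assume x: "x \<in> carrier G" and h: "h \<in> H"
  then have "x \<otimes> h = h \<otimes> x" using group_center_commutes[OF subsetD[OF H(2) h] x] by simp
  then show "x \<otimes> h \<otimes> inv x \<in> H"
    using conj_eq_self_iff[OF x subgroup.mem_carrier[OF H(1) h]] h by simp
qed

lemma commutator_nat_pow_left:
  assumes x: "x \<in> carrier G" and g: "g \<in> carrier G" and c: "commutator G x g \<in> group_center G"
  shows "commutator G (x [^] (n::nat)) g = commutator G x g [^] n"
proof (induction n)
  case 0
  then show ?case using g by (simp add: commutator_one_left)
next
  case (Suc n)
  have "x [^] n \<otimes> commutator G x g \<otimes> inv (x [^] n) = commutator G x g"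
    using conj_eq_self_iff[of "x [^] n" "commutator G x g"]
      group_center_commutes[OF c, of "x [^] n"] x g
    by simp
  then show ?case
    using Suc x g nat_pow_Suc2[of "commutator G x g" n] by (simp add: commutator_mult_left)
qed

lemma centralizer_subgroup:
  assumes w: "w \<in> carrier G"
  shows "subgroup (centralizer G w) G"
proof -
  interpret conj: group_action G "carrier G" "\<lambda>g. \<lambda>h\<in>carrier G. g \<otimes> h \<otimes> inv g"
    by (rule action_by_conjugation)
  have "centralizer G w = stabilizer G (\<lambda>g. \<lambda>h\<in>carrier G. g \<otimes> h \<otimes> inv g) w"
    unfolding centralizer_def stabilizer_def using conj_eq_self_iff w by auto
  then show ?thesis using conj.stabilizer_subgroup[OF w] by simp
qed

lemma centralizer_sym:
  "x \<in> carrier G \<Longrightarrow> y \<in> carrier G \<Longrightarrow> x \<in> centralizer G y \<longleftrightarrow> y \<in> centralizer G x"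
  unfolding centralizer_def by auto

lemma centralizer_iff_commutator:
  "x \<in> carrier G \<Longrightarrow> y \<in> carrier G \<Longrightarrow> x \<in> centralizer G y \<longleftrightarrow> commutator G x y = \<one>"
  unfolding centralizer_def using commutator_eq_one_iff by auto

lemma group_center_subset_centralizer: "w \<in> carrier G \<Longrightarrow> group_center G \<subseteq> centralizer G w"
  unfolding group_center_def centralizer_def by auto

text \<open>
  Conjugation by any element changes \<open>x\<close> and \<open>y\<close> only by factors in \<open>G'\<close>, which are central in \<open>C\<close>.
\<close>

lemma commutator_central_if_derived_centralized:
  assumes C: "subgroup C G" and D: "derived G (carrier G) \<subseteq> C"
    and central: "\<And>s c. s \<in> derived G (carrier G) \<Longrightarrow> c \<in> C \<Longrightarrow> s \<in> centralizer G c"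
    and x: "x \<in> C" and y: "y \<in> C"
  shows "commutator G x y \<in> group_center G"
proof -
  note Cc = subgroup.mem_carrier[OF C]
  have absorb: "commutator G (s \<otimes> u) v = commutator G u v"
    if s: "s \<in> derived G (carrier G)" and u: "u \<in> C" and v: "v \<in> C" for s u v
  proof -
    have sc: "s \<in> carrier G" using D s Cc by blast
    have uv: "commutator G u v \<in> C" unfolding commutator_def
      using u v subgroup.m_closed[OF C] subgroup.m_inv_closed[OF C] by simp
    have "commutator G s v = \<one>"
      using central[OF s v] centralizer_iff_commutator[OF sc Cc[OF v]] by simp
    moreover have "s \<otimes> commutator G u v \<otimes> inv s = commutator G u v"
      using central[OF s uv] conj_eq_self_iff[OF sc Cc[OF uv]] unfolding centralizer_def by simp
    ultimately show ?thesis using commutator_mult_left[OF sc Cc[OF u] Cc[OF v]] Cc[OF uv] by simp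
  qed
  have "w \<otimes> commutator G x y \<otimes> inv w = commutator G x y" if w: "w \<in> carrier G" for w
  proof -
    let ?s = "commutator G w x" and ?t = "commutator G w y"
    have st: "?s \<in> derived G (carrier G)" "?t \<in> derived G (carrier G)"
      using commutator_in_derived w Cc x y by auto
    have ty: "?t \<otimes> y \<in> C" using st D y subgroup.m_closed[OF C] by blast
    have "w \<otimes> commutator G x y \<otimes> inv w = commutator G (?s \<otimes> x) (?t \<otimes> y)"
      using conj_commutator conj_eq_commutator_mult w Cc x y by simp
    also have "\<dots> = commutator G x (?t \<otimes> y)" using absorb[OF st(1) x ty] .
    also have "\<dots> = inv (commutator G (?t \<otimes> y) x)" using inv_commutator Cc ty x by simp
    also have "\<dots> = inv (commutator G y x)" using absorb[OF st(2) y x] by simp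
    also have "\<dots> = commutator G x y" using inv_commutator Cc x y by simp
    finally show ?thesis .
  qed
  then show ?thesis
    unfolding group_center_def using conj_eq_self_iff Cc x y by auto
qed

lemma card_subgroup_dvd:
  assumes "subgroup A G" "subgroup B G" "A \<subseteq> B"
  shows "card A dvd card B"
proof -
  interpret B: group "G\<lparr>carrier := B\<rparr>" using subgroup_imp_group[OF assms(2)] .
  have "card (rcosets\<^bsub>G\<lparr>carrier := B\<rparr>\<^esub> A) * card A = card B"
    using B.lagrange[OF subgroup_incl[OF assms]] by (simp add: Coset.order_def)
  then show ?thesis by (metis dvd_triv_right)
qed

lemma pow_card_subgroup_eq_one:
  assumes H: "subgroup H G" and x: "x \<in> H"
  shows "x [^] card H = \<one>"
proof -
  interpret H: group "G\<lparr>carrier := H\<rparr>" using subgroup_imp_group[OF H] .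
  show ?thesis
    using H.pow_order_eq_1[of x] x nat_pow_consistent[of x "card H" H]
    by (simp add: Coset.order_def)
qed

lemma subset_if_prime_index:
  fixes p :: nat
  assumes fin: "finite (carrier G)" and p: "prime p"
    and A: "subgroup A G" and B: "subgroup B G" "A \<subseteq> B" "card B = p * card A"
    and D: "subgroup D G" "A \<subseteq> D" and x: "x \<in> B" "x \<notin> A" "x \<in> D"
  shows "B \<subseteq> D"
proof -
  have S: "subgroup (B \<inter> D) G" using B D by (intro subgroups_Inter_pair) auto
  have finB: "finite B" using finite_subset[OF subgroup.subset[OF B(1)] fin] .
  have card_A_pos: "card A > 0" using subgroup.finite_imp_card_positive[OF A fin] .
  obtain q where q: "card (B \<inter> D) = card A * q"
    using card_subgroup_dvd[OF A S] B D by (metis dvdE le_inf_iff)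
  have "card A < card (B \<inter> D)" using B D x finB by (intro psubset_card_mono) auto
  then have "q \<noteq> 1" using q by auto
  moreover have "card (B \<inter> D) dvd p * card A" using card_subgroup_dvd[OF S B(1)] B(3) by simp
  then have "q dvd p" using q card_A_pos by (simp add: mult.commute)
  ultimately have "q = p" using p by (metis prime_nat_iff)
  then have "B \<inter> D = B" using q B(3) finB by (intro card_subset_eq) auto
  then show ?thesis by auto
qed

lemma commute_if_central_prime_index:
  fixes p :: nat
  assumes fin: "finite (carrier G)" and p: "prime p"
    and K: "subgroup K G" and C: "subgroup C G" "K \<subseteq> C" "card C = p * card K"
    and central: "\<And>c. c \<in> C \<Longrightarrow> K \<subseteq> centralizer G c"
    and x: "x \<in> C" and y: "y \<in> C"
  shows "commutator G x y = \<one>"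
proof -
  note Cc = subgroup.mem_carrier[OF C(1)]
  have C_le: "C \<subseteq> centralizer G w" if "w \<in> C" "c \<in> C" "c \<notin> K" "c \<in> centralizer G w" for w c
    using subset_if_prime_index[OF fin p K C centralizer_subgroup[OF Cc] central] that by blast
  have "card K > 0" using subgroup.finite_imp_card_positive[OF K fin] .
  then have "C \<noteq> K" using C(3) prime_gt_1_nat[OF p] by auto
  then obtain c where c: "c \<in> C" "c \<notin> K" using C(2) by blast
  have "c \<in> centralizer G c" unfolding centralizer_def using Cc c by simp
  then have "y \<in> centralizer G c" using C_le[OF c(1) c] y by blast
  then have "c \<in> centralizer G y" using centralizer_sym[OF Cc[OF c(1)] Cc[OF y]] by blast
  then have "x \<in> centralizer G y" using C_le[OF y c] x by blast
  then show ?thesis using centralizer_iff_commutator[OF Cc[OF x] Cc[OF y]] by blast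
qed

end

context group_hom
begin

lemma normal_preimage:
  assumes "N \<lhd> H"
  shows "{x \<in> carrier G. h x \<in> N} \<lhd> G"
proof -
  interpret N: normal N H by fact
  show ?thesis
  proof (rule G.normal_invI)
    show "subgroup {x \<in> carrier G. h x \<in> N} G"
    proof (rule G.subgroupI)
      have "\<one> \<in> {x \<in> carrier G. h x \<in> N}" by simp
      then show "{x \<in> carrier G. h x \<in> N} \<noteq> {}" by blast
    qed auto
  qed (simp add: N.inv_op_closed2)
qed

lemma normal_image:
  assumes surj: "h ` carrier G = carrier H" and "K \<lhd> G"
  shows "h ` K \<lhd> H"
proof -
  interpret K: normal K G by fact
  show ?thesis
  proof (rule H.normal_invI)
    show "subgroup (h ` K) H" by (rule subgroup_img_is_subgroup[OF K.is_subgroup])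
    fix a b assume "a \<in> carrier H" "b \<in> h ` K"
    then obtain x y where x: "x \<in> carrier G" "a = h x" and y: "y \<in> K" "b = h y" using surj by blast
    then have "a \<otimes>\<^bsub>H\<^esub> b \<otimes>\<^bsub>H\<^esub> inv\<^bsub>H\<^esub> a = h (x \<otimes> y \<otimes> inv x)" by simp
    then show "a \<otimes>\<^bsub>H\<^esub> b \<otimes>\<^bsub>H\<^esub> inv\<^bsub>H\<^esub> a \<in> h ` K" using K.inv_op_closed2[OF x(1) y(1)] by blast
  qed
qed

end

context normal
begin

lemma group_hom_Mod: "group_hom G (G Mod H) (\<lambda>x. H #> x)"
  unfolding group_hom_def group_hom_axioms_def
  using r_coset_hom_Mod factorgroup_is_group is_group by auto

lemma rcos_surj_Mod: "(\<lambda>x. H #> x) ` carrier G = carrier (G Mod H)"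
  unfolding carrier_FactGroup ..

lemma rcos_eq_one_Mod_iff: "x \<in> carrier G \<Longrightarrow> H #> x = \<one>\<^bsub>G Mod H\<^esub> \<longleftrightarrow> x \<in> H"
  using coset_join1[OF _ _ is_subgroup] coset_join2[OF _ is_subgroup] by auto

lemma image_Mod_trivial_iff:
  assumes "subgroup K G"
  shows "(\<lambda>x. H #> x) ` K = {\<one>\<^bsub>G Mod H\<^esub>} \<longleftrightarrow> K \<subseteq> H"
proof -
  have "(\<lambda>x. H #> x) ` K = {\<one>\<^bsub>G Mod H\<^esub>} \<longleftrightarrow> (\<forall>x \<in> K. H #> x = \<one>\<^bsub>G Mod H\<^esub>)"
    using subgroup.one_closed[OF assms] by auto
  then show ?thesis using rcos_eq_one_Mod_iff subgroup.mem_carrier[OF assms] by auto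
qed

lemma card_image_Mod:
  assumes K: "subgroup K G" "H \<subseteq> K"
  shows "card ((\<lambda>x. H #> x) ` K) * card H = card K"
proof -
  interpret K: group "G\<lparr>carrier := K\<rparr>" using subgroup_imp_group[OF K(1)] .
  have "(\<lambda>x. H #> x) ` K = rcosets\<^bsub>G\<lparr>carrier := K\<rparr>\<^esub> H"
    unfolding RCOSETS_def r_coset_def by auto
  then show ?thesis
    using K.lagrange[OF subgroup_incl[OF is_subgroup K]] by (simp add: Coset.order_def)
qed

lemma card_Mod: "card (carrier (G Mod H)) * card H = card (carrier G)"
  using card_image_Mod[OF subgroup_self subset] unfolding carrier_FactGroup .

lemma rcos_in_group_center_Mod_iff:
  assumes a: "a \<in> carrier G"
  shows "H #> a \<in> group_center (G Mod H) \<longleftrightarrow> a \<in> center_mod G H"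
proof -
  interpret h: group_hom G "G Mod H" "\<lambda>x. H #> x" by (rule group_hom_Mod)
  have "H #> a \<in> group_center (G Mod H) \<longleftrightarrow>
      (\<forall>g \<in> carrier G. commutator (G Mod H) (H #> a) (H #> g) = \<one>\<^bsub>G Mod H\<^esub>)"
    unfolding h.H.group_center_eq_center_mod center_mod_def using a h.hom_closed[OF a]
    by (simp add: carrier_FactGroup)
  also have "\<dots> \<longleftrightarrow> (\<forall>g \<in> carrier G. commutator G a g \<in> H)"
    using a rcos_eq_one_Mod_iff by (simp add: h.hom_commutator[symmetric])
  finally show ?thesis unfolding center_mod_def using a by simp
qed

end

section \<open>Finite \<open>p\<close>-groups\<close>

lemma (in group) conj_action_on_normal:
  assumes "H \<lhd> G"
  shows "group_action G H (\<lambda>g. \<lambda>h\<in>H. g \<otimes> h \<otimes> inv g)"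
proof -
  interpret H: normal H G by fact
  let ?f = "\<lambda>g. \<lambda>h\<in>H. g \<otimes> h \<otimes> inv g"
  have bij: "?f g \<in> Bij H" if g: "g \<in> carrier G" for g
  proof -
    have "bij_betw (\<lambda>h. g \<otimes> h \<otimes> inv g) H H"
    proof (rule bij_betwI[where g = "\<lambda>h. inv g \<otimes> h \<otimes> g"])
      show "(\<lambda>h. g \<otimes> h \<otimes> inv g) \<in> H \<rightarrow> H" using g H.inv_op_closed2 by auto
      show "(\<lambda>h. inv g \<otimes> h \<otimes> g) \<in> H \<rightarrow> H" using g H.inv_op_closed1 by auto
    qed (use g H.mem_carrier in \<open>auto simp: m_assoc\<close>, (simp add: m_assoc[symmetric])+)
    then show ?thesis unfolding Bij_def by (auto intro: bij_betw_cong[THEN iffD1])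
  qed
  have "?f \<in> hom G (BijGroup H)"
  proof (rule homI)
    show "?f g \<in> carrier (BijGroup H)" if "g \<in> carrier G" for g
      using bij[OF that] unfolding BijGroup_def by simp
    fix g k assume gk: "g \<in> carrier G" "k \<in> carrier G"
    have "?f (g \<otimes> k) = compose H (?f g) (?f k)"
      using gk H.inv_op_closed2 H.mem_carrier
      by (auto simp: compose_def fun_eq_iff inv_mult_group m_assoc)
    then show "?f (g \<otimes> k) = ?f g \<otimes>\<^bsub>BijGroup H\<^esub> ?f k" using bij gk unfolding BijGroup_def by simp
  qed
  then show ?thesis unfolding group_action_def group_hom_def group_hom_axioms_def
    using group_BijGroup group_axioms by auto
qed

locale pgroup = group G for G (structure) +
  fixes p k :: nat
  assumes finite_carrier: "finite (carrier G)" and prime: "prime p"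
    and card_carrier: "card (carrier G) = p ^ k"
begin

lemma p_gt_1: "p > 1" using prime prime_gt_1_nat by blast

lemma card_subgroup_prime_power:
  assumes "subgroup H G"
  obtains j where "card H = p ^ j"
  using card_subgroup_dvd[OF assms subgroup_self subgroup.subset[OF assms]] card_carrier
    divides_primepow_nat[OF prime] by metis

lemma card_subgroup_pos: "subgroup H G \<Longrightarrow> card H > 0"
  using subgroup.finite_imp_card_positive finite_carrier by blast

lemma finite_subgroup: "subgroup H G \<Longrightarrow> finite H"
  using finite_subset[OF subgroup.subset finite_carrier] .

lemma pgroup_Mod:
  assumes "M \<lhd> G"
  obtains j where "pgroup (G Mod M) p j"
proof -
  interpret M: normal M G by fact
  have "card (carrier (G Mod M)) dvd p ^ k" using M.card_Mod card_carrier by (metis dvd_triv_left)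
  then obtain j where "card (carrier (G Mod M)) = p ^ j"
    using divides_primepow_nat[OF prime] by blast
  moreover have "finite (carrier (G Mod M))"
    using finite_carrier unfolding carrier_FactGroup by simp
  ultimately show thesis
    using that M.factorgroup_is_group prime unfolding pgroup_def pgroup_axioms_def by blast
qed

lemma card_fixed_points_cong:
  assumes "group_action G E \<phi>" and fin: "finite E"
  shows "[card E = card {x \<in> E. \<forall>g \<in> carrier G. \<phi> g x = x}] (mod p)"
proof -
  interpret group_action G E \<phi> by fact
  let ?O = "orbits G E \<phi>" and ?F = "{x \<in> E. \<forall>g \<in> carrier G. \<phi> g x = x}"
  have finO: "finite ?O" using fin unfolding orbits_def by simp
  have orbit_fixed: "orbit G \<phi> x = {x} \<longleftrightarrow> x \<in> ?F" if "x \<in> E" for x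
    using that orbit_refl[OF that] unfolding orbit_def by blast
  have "p dvd card S" if S: "S \<in> ?O" "S \<notin> (\<lambda>x. {x}) ` ?F" for S
  proof -
    obtain x where x: "x \<in> E" "S = orbit G \<phi> x" using S(1) unfolding orbits_def by blast
    have "card S dvd p ^ k"
      using orbit_stabilizer_theorem[OF x(1)] x(2) unfolding Coset.order_def card_carrier
      by (metis dvd_triv_left)
    then obtain j where j: "card S = p ^ j" using divides_primepow_nat[OF prime] by blast
    have "j \<noteq> 0"
    proof
      assume "j = 0"
      then obtain y where "S = {y}" using j card_1_singletonE by auto
      then have "S = {x}" using orbit_refl[OF x(1)] x(2) by simp
      then show False using S(2) orbit_fixed[OF x(1)] x(2) by blast
    qed
    then show ?thesis using j by (simp add: dvd_power)
  qed
  then have "p dvd (\<Sum>S\<in>?O - (\<lambda>x. {x}) ` ?F. card S)" by (intro dvd_sum) auto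
  moreover have "(\<lambda>x. {x}) ` ?F \<subseteq> ?O" using orbit_fixed unfolding orbits_def by blast
  then have "(\<Sum>S\<in>?O. card S) = (\<Sum>S\<in>?O - (\<lambda>x. {x}) ` ?F. card S) + (\<Sum>S\<in>(\<lambda>x. {x}) ` ?F. card S)"
    by (rule sum.subset_diff) (rule finO)
  moreover have "(\<Sum>S\<in>(\<lambda>x. {x}) ` ?F. card S) = card ?F" by (simp add: sum.reindex)
  moreover have "(\<Sum>S\<in>?O. card S) = card E" using disjoint_sum[OF fin, of "\<lambda>_. 1::nat"] by simp
  ultimately have "\<exists>m. p dvd m \<and> card E = m + card ?F" by auto
  then show ?thesis by (auto simp: cong_def elim!: dvdE)
qed

lemma normal_meets_center:
  assumes H: "H \<lhd> G" "H \<noteq> {\<one>}"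
  obtains a where "a \<in> H" "a \<in> group_center G" "a \<noteq> \<one>"
proof -
  interpret H: normal H G by fact
  let ?f = "\<lambda>g. \<lambda>h\<in>H. g \<otimes> h \<otimes> inv g"
  have "{h \<in> H. \<forall>g \<in> carrier G. ?f g h = h} = H \<inter> group_center G"
    unfolding group_center_def using conj_eq_self_iff H.mem_carrier by auto
  then have cong: "[card H = card (H \<inter> group_center G)] (mod p)"
    using card_fixed_points_cong[OF conj_action_on_normal[OF H(1)]
          finite_subgroup[OF H.is_subgroup]]
    by simp
  obtain j where j: "card H = p ^ j" using card_subgroup_prime_power[OF H.is_subgroup] .
  have "j \<noteq> 0"
  proof
    assume "j = 0"
    then obtain y where "H = {y}" using j card_1_singletonE by auto
    then show False using H(2) H.one_closed by auto
  qed
  then have "H \<inter> group_center G \<noteq> {\<one>}" using cong j p_gt_1 by (auto simp: cong_def)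
  then show thesis using that H.one_closed subgroup.one_closed[OF group_center_subgroup] by blast
qed

lemma central_subgroup_of_prime_order_exists:
  assumes H: "H \<lhd> G" "H \<noteq> {\<one>}"
  obtains N where "N \<lhd> G" "N \<subseteq> H" "N \<subseteq> group_center G" "card N = p"
proof -
  have HZ: "subgroup (H \<inter> group_center G) G"
    using H(1) group_center_subgroup by (simp add: normal_imp_subgroup subgroups_Inter_pair)
  obtain a where a: "a \<in> H \<inter> group_center G" "a \<noteq> \<one>" using normal_meets_center[OF H] by blast
  then have ac: "a \<in> carrier G" using group_center_closed by blast
  have "ord a dvd p ^ k"
    using ord_dvd_group_order[OF ac] card_carrier by (simp add: Coset.order_def)
  then obtain j where j: "ord a = p ^ j" using divides_primepow_nat[OF prime] by blast
  have "j \<noteq> 0" using j a(2) ord_eq_1[OF ac] by (intro notI) simp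
  then obtain i where i: "j = Suc i" using not0_implies_Suc by blast
  let ?N = "generate G {a [^] (p ^ i)}"
  have pow: "a [^] (p ^ i) \<in> H \<inter> group_center G" using subgroup_nat_pow_closed[OF HZ a(1)] .
  have "ord (a [^] (p ^ i)) = p" using ord_pow[OF ac, of "p ^ i"] j i p_gt_1 by simp
  then have "card ?N = p" using generate_pow_card[of "a [^] (p ^ i)"] ac by simp
  moreover have N: "?N \<subseteq> H \<inter> group_center G" using generate_subgroup_incl[OF _ HZ] pow by blast
  moreover have "subgroup ?N G" using generate_is_subgroup[of "{a [^] (p ^ i)}"] ac by simp
  then have "?N \<lhd> G" using central_subgroup_normal N by blast
  ultimately show thesis using that by blast
qed

lemma normal_extend_by_p:
  assumes M: "M \<lhd> G" and H: "H \<lhd> G" "M \<subset> H"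
  obtains S where "S \<lhd> G" "M \<subseteq> S" "S \<subseteq> H" "S \<subseteq> center_mod G M" "card S = p * card M"
proof -
  interpret M: normal M G by fact
  interpret H: normal H G by fact
  obtain j where "pgroup (G Mod M) p j" using pgroup_Mod[OF M] .
  then interpret Q: pgroup "G Mod M" p j .
  interpret h: group_hom G "G Mod M" "\<lambda>x. M #> x" by (rule M.group_hom_Mod)
  have "(\<lambda>x. M #> x) ` H \<noteq> {\<one>\<^bsub>G Mod M\<^esub>}"
    using M.image_Mod_trivial_iff[OF H.is_subgroup] H(2) by blast
  then obtain N where N: "N \<lhd> G Mod M" "N \<subseteq> (\<lambda>x. M #> x) ` H"
      "N \<subseteq> group_center (G Mod M)" "card N = p"
    using Q.central_subgroup_of_prime_order_exists[OF h.normal_image[OF M.rcos_surj_Mod H(1)]]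
    by blast
  let ?S = "{x \<in> carrier G. M #> x \<in> N}"
  have S: "?S \<lhd> G" using h.normal_preimage[OF N(1)] .
  have MS: "M \<subseteq> ?S"
  proof
    fix x assume x: "x \<in> M"
    then have "M #> x = \<one>\<^bsub>G Mod M\<^esub>" using M.rcos_eq_one_Mod_iff[OF M.mem_carrier] by simp
    then have "M #> x \<in> N"
      using subgroup.one_closed[OF normal_imp_subgroup[OF N(1)]] by (rule ssubst)
    then show "x \<in> ?S" using x M.mem_carrier by blast
  qed
  have "(\<lambda>x. M #> x) ` ?S = N" using N(2) H.mem_carrier by blast
  then have "card ?S = p * card M"
    using M.card_image_Mod[OF normal_imp_subgroup[OF S] MS] N(4) by simp
  moreover have "?S \<subseteq> H"
  proof
    fix x assume x: "x \<in> ?S"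
    then obtain y where y: "y \<in> H" "M #> x = M #> y" using N(2) by blast
    then have "x \<in> M #> y" using rcos_self[OF _ M.is_subgroup] x by blast
    then show "x \<in> H" using y(1) H(2) unfolding r_coset_def by auto
  qed
  moreover have "?S \<subseteq> center_mod G M" using M.rcos_in_group_center_Mod_iff N(3) by blast
  ultimately show thesis using that S MS by blast
qed

lemma normal_subgroup_of_card_exists:
  assumes H: "H \<lhd> G" and card: "card H = p ^ j" and i: "i \<le> j"
  shows "\<exists>M. M \<lhd> G \<and> M \<subseteq> H \<and> card M = p ^ i"
  using i
proof (induction i)
  case 0
  show ?case
    using one_is_normal subgroup.one_closed[OF normal_imp_subgroup[OF H]]
    by (intro exI[of _ "{\<one>}"]) auto
next
  case (Suc i)
  then obtain M where M: "M \<lhd> G" "M \<subseteq> H" "card M = p ^ i" by auto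
  have "M \<noteq> H" using M(3) card Suc.prems p_gt_1 by auto
  then show ?case using normal_extend_by_p[OF M(1) H] M by (metis power_Suc psubsetI)
qed

lemma subset_if_card_p:
  assumes B: "subgroup B G" "card B = p" and D: "subgroup D G" and x: "x \<in> B" "x \<in> D" "x \<noteq> \<one>"
  shows "B \<subseteq> D"
  using subset_if_prime_index[OF finite_carrier prime triv_subgroup B(1) _ _ D _ x(1) _ x(2)]
    B(2) x(3) subgroup.one_closed[OF B(1)] subgroup.one_closed[OF D] by simp

lemma card_eq_or_p_times:
  assumes A: "subgroup A G" and B: "subgroup B G" "A \<subseteq> B" "card B \<le> p * card A"
  shows "card B = card A \<or> card B = p * card A"
proof -
  obtain i j where ij: "card A = p ^ i" "card B = p ^ j"
    using card_subgroup_prime_power A B by metis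
  have "p ^ i \<le> p ^ j"
    using card_subgroup_dvd[OF A B(1,2)] card_subgroup_pos[OF B(1)] ij by (metis dvd_imp_le)
  then have "i \<le> j" using p_gt_1 by simp
  have "p ^ j \<le> p ^ Suc i" using B(3) ij by simp
  then have "j \<le> Suc i" using p_gt_1 power_increasing_iff by blast
  then have "j = i \<or> j = Suc i" using \<open>i \<le> j\<close> by auto
  then show ?thesis using ij by auto
qed

lemma derived_subset_center_if_card_p:
  assumes "card (derived G (carrier G)) = p"
  shows "derived G (carrier G) \<subseteq> group_center G"
proof -
  have "derived G (carrier G) \<noteq> {\<one>}" using assms p_gt_1 by auto
  then obtain a where "a \<in> derived G (carrier G)" "a \<in> group_center G" "a \<noteq> \<one>"
    using normal_meets_center[OF derived_self_is_normal] by blast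
  then show ?thesis using subset_if_card_p[OF derived_subgroup assms group_center_subgroup] by blast
qed

lemma card_centralizer_if_central_mod:
  assumes N: "subgroup N G" "card N = p" and b: "b \<in> center_mod G N" "b \<notin> group_center G"
  shows "card (carrier G) = p * card (centralizer G b)"
proof -
  have bc: "b \<in> carrier G" using b center_mod_subset by auto
  note C = centralizer_subgroup[OF bc]
  let ?f = "\<lambda>g. \<lambda>h\<in>carrier G. g \<otimes> h \<otimes> inv g"
  interpret conj: group_action G "carrier G" ?f by (rule action_by_conjugation)
  have "orbit G ?f b \<subseteq> (\<lambda>n. n \<otimes> b) ` N"
    using b(1) commutator_in_subgroup_sym[OF N(1) bc] bc conj_eq_commutator_mult
    unfolding orbit_def center_mod_def by auto
  then have "card (orbit G ?f b) \<le> p" using surj_card_le[OF finite_subgroup[OF N(1)]] N(2) by simp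
  then have "card (orbit G ?f b) * card (centralizer G b) \<le> p * card (centralizer G b)"
    by (rule mult_le_mono1)
  moreover have "stabilizer G ?f b = centralizer G b"
    unfolding centralizer_def stabilizer_def using conj_eq_self_iff bc by auto
  then have "card (orbit G ?f b) * card (centralizer G b) = card (carrier G)"
    using conj.orbit_stabilizer_theorem[OF bc] by (simp add: Coset.order_def)
  ultimately have "card (carrier G) \<le> p * card (centralizer G b)" by simp
  then have "card (carrier G) = card (centralizer G b) \<or>
      card (carrier G) = p * card (centralizer G b)"
    using card_eq_or_p_times[OF C subgroup_self subgroup.subset[OF C]] by blast
  moreover have "card (carrier G) \<noteq> card (centralizer G b)"
  proof
    assume "card (carrier G) = card (centralizer G b)"
    then have "centralizer G b = carrier G"
      using finite_carrier subgroup.subset[OF C] by (intro card_subset_eq) auto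
    then have "g \<otimes> b = b \<otimes> g" if "g \<in> carrier G" for g using that unfolding centralizer_def by blast
    then have "b \<in> group_center G" unfolding group_center_def using bc by simp
    then show False using b(2) by simp
  qed
  ultimately show ?thesis by blast
qed

end

section \<open>Characters of irreducible representations\<close>

lemma mat_trace_mult_comm:
  assumes A: "A \<in> carrier_mat n m" and B: "B \<in> carrier_mat m n"
  shows "mat_trace (A * B) = mat_trace (B * A)"
proof -
  have "mat_trace (A * B) = (\<Sum>i<n. \<Sum>j<m. A $$ (i, j) * B $$ (j, i))"
    using A B unfolding mat_trace_def by (simp add: scalar_prod_def atLeast0LessThan)
  also have "\<dots> = (\<Sum>j<m. \<Sum>i<n. B $$ (j, i) * A $$ (i, j))"
    by (subst sum.swap) (simp add: mult.commute)
  also have "\<dots> = mat_trace (B * A)"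
    using A B unfolding mat_trace_def by (simp add: scalar_prod_def atLeast0LessThan)
  finally show ?thesis .
qed

lemma mat_trace_smult: "A \<in> carrier_mat n n \<Longrightarrow> mat_trace (c \<cdot>\<^sub>m A) = c * mat_trace A"
  unfolding mat_trace_def by (simp add: sum_distrib_left)

locale irrep = group G for G (structure) +
  fixes d :: nat and \<rho> :: "'a \<Rightarrow> complex mat"
  assumes finite_carrier: "finite (carrier G)" and irr: "is_irr_rep G d \<rho>"

lemma irrepI: "group G \<Longrightarrow> finite (carrier G) \<Longrightarrow> is_irr_rep G d \<rho> \<Longrightarrow> irrep G d \<rho>"
  unfolding irrep_def irrep_axioms_def by auto

context irrep
begin

lemma rep: "is_rep G d \<rho>" using irr unfolding is_irr_rep_def by auto

lemmas degree_pos = is_repD(1)[OF rep]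
  and rep_carrier = is_repD(2)[OF rep]
  and rep_mult = is_repD(3)[OF rep]
  and rep_one = is_repD(4)[OF rep]

lemma irr_char: "irr_char G (\<lambda>g. mat_trace (\<rho> g))"
  unfolding irr_char_def using irr by blast

lemma character_one: "mat_trace (\<rho> \<one>) = of_nat d"
  unfolding rep_one mat_trace_def by simp

lemma rep_mult_index:
  assumes "g \<in> carrier G" "h \<in> carrier G" "i < d" "j < d"
  shows "\<rho> (g \<otimes> h) $$ (i, j) = (\<Sum>k<d. \<rho> g $$ (i, k) * \<rho> h $$ (k, j))"
  using rep_mult[OF assms(1,2)] rep_carrier[OF assms(1)] rep_carrier[OF assms(2)] assms(3,4)
  by (simp add: scalar_prod_def atLeast0LessThan)

text \<open>
  The average of \<open>\<rho> g * E * \<rho> (inv g)\<close> over \<open>G\<close>, up to the factor \<open>|G|\<close>, for the matrix unit \<open>E\<close>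
  at \<open>(i, j)\<close>.
\<close>

definition averaged_unit :: "nat \<Rightarrow> nat \<Rightarrow> complex mat" where
  "averaged_unit i j = mat d d (\<lambda>(k, l). \<Sum>g\<in>carrier G. \<rho> g $$ (k, i) * \<rho> (inv g) $$ (j, l))"

lemma averaged_unit_carrier: "averaged_unit i j \<in> carrier_mat d d"
  unfolding averaged_unit_def by simp

lemma averaged_unit_commutes:
  assumes ij: "i < d" "j < d" and h: "h \<in> carrier G"
  shows "averaged_unit i j * \<rho> h = \<rho> h * averaged_unit i j"
proof (rule eq_matI)
  let ?T = "averaged_unit i j"
  fix k l assume "k < dim_row (\<rho> h * ?T)" "l < dim_col (\<rho> h * ?T)"
  then have kl: "k < d" "l < d" using rep_carrier[OF h] averaged_unit_carrier[of i j] by auto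
  have "(\<rho> h * ?T) $$ (k, l) =
      (\<Sum>m<d. \<rho> h $$ (k, m) * (\<Sum>g\<in>carrier G. \<rho> g $$ (m, i) * \<rho> (inv g) $$ (j, l)))"
    using kl rep_carrier[OF h] unfolding averaged_unit_def
    by (simp add: scalar_prod_def atLeast0LessThan)
  also have "\<dots> = (\<Sum>g\<in>carrier G. (\<Sum>m<d. \<rho> h $$ (k, m) * \<rho> g $$ (m, i)) * \<rho> (inv g) $$ (j, l))"
    by (simp add: sum_distrib_left sum_distrib_right mult.assoc) (rule sum.swap)
  also have "\<dots> = (\<Sum>g\<in>carrier G. \<rho> (h \<otimes> g) $$ (k, i) * \<rho> (inv g) $$ (j, l))"
    using kl ij h by (intro sum.cong) (auto simp: rep_mult_index)
  also have "\<dots> = (\<Sum>g\<in>carrier G. \<rho> g $$ (k, i) * \<rho> (inv g \<otimes> h) $$ (j, l))"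
  proof (rule sum.reindex_bij_witness[of _ "\<lambda>g. inv h \<otimes> g" "\<lambda>g. h \<otimes> g"])
    fix g assume g: "g \<in> carrier G"
    show "\<rho> (h \<otimes> g) $$ (k, i) * \<rho> (inv (h \<otimes> g) \<otimes> h) $$ (j, l) =
        \<rho> (h \<otimes> g) $$ (k, i) * \<rho> (inv g) $$ (j, l)"
      using g h by (simp add: inv_mult_group m_assoc)
  qed (use h in \<open>auto simp: m_assoc[symmetric]\<close>)
  also have "\<dots> = (\<Sum>g\<in>carrier G. \<rho> g $$ (k, i) * (\<Sum>m<d. \<rho> (inv g) $$ (j, m) * \<rho> h $$ (m, l)))"
    using kl ij h by (intro sum.cong) (auto simp: rep_mult_index)
  also have "\<dots> = (\<Sum>m<d. (\<Sum>g\<in>carrier G. \<rho> g $$ (k, i) * \<rho> (inv g) $$ (j, m)) * \<rho> h $$ (m, l))"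
    by (simp add: sum_distrib_left sum_distrib_right mult.assoc) (rule sum.swap)
  also have "\<dots> = (?T * \<rho> h) $$ (k, l)"
    using kl rep_carrier[OF h] unfolding averaged_unit_def
    by (simp add: scalar_prod_def atLeast0LessThan)
  finally show "(?T * \<rho> h) $$ (k, l) = (\<rho> h * ?T) $$ (k, l)" by simp
qed (use rep_carrier[OF h] averaged_unit_carrier[of i j] in auto)

lemma schur_orthogonality:
  assumes ij: "i < d" "j < d" and kl: "k < d" "l < d"
  shows "(\<Sum>g\<in>carrier G. \<rho> g $$ (k, i) * \<rho> (inv g) $$ (j, l)) =
    (if i = j \<and> k = l then of_nat (card (carrier G)) / of_nat d else 0)"
proof -
  let ?T = "averaged_unit i j"
  obtain c where c: "?T = c \<cdot>\<^sub>m 1\<^sub>m d"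
    using schur[OF irr averaged_unit_carrier averaged_unit_commutes[OF ij]] .
  have "(\<Sum>k<d. ?T $$ (k, k)) = (\<Sum>g\<in>carrier G. \<Sum>k<d. \<rho> (inv g) $$ (j, k) * \<rho> g $$ (k, i))"
    unfolding averaged_unit_def by (simp add: mult.commute) (rule sum.swap)
  also have "\<dots> = (\<Sum>g\<in>carrier G. \<rho> (inv g \<otimes> g) $$ (j, i))"
    using ij by (intro sum.cong refl rep_mult_index[symmetric]) auto
  also have "\<dots> = (if i = j then of_nat (card (carrier G)) else 0)"
    using ij by (simp add: rep_one)
  finally have "of_nat d * c = (if i = j then of_nat (card (carrier G)) else 0)"
    unfolding c by simp
  moreover have "(\<Sum>g\<in>carrier G. \<rho> g $$ (k, i) * \<rho> (inv g) $$ (j, l)) = ?T $$ (k, l)"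
    unfolding averaged_unit_def using kl by simp
  ultimately show ?thesis unfolding c using kl degree_pos by (auto simp: field_simps)
qed

lemma character_eq: "g \<in> carrier G \<Longrightarrow> mat_trace (\<rho> g) = (\<Sum>i<d. \<rho> g $$ (i, i))"
  unfolding mat_trace_def using rep_carrier by (metis carrier_matD(1))

lemma character_norm:
  "(\<Sum>g\<in>carrier G. mat_trace (\<rho> g) * mat_trace (\<rho> (inv g))) = of_nat (card (carrier G))"
proof -
  have "(\<Sum>g\<in>carrier G. mat_trace (\<rho> g) * mat_trace (\<rho> (inv g))) =
     (\<Sum>g\<in>carrier G. \<Sum>i<d. \<Sum>j<d. \<rho> g $$ (i, i) * \<rho> (inv g) $$ (j, j))"
    by (intro sum.cong) (auto simp: character_eq sum_product)
  also have "\<dots> = (\<Sum>i<d. \<Sum>j<d. \<Sum>g\<in>carrier G. \<rho> g $$ (i, i) * \<rho> (inv g) $$ (j, j))"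
    by (subst sum.swap, intro sum.cong refl, rule sum.swap)
  also have "\<dots> = (\<Sum>i<d. \<Sum>j<d. if i = j then of_nat (card (carrier G)) / of_nat d else 0)"
    by (intro sum.cong refl) (simp add: schur_orthogonality)
  also have "\<dots> = of_nat (card (carrier G))" using degree_pos by simp
  finally show ?thesis .
qed

text \<open>
  \<open>char_center\<close> and \<open>char_ker\<close> are the center \<open>Z(\<chi>)\<close> and the kernel of the character \<open>\<chi>\<close> of \<open>\<rho>\<close>, and
  \<open>central_char\<close> is the linear character \<open>\<lambda>\<close> of \<open>Z(\<chi>)\<close> with \<open>\<chi> = d * \<lambda>\<close>; its values elsewhere are
  meaningless.
\<close>

definition char_center :: "'a set" where
  "char_center = {x \<in> carrier G. \<exists>\<mu>. \<rho> x = \<mu> \<cdot>\<^sub>m 1\<^sub>m d}"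

definition central_char :: "'a \<Rightarrow> complex" where
  "central_char x = \<rho> x $$ (0, 0)"

definition char_ker :: "'a set" where
  "char_ker = {x \<in> carrier G. \<rho> x = 1\<^sub>m d}"

lemma central_char_eqI: "\<rho> x = \<mu> \<cdot>\<^sub>m 1\<^sub>m d \<Longrightarrow> central_char x = \<mu>"
  unfolding central_char_def using degree_pos by simp

lemma char_centerI: "x \<in> carrier G \<Longrightarrow> \<rho> x = \<mu> \<cdot>\<^sub>m 1\<^sub>m d \<Longrightarrow> x \<in> char_center"
  unfolding char_center_def by auto

lemma char_centerD:
  assumes "x \<in> char_center"
  shows "x \<in> carrier G" "\<rho> x = central_char x \<cdot>\<^sub>m 1\<^sub>m d"
  using assms central_char_eqI unfolding char_center_def by auto

lemma rep_char_center_mult: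
  assumes "x \<in> char_center" "y \<in> carrier G"
  shows "\<rho> (x \<otimes> y) = central_char x \<cdot>\<^sub>m \<rho> y" "\<rho> (y \<otimes> x) = central_char x \<cdot>\<^sub>m \<rho> y"
  using rep_mult rep_carrier[OF assms(2)] char_centerD[OF assms(1)] assms(2)
  by (simp_all add: mult_smult_assoc_mat[of _ d d _ d] mult_smult_distrib[of _ d d _ d])

lemma char_ker_iff: "x \<in> char_ker \<longleftrightarrow> x \<in> char_center \<and> central_char x = 1"
proof -
  have one: "1 \<cdot>\<^sub>m 1\<^sub>m d = (1\<^sub>m d :: complex mat)" by auto
  show ?thesis
    unfolding char_ker_def char_center_def using central_char_eqI[of x] one by fastforce
qed

lemma one_in_char_center: "\<one> \<in> char_center" and central_char_one: "central_char \<one> = 1"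
  using char_ker_iff[of \<one>] rep_one unfolding char_ker_def by auto

lemma char_center_mult:
  assumes "x \<in> char_center" "y \<in> char_center"
  shows "x \<otimes> y \<in> char_center" "central_char (x \<otimes> y) = central_char x * central_char y"
proof -
  have "\<rho> (x \<otimes> y) = (central_char x * central_char y) \<cdot>\<^sub>m 1\<^sub>m d"
    using rep_char_center_mult(1)[OF assms(1) char_centerD(1)[OF assms(2)]]
      char_centerD(2)[OF assms(2)]
    by (auto intro!: eq_matI)
  then show "x \<otimes> y \<in> char_center" "central_char (x \<otimes> y) = central_char x * central_char y"
    using char_centerI central_char_eqI char_centerD(1) assms by auto
qed

lemma char_center_inv:
  assumes "x \<in> char_center"
  shows "inv x \<in> char_center" "central_char (inv x) = inverse (central_char x)" "central_char x \<noteq> 0"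
proof -
  have x: "x \<in> carrier G" using assms char_centerD by auto
  note \<rho>x = rep_carrier[OF inv_closed[OF x]]
  have one: "1\<^sub>m d = central_char x \<cdot>\<^sub>m \<rho> (inv x)"
    using rep_char_center_mult(1)[OF assms inv_closed[OF x]] x rep_one by simp
  then have "(1\<^sub>m d :: complex mat) $$ (0, 0) = (central_char x \<cdot>\<^sub>m \<rho> (inv x)) $$ (0, 0)" by simp
  then show nz: "central_char x \<noteq> 0" using degree_pos \<rho>x by auto
  have "\<rho> (inv x) = inverse (central_char x) \<cdot>\<^sub>m (central_char x \<cdot>\<^sub>m \<rho> (inv x))"
    using nz \<rho>x by (intro eq_matI) auto
  then have "\<rho> (inv x) = inverse (central_char x) \<cdot>\<^sub>m 1\<^sub>m d" using one by simp
  then show "inv x \<in> char_center" "central_char (inv x) = inverse (central_char x)"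
    using char_centerI central_char_eqI x by auto
qed

lemma char_center_nat_pow:
  assumes "x \<in> char_center"
  shows "x [^] (n::nat) \<in> char_center" "central_char (x [^] n) = central_char x ^ n"
  using assms
  by (induction n) (auto simp: one_in_char_center central_char_one char_center_mult mult.commute)

lemma char_center_subgroup: "subgroup char_center G"
  by (rule subgroupI) (use one_in_char_center char_center_mult char_center_inv char_centerD in auto)

lemma char_ker_subgroup: "subgroup char_ker G"
proof (rule subgroupI)
  show "char_ker \<noteq> {}" using char_ker_iff[of \<one>] one_in_char_center central_char_one by auto
qed (auto simp: char_ker_iff char_center_mult char_center_inv char_centerD)

lemma char_ker_subset_char_center: "char_ker \<subseteq> char_center"
  using char_ker_iff by blast

lemma character_on_char_center: "x \<in> char_center \<Longrightarrow> mat_trace (\<rho> x) = of_nat d * central_char x"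
  using char_centerD by (simp add: mat_trace_def)

lemma rep_cancel:
  assumes "x \<in> carrier G" "y \<in> carrier G"
  shows "\<rho> (x \<otimes> y) = \<rho> y \<longleftrightarrow> x \<in> char_ker"
proof
  assume eq: "\<rho> (x \<otimes> y) = \<rho> y"
  have "\<rho> x = \<rho> (x \<otimes> y \<otimes> inv y)" using assms by (simp add: m_assoc)
  also have "\<dots> = \<rho> (x \<otimes> y) * \<rho> (inv y)" using assms by (intro rep_mult) auto
  also have "\<dots> = \<rho> (y \<otimes> inv y)" unfolding eq using assms by (intro rep_mult[symmetric]) auto
  finally show "x \<in> char_ker" using assms rep_one unfolding char_ker_def by simp
qed (use rep_mult[OF assms] rep_carrier[OF assms(2)] in \<open>auto simp: char_ker_def\<close>)

lemma char_center_iff_commutator: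
  assumes x: "x \<in> carrier G"
  shows "x \<in> char_center \<longleftrightarrow> (\<forall>g \<in> carrier G. commutator G x g \<in> char_ker)"
proof -
  have "x \<in> char_center \<longleftrightarrow> (\<forall>g \<in> carrier G. \<rho> (x \<otimes> g) = \<rho> (g \<otimes> x))"
  proof
    assume "\<forall>g \<in> carrier G. \<rho> (x \<otimes> g) = \<rho> (g \<otimes> x)"
    then obtain \<mu> where "\<rho> x = \<mu> \<cdot>\<^sub>m 1\<^sub>m d"
      using rep_mult x schur[OF irr rep_carrier[OF x]] by metis
    then show "x \<in> char_center" using x char_centerI by blast
  qed (use rep_char_center_mult in auto)
  also have "\<dots> \<longleftrightarrow> (\<forall>g \<in> carrier G. commutator G x g \<in> char_ker)"
  proof -
    have "\<rho> (x \<otimes> g) = \<rho> (g \<otimes> x) \<longleftrightarrow> commutator G x g \<in> char_ker" if "g \<in> carrier G" for g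
      using rep_cancel[of "commutator G x g" "g \<otimes> x"] commutator_mult[OF x that] x that by simp
    then show ?thesis by blast
  qed
  finally show ?thesis .
qed

lemma char_center_eq_center_mod: "char_center = center_mod G char_ker"
  unfolding center_mod_def using char_center_iff_commutator char_centerD(1) by blast

lemma group_center_subset_char_center: "group_center G \<subseteq> char_center"
  unfolding group_center_eq_center_mod char_center_eq_center_mod center_mod_def
  using subgroup.one_closed[OF char_ker_subgroup] by auto

lemma rep_conj_eq_smult:
  assumes g: "g \<in> carrier G" and x: "x \<in> carrier G" and c: "commutator G g x \<in> char_center"
  shows "\<rho> (g \<otimes> x \<otimes> inv g) = central_char (commutator G g x) \<cdot>\<^sub>m \<rho> x"
  using conj_eq_commutator_mult[OF g x] rep_char_center_mult(1)[OF c x] by simp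

lemma character_conj:
  assumes g: "g \<in> carrier G" and x: "x \<in> carrier G"
  shows "mat_trace (\<rho> (g \<otimes> x \<otimes> inv g)) = mat_trace (\<rho> x)"
proof -
  have "mat_trace (\<rho> (g \<otimes> x \<otimes> inv g)) = mat_trace (\<rho> (inv g) * \<rho> (g \<otimes> x))"
    using rep_mult[of "g \<otimes> x" "inv g"] mat_trace_mult_comm[OF rep_carrier rep_carrier] g x by simp
  also have "\<dots> = mat_trace (\<rho> x)"
    using rep_mult[of "inv g" "g \<otimes> x"] g x by (simp add: m_assoc[symmetric])
  finally show ?thesis .
qed

lemma character_zero_off_char_center:
  assumes comm: "derived G (carrier G) \<subseteq> char_center" and x: "x \<in> carrier G" "x \<notin> char_center"
  shows "mat_trace (\<rho> x) = 0"
proof -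
  obtain g where g: "g \<in> carrier G" "commutator G x g \<notin> char_ker"
    using char_center_iff_commutator x by blast
  let ?c = "commutator G g x"
  have c: "?c \<in> char_center" using comm commutator_in_derived g x by blast
  have "central_char ?c \<noteq> 1"
    using c g(2) char_ker_iff commutator_in_subgroup_sym[OF char_ker_subgroup g(1) x(1)] by blast
  moreover have "mat_trace (\<rho> x) = central_char ?c * mat_trace (\<rho> x)"
    using character_conj[OF g(1) x(1)] rep_conj_eq_smult[OF g(1) x(1) c]
    by (simp add: mat_trace_smult[OF rep_carrier[OF x(1)]])
  ultimately show ?thesis by simp
qed

lemma degree_square:
  assumes comm: "derived G (carrier G) \<subseteq> char_center"
  shows "d\<^sup>2 * card char_center = card (carrier G)"
proof -
  have sub: "char_center \<subseteq> carrier G" using char_centerD by auto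
  have "of_nat (card (carrier G)) = (\<Sum>g\<in>char_center. mat_trace (\<rho> g) * mat_trace (\<rho> (inv g)))"
    unfolding character_norm[symmetric]
    by (rule sum.mono_neutral_right)
      (use finite_carrier sub character_zero_off_char_center[OF comm] in auto)
  also have "\<dots> = (\<Sum>g\<in>char_center. (of_nat d)\<^sup>2)"
    using char_center_inv by (intro sum.cong) (auto simp: character_on_char_center power2_eq_square)
  also have "\<dots> = of_nat (d\<^sup>2 * card char_center)" by simp
  finally show ?thesis by (metis of_nat_eq_iff)
qed

lemma degree_one_iff: "d = 1 \<longleftrightarrow> derived G (carrier G) \<subseteq> char_ker"
proof
  assume d: "d = 1"
  have "\<rho> x = \<rho> x $$ (0, 0) \<cdot>\<^sub>m 1\<^sub>m d" if "x \<in> carrier G" for x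
    using rep_carrier[OF that] d by (intro eq_matI) auto
  then have "x \<in> char_center" if "x \<in> carrier G" for x using char_centerI that by blast
  then show "derived G (carrier G) \<subseteq> char_ker"
    using char_center_iff_commutator unfolding derived_subset_iff[OF char_ker_subgroup] by blast
next
  assume comm: "derived G (carrier G) \<subseteq> char_ker"
  then have "char_center = carrier G"
    using char_center_iff_commutator char_centerD unfolding derived_subset_iff[OF char_ker_subgroup]
    by blast
  then have "d\<^sup>2 * card (carrier G) = card (carrier G)"
    using degree_square comm char_ker_subset_char_center by simp
  then show "d = 1" using finite_carrier one_closed by (auto simp: card_eq_0_iff)
qed

lemma central_char_commutator_pow_degree:
  assumes g: "g \<in> carrier G" and x: "x \<in> carrier G" and c: "commutator G g x \<in> char_center"
  shows "central_char (commutator G g x) ^ d = 1"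
proof -
  have det_mult: "det (\<rho> (y \<otimes> z)) = det (\<rho> y) * det (\<rho> z)" if "y \<in> carrier G" "z \<in> carrier G"
    for y z
    using rep_mult that det_mult[OF rep_carrier rep_carrier] by simp
  have det_inv: "det (\<rho> y) * det (\<rho> (inv y)) = 1" if "y \<in> carrier G" for y
    using det_mult[OF that inv_closed[OF that]] that rep_one by simp
  have "det (\<rho> (g \<otimes> x \<otimes> inv g)) = (det (\<rho> g) * det (\<rho> (inv g))) * det (\<rho> x)"
    using g x det_mult by simp
  then have "det (\<rho> (g \<otimes> x \<otimes> inv g)) = det (\<rho> x)" using det_inv g by simp
  then have "central_char (commutator G g x) ^ d * det (\<rho> x) = det (\<rho> x)"
    using rep_carrier[OF x] rep_conj_eq_smult[OF g x c] by (simp add: det_smult)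
  moreover have "det (\<rho> x) \<noteq> 0" using det_inv[OF x] by auto
  ultimately show ?thesis by simp
qed

lemma prime_dvd_degree:
  fixes p :: nat
  assumes p: "prime p" and card: "card (carrier G) = p ^ k"
    and g: "g \<in> carrier G" and x: "x \<in> carrier G"
    and c: "commutator G g x \<in> char_center" "commutator G g x \<notin> char_ker"
  shows "p dvd d"
proof (rule ccontr)
  let ?u = "central_char (commutator G g x)"
  assume "\<not> p dvd d"
  then have "coprime d (card (carrier G))"
    using prime_imp_power_coprime[OF p] card by (simp add: coprime_commute)
  moreover have "?u ^ card (carrier G) = 1"
    using char_center_nat_pow(2)[OF c(1), of "card (carrier G)"]
      pow_order_eq_1[of "commutator G g x"] g x central_char_one
    by (simp add: Coset.order_def)
  ultimately have "?u = 1"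
    using power_gcd_eq_1[OF central_char_commutator_pow_degree[OF g x c(1)], of "card (carrier G)"]
    by (simp add: coprime_iff_gcd_eq_1)
  then show False using c char_ker_iff by blast
qed

lemma central_char_eq_iff:
  assumes x: "x \<in> char_center" and y: "y \<in> char_center"
  shows "central_char x = central_char y \<longleftrightarrow> inv x \<otimes> y \<in> char_ker"
proof -
  have "inv x \<otimes> y \<in> char_ker \<longleftrightarrow> inverse (central_char x) * central_char y = 1"
    unfolding char_ker_iff
    using char_center_mult[OF char_center_inv(1)[OF x] y] char_center_inv(2)[OF x] by simp
  then show ?thesis using char_center_inv(3)[OF x] by (auto simp: field_simps)
qed

lemma card_eq_card_central_char_image:
  assumes S: "subgroup S G" "char_ker \<subseteq> S" "S \<subseteq> char_center"
  shows "card S = card (central_char ` S) * card char_ker"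
proof -
  interpret S: subgroup S G by fact
  note Sc = subgroup.mem_carrier[OF S(1)]
  have fin: "finite S" using finite_subset[OF S.subset finite_carrier] .
  have fiber: "card {y \<in> S. central_char y = central_char x} = card char_ker" if x: "x \<in> S" for x
  proof -
    have "bij_betw (\<lambda>k. x \<otimes> k) char_ker {y \<in> S. central_char y = central_char x}"
    proof (rule bij_betwI[where g = "\<lambda>y. inv x \<otimes> y"])
      show "(\<lambda>k. x \<otimes> k) \<in> char_ker \<rightarrow> {y \<in> S. central_char y = central_char x}"
        using x S char_ker_iff char_center_mult by auto
      have "inv x \<otimes> y \<in> char_ker" if "y \<in> S" "central_char y = central_char x" for y
        using central_char_eq_iff[of x y] subsetD[OF S(3)] x that by simp
      then show "(\<lambda>y. inv x \<otimes> y) \<in> {y \<in> S. central_char y = central_char x} \<rightarrow> char_ker" by blast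
    qed (use x Sc S(2) in \<open>auto simp: m_assoc[symmetric]\<close>)
    then show ?thesis using bij_betw_same_card by metis
  qed
  have "card S = (\<Sum>u\<in>central_char ` S. card {y \<in> S. central_char y = u})"
    using sum.image_gen[OF fin, of "\<lambda>_. 1::nat" central_char] by simp
  also have "\<dots> = (\<Sum>u\<in>central_char ` S. card char_ker)" using fiber by (intro sum.cong) auto
  finally show ?thesis by simp
qed

lemma card_char_center_le:
  assumes Z: "subgroup Z G" "char_ker \<subseteq> Z" "Z \<subseteq> char_center" and n: "n > 0"
    and pow: "\<And>x. x \<in> char_center \<Longrightarrow> x [^] n \<in> Z"
  shows "card char_center \<le> n * card Z"
proof -
  have fin: "finite char_center" "finite Z"
    using finite_subset[OF subgroup.subset finite_carrier] char_center_subgroup Z(1) by auto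
  have nz: "w \<noteq> 0" if "w \<in> central_char ` Z" for w using char_center_inv(3) Z(3) that by auto
  have "central_char ` char_center \<subseteq> (\<Union>w\<in>central_char ` Z. {u. u ^ n = w})"
  proof
    fix u assume "u \<in> central_char ` char_center"
    then obtain x where "x \<in> char_center" "u = central_char x" by blast
    then have "x [^] n \<in> Z" "u ^ n = central_char (x [^] n)"
      using pow char_center_nat_pow(2) by auto
    then show "u \<in> (\<Union>w\<in>central_char ` Z. {u. u ^ n = w})" by blast
  qed
  then have "card (central_char ` char_center) \<le> card (\<Union>w\<in>central_char ` Z. {u. u ^ n = w})"
    using fin nz n by (intro card_mono) (auto intro!: finite_UN_I finite_nth_roots)
  also have "\<dots> \<le> (\<Sum>w\<in>central_char ` Z. card {u. u ^ n = w})" using fin by (intro card_UN_le) auto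
  also have "\<dots> = card (central_char ` Z) * n" using nz n by (simp add: card_nth_roots)
  finally have "card (central_char ` char_center) * card char_ker \<le>
      (card (central_char ` Z) * n) * card char_ker" by simp
  then show ?thesis
    using card_eq_card_central_char_image[OF char_center_subgroup char_ker_subset_char_center
          subset_refl]
      card_eq_card_central_char_image[OF Z] by (simp add: mult.commute mult.left_commute)
qed

lemma central_char_inj_on:
  assumes S: "subgroup S G" "S \<subseteq> char_center" "S \<inter> char_ker \<subseteq> {\<one>}"
  shows "inj_on central_char S"
proof (rule inj_onI)
  interpret S: subgroup S G by fact
  fix x y assume xy: "x \<in> S" "y \<in> S" "central_char x = central_char y"
  have "inv x \<otimes> y \<in> S \<inter> char_ker"
    using central_char_eq_iff[of x y] subsetD[OF S(2)] xy by simp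
  then have "inv x \<otimes> y = \<one>" using S(3) by blast
  then show "x = y"
    using S.mem_carrier[OF xy(1)] S.mem_carrier[OF xy(2)] by (metis inv_closed inv_equality inv_inv)
qed

lemma central_char_image_eq_roots_of_unity:
  assumes S: "subgroup S G" "S \<subseteq> char_center" and inj: "inj_on central_char S"
  shows "central_char ` S = {u. u ^ card S = 1}"
proof -
  have card_pos: "card S > 0" by (rule subgroup.finite_imp_card_positive[OF S(1) finite_carrier])
  have "central_char x ^ card S = 1" if "x \<in> S" for x
    using char_center_nat_pow(2)[OF subsetD[OF S(2) that], of "card S"]
      pow_card_subgroup_eq_one[OF S(1) that]
    by (simp add: central_char_one)
  then have "central_char ` S \<subseteq> {u. u ^ card S = 1}" by blast
  moreover have "card (central_char ` S) = card {u::complex. u ^ card S = 1}"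
    using inj card_pos by (simp add: card_image card_nth_roots)
  ultimately show ?thesis using card_subset_eq finite_nth_roots[OF card_pos] by blast
qed

lemma faithful_central_subgroup_cyclic:
  assumes S: "subgroup S G" "S \<subseteq> char_center" "S \<inter> char_ker \<subseteq> {\<one>}"
  shows "cyclic_subset G S"
proof -
  have card_pos: "card S > 0" by (rule subgroup.finite_imp_card_positive[OF S(1) finite_carrier])
  let ?\<zeta> = "cis (2 * pi / real (card S))"
  note \<zeta> = primitive_root_cis[OF card_pos] and inj = central_char_inj_on[OF S]
  note image = central_char_image_eq_roots_of_unity[OF S(1,2) inj]
  have "?\<zeta> \<in> central_char ` S"
    unfolding image using primitive_root_power_eq_1_iff[OF \<zeta>, of "card S"] by simp
  then obtain z where z: "z \<in> S" "central_char z = ?\<zeta>" by auto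
  have "S \<subseteq> generate G {z}"
  proof
    fix y assume y: "y \<in> S"
    then obtain i where "central_char y = ?\<zeta> ^ i"
      using image roots_of_unity_eq_powers[OF card_pos \<zeta>] by blast
    then have "central_char y = central_char (z [^] i)"
      using char_center_nat_pow(2)[of z i] z S(2) by auto
    then have "y = z [^] i" using inj_onD[OF inj] y z(1) subgroup_nat_pow_closed[OF S(1)] by blast
    then show "y \<in> generate G {z}"
      using subgroup_nat_pow_closed[OF generate_is_subgroup] subgroup.mem_carrier[OF S(1) z(1)]
        generate.incl[of z "{z}" G] by simp
  qed
  then show ?thesis
    unfolding cyclic_subset_def using generate_subgroup_incl[OF _ S(1), of "{z}"] z(1) by blast
qed

lemma linear_subrep_of_restriction:
  assumes C: "subgroup C G" and comm: "\<And>x y. x \<in> C \<Longrightarrow> y \<in> C \<Longrightarrow> commutator G x y \<in> char_ker"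
  obtains \<tau> B where "rep_embedding (G\<lparr>carrier := C\<rparr>) d \<rho> 1 \<tau> B"
proof -
  let ?H = "G\<lparr>carrier := C\<rparr>"
  have H: "group ?H" by (rule subgroup_imp_group[OF C])
  have repH: "is_rep ?H d \<rho>"
    unfolding is_rep_def using degree_pos rep_carrier rep_mult rep_one subgroup.mem_carrier[OF C]
    by auto
  have "invariant_subspace ?H d \<rho> (carrier_vec d)"
    unfolding invariant_subspace_def
    using is_subspace_carrier_vec mult_mat_vec_carrier[OF is_repD(2)[OF repH]] by blast
  moreover have "carrier_vec d \<noteq> {0\<^sub>v d :: complex vec}"
    using degree_pos by (metis singletonD unit_vec_carrier unit_vec_nonzero)
  ultimately obtain f \<tau> B where \<tau>: "is_irr_rep ?H f \<tau>" and B: "rep_embedding ?H d \<rho> f \<tau> B"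
    using irr_subrep_exists[OF H repH] by metis
  interpret H: irrep ?H f \<tau>
    using irrepI[OF H _ \<tau>] finite_subset[OF subgroup.subset[OF C] finite_carrier] by simp
  have "commutator ?H x y \<in> H.char_ker" if x: "x \<in> C" and y: "y \<in> C" for x y
  proof -
    have eq: "commutator ?H x y = commutator G x y" using commutator_restrict_carrier[OF C x y] .
    have c: "commutator G x y \<in> C" using H.commutator_closed[of x y] x y eq by simp
    have "B * \<tau> (commutator G x y) = B * 1\<^sub>m f"
      using rep_embeddingD(3)[OF B] rep_embeddingD(4)[OF B, of "commutator G x y"] c comm[OF x y]
      unfolding char_ker_def by simp
    then have "\<tau> (commutator G x y) = 1\<^sub>m f"
      using inj_mat_mult_cancel[OF rep_embeddingD(2)[OF B] H.rep_carrier one_carrier_mat] c by simp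
    then show ?thesis unfolding H.char_ker_def eq using c by simp
  qed
  then have "f = 1" unfolding H.degree_one_iff H.derived_subset_iff[OF H.char_ker_subgroup] by simp
  then show thesis using that B by blast
qed

lemma common_eigenvector:
  assumes C: "subgroup C G" and comm: "\<And>x y. x \<in> C \<Longrightarrow> y \<in> C \<Longrightarrow> commutator G x y \<in> char_ker"
  obtains v where "v \<in> carrier_vec d" "v \<noteq> 0\<^sub>v d" "\<And>c. c \<in> C \<Longrightarrow> \<exists>\<nu>. \<rho> c *\<^sub>v v = \<nu> \<cdot>\<^sub>v v"
proof -
  obtain \<tau> B where B: "rep_embedding (G\<lparr>carrier := C\<rparr>) d \<rho> 1 \<tau> B"
    by (rule linear_subrep_of_restriction[OF C comm])
  note Bc = rep_embeddingD(3)[OF B]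
  define u :: "complex vec" where "u = unit_vec 1 0"
  have u: "u \<in> carrier_vec 1" "u \<noteq> 0\<^sub>v 1" unfolding u_def by (auto simp: unit_vec_nonzero)
  show thesis
  proof
    show "B *\<^sub>v u \<in> carrier_vec d" using Bc u by simp
    show "B *\<^sub>v u \<noteq> 0\<^sub>v d" using rep_embeddingD(2)[OF B] u unfolding inj_mat_def by blast
    show "\<exists>\<nu>. \<rho> c *\<^sub>v (B *\<^sub>v u) = \<nu> \<cdot>\<^sub>v (B *\<^sub>v u)" if c: "c \<in> C" for c
    proof -
      have \<tau>c: "\<tau> c \<in> carrier_mat 1 1" using is_repD(2)[OF rep_embeddingD(1)[OF B]] c by simp
      have "\<rho> c *\<^sub>v (B *\<^sub>v u) = B *\<^sub>v (\<tau> c *\<^sub>v u)"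
        using assoc_mult_mat_vec[OF rep_carrier[OF subgroup.mem_carrier[OF C c]] Bc u(1)]
          assoc_mult_mat_vec[OF Bc \<tau>c u(1)] rep_embeddingD(4)[OF B, of c] c by simp
      also have "\<tau> c *\<^sub>v u = \<tau> c $$ (0, 0) \<cdot>\<^sub>v u"
        unfolding u_def using \<tau>c by (intro eq_vecI) (auto simp: scalar_prod_right_unit)
      finally show ?thesis using mult_mat_vec[OF Bc u(1)] by auto
    qed
  qed
qed

lemma degree_le_card_spanning:
  assumes fin: "finite S" and S: "S \<subseteq> carrier_vec d"
    and closed: "\<And>g w. g \<in> carrier G \<Longrightarrow> w \<in> S \<Longrightarrow> \<rho> g *\<^sub>v w \<in> vec_span d S"
    and v: "v \<in> vec_span d S" "v \<noteq> 0\<^sub>v d"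
  shows "d \<le> card S"
proof -
  have "vec_span d S \<subseteq> {w \<in> carrier_vec d. \<rho> g *\<^sub>v w \<in> vec_span d S}" if g: "g \<in> carrier G" for g
    by (rule vec_span_minimal[OF is_subspace_preimage[OF rep_carrier[OF g]
          is_subspace_vec_span[OF S]]])
      (use S closed[OF g] in blast)
  then have "invariant_subspace G d \<rho> (vec_span d S)"
    unfolding invariant_subspace_def using is_subspace_vec_span[OF S] by blast
  then have "vec_span d S = carrier_vec d" using irr v unfolding is_irr_rep_iff by blast
  then show ?thesis by (rule card_ge_if_vec_span_eq[OF fin S])
qed

text \<open>
  The translates of a common eigenvector of \<open>C\<close> by coset representatives span an invariant subspace.
\<close>

lemma degree_le_index:
  assumes C: "subgroup C G" and comm: "\<And>x y. x \<in> C \<Longrightarrow> y \<in> C \<Longrightarrow> commutator G x y \<in> char_ker"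
  shows "d \<le> card (rcosets C)"
proof -
  note Cc = subgroup.mem_carrier[OF C]
  obtain v where v: "v \<in> carrier_vec d" "v \<noteq> 0\<^sub>v d" and eigen: "\<And>c. c \<in> C \<Longrightarrow> \<exists>\<nu>. \<rho> c *\<^sub>v v = \<nu> \<cdot>\<^sub>v v"
    using common_eigenvector[OF C comm] by blast
  obtain R where R: "finite R" "R \<subseteq> carrier G" "card R \<le> card (rcosets C)"
    and transversal: "\<And>x. x \<in> carrier G \<Longrightarrow> \<exists>c \<in> C. \<exists>r \<in> R. x = c \<otimes> r"
    using right_transversal_exists[OF C finite_carrier] by metis
  define u where "u x = \<rho> (inv x) *\<^sub>v v" for x
  have u_carrier: "u x \<in> carrier_vec d" if "x \<in> carrier G" for x
    unfolding u_def using rep_carrier[OF inv_closed[OF that]] v(1) by simp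
  have u_mult: "u (x \<otimes> y) = \<rho> (inv y) *\<^sub>v u x" if "x \<in> carrier G" "y \<in> carrier G" for x y
    unfolding u_def
    using that assoc_mult_mat_vec[OF rep_carrier rep_carrier v(1), of "inv y" "inv x"]
    by (simp add: inv_mult_group rep_mult)
  have S: "u ` R \<subseteq> carrier_vec d" using u_carrier R(2) by blast
  have u_span: "u x \<in> vec_span d (u ` R)" if x: "x \<in> carrier G" for x
  proof -
    obtain c r where c: "c \<in> C" and r: "r \<in> R" and x_eq: "x = c \<otimes> r"
      using transversal[OF x] by blast
    note rc = subsetD[OF R(2) r]
    obtain \<nu> where "u c = \<nu> \<cdot>\<^sub>v v"
      using eigen[of "inv c"] subgroup.m_inv_closed[OF C c] unfolding u_def by blast
    then have "u x = \<nu> \<cdot>\<^sub>v u r"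
      using u_mult[OF Cc[OF c] rc] x_eq mult_mat_vec[OF rep_carrier[OF inv_closed[OF rc]] v(1)]
      unfolding u_def by simp
    moreover have "u r \<in> vec_span d (u ` R)" using vec_span_superset[OF S] r by blast
    ultimately show ?thesis using is_subspace_vec_span[OF S] unfolding is_subspace_def by simp
  qed
  have "d \<le> card (u ` R)"
  proof (rule degree_le_card_spanning[OF finite_imageI[OF R(1)] S])
    show "v \<in> vec_span d (u ` R)"
      using u_span[OF one_closed] v(1) unfolding u_def by (simp add: rep_one)
    fix g w assume g: "g \<in> carrier G" and "w \<in> u ` R"
    then obtain x where x: "x \<in> carrier G" "w = u x" using R(2) by blast
    then show "\<rho> g *\<^sub>v w \<in> vec_span d (u ` R)"
      using u_mult[OF x(1) inv_closed[OF g]] u_span[of "x \<otimes> inv g"] g by simp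
  qed (rule v(2))
  also have "\<dots> \<le> card (rcosets C)" using card_image_le[OF R(1)] R(3) by (rule order.trans)
  finally show ?thesis .
qed

end

section \<open>Existence and twisting of irreducible representations\<close>

lemma is_irr_rep_inflate:
  assumes "M \<lhd> G" and irr: "is_irr_rep (G Mod M) d \<rho>"
  shows "is_irr_rep G d (\<lambda>x. \<rho> (M #>\<^bsub>G\<^esub> x))"
proof -
  interpret M: normal M G by fact
  interpret h: group_hom G "G Mod M" "\<lambda>x. M #>\<^bsub>G\<^esub> x" by (rule M.group_hom_Mod)
  have rep: "is_rep (G Mod M) d \<rho>" using irr unfolding is_irr_rep_def by blast
  have "is_rep G d (\<lambda>x. \<rho> (M #>\<^bsub>G\<^esub> x))"
    unfolding is_rep_def using is_repD[OF rep] h.hom_closed h.hom_mult h.hom_one by metis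
  moreover have "invariant_subspace (G Mod M) d \<rho> W"
    if "invariant_subspace G d (\<lambda>x. \<rho> (M #>\<^bsub>G\<^esub> x)) W" for W
    using that unfolding invariant_subspace_def carrier_FactGroup by blast
  ultimately show ?thesis using irr unfolding is_irr_rep_iff by blast
qed

lemma (in group) irrep_separating:
  assumes fin: "finite (carrier G)" and M: "M \<lhd> G" and a: "a \<in> center_mod G M" "a \<notin> M"
  obtains d \<rho> where "irrep G d \<rho>" "M \<subseteq> irrep.char_ker G d \<rho>" "a \<notin> irrep.char_ker G d \<rho>"
proof -
  interpret M: normal M G by fact
  have ac: "a \<in> carrier G" using a(1) center_mod_subset by blast
  have fin_Mod: "finite (carrier (G Mod M))" using fin unfolding carrier_FactGroup by simp
  have "M #> a \<in> group_center (G Mod M)" "M #> a \<noteq> \<one>\<^bsub>G Mod M\<^esub>"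
    using M.rcos_in_group_center_Mod_iff[OF ac] M.rcos_eq_one_Mod_iff[OF ac] a by auto
  then obtain d \<rho> where \<rho>: "is_irr_rep (G Mod M) d \<rho>" "\<rho> (M #> a) \<noteq> 1\<^sub>m d"
    using irr_rep_nontrivial_on_central[OF M.factorgroup_is_group fin_Mod] by metis
  let ?\<rho> = "\<lambda>x. \<rho> (M #> x)"
  interpret A: irrep G d ?\<rho> using irrepI[OF group_axioms fin is_irr_rep_inflate[OF M \<rho>(1)]] .
  have "\<rho> \<one>\<^bsub>G Mod M\<^esub> = 1\<^sub>m d" using \<rho>(1) unfolding is_irr_rep_def is_rep_def by blast
  then have "?\<rho> x = 1\<^sub>m d" if "x \<in> M" for x
    using M.rcos_eq_one_Mod_iff[OF M.mem_carrier[OF that]] that by simp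
  then have "M \<subseteq> A.char_ker" unfolding A.char_ker_def using M.mem_carrier by blast
  moreover have "a \<notin> A.char_ker" unfolding A.char_ker_def using \<rho>(2) by simp
  ultimately show thesis using that A.irrep_axioms by blast
qed

lemma irrep_twist:
  assumes "irrep G d \<rho>" and "irrep G 1 \<tau>"
  shows "irrep G d (\<lambda>g. irrep.central_char \<tau> g \<cdot>\<^sub>m \<rho> g)"
proof -
  interpret A: irrep G d \<rho> by fact
  interpret L: irrep G 1 \<tau> by fact
  let ?\<sigma> = "\<lambda>g. L.central_char g \<cdot>\<^sub>m \<rho> g"
  have linear: "g \<in> L.char_center" if "g \<in> carrier G" for g
    using L.degree_one_iff L.char_center_iff_commutator[OF that] A.commutator_in_derived[OF that]
    by auto
  have "is_rep G d ?\<sigma>" unfolding is_rep_def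
  proof (intro conjI ballI)
    fix g h assume g: "g \<in> carrier G" and h: "h \<in> carrier G"
    show "?\<sigma> (g \<otimes>\<^bsub>G\<^esub> h) = ?\<sigma> g * ?\<sigma> h"
      using A.rep_mult[OF g h] A.rep_carrier[OF g] A.rep_carrier[OF h]
        L.char_center_mult(2)[OF linear[OF g] linear[OF h]]
      by (auto simp: mult_smult_assoc_mat[of _ d d _ d] mult_smult_distrib[of _ d d _ d]
          intro!: eq_matI)
  qed (use A.degree_pos A.rep_carrier A.rep_one L.central_char_one in auto)
  moreover have "invariant_subspace G d \<rho> W" if W: "invariant_subspace G d ?\<sigma> W" for W
    unfolding invariant_subspace_def
  proof (intro conjI ballI)
    show sub: "is_subspace d W" using W unfolding invariant_subspace_def by blast
    fix g w assume g: "g \<in> carrier G" and w: "w \<in> W"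
    have wc: "w \<in> carrier_vec d" using sub w unfolding is_subspace_def by auto
    have "inverse (L.central_char g) \<cdot>\<^sub>v (?\<sigma> g *\<^sub>v w) = \<rho> g *\<^sub>v w"
      using A.rep_carrier[OF g] wc L.char_center_inv(3)[OF linear[OF g]]
      by (intro eq_vecI) (auto simp: row_smult smult_scalar_prod_distrib[of _ d])
    then show "\<rho> g *\<^sub>v w \<in> W"
      using W sub g w unfolding invariant_subspace_def is_subspace_def by metis
  qed
  ultimately have "is_irr_rep G d ?\<sigma>" using A.irr unfolding is_irr_rep_iff by blast
  then show ?thesis using irrepI[OF A.is_group A.finite_carrier] by blast
qed

section \<open>Galois conjugate characters\<close>

lemma GC_star_char_ker:
  assumes GC: "GC_star G" and "irrep G d \<rho>" and "irrep G d \<rho>'" and d: "d \<noteq> 1"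
    and x: "x \<in> irrep.char_ker G d \<rho>" "x \<in> irrep.char_center G d \<rho>'"
  shows "x \<in> irrep.char_ker G d \<rho>'"
proof -
  interpret A: irrep G d \<rho> by fact
  interpret B: irrep G d \<rho>' by fact
  have "galois_conjugate G (\<lambda>g. mat_trace (\<rho> g)) (\<lambda>g. mat_trace (\<rho>' g))"
    using GC d A.irr_char B.irr_char A.character_one B.character_one unfolding GC_star_def by simp
  then obtain n \<sigma> where \<sigma>: "\<sigma> \<in> gal_cyclotomic n"
      "\<forall>g \<in> carrier G. mat_trace (\<rho>' g) = \<sigma> (mat_trace (\<rho> g))"
    unfolding galois_conjugate_def by blast
  have "mat_trace (\<rho> x) = of_nat d" using A.character_on_char_center x(1) A.char_ker_iff by simp
  then have "mat_trace (\<rho>' x) = of_nat d"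
    using \<sigma> B.char_centerD(1)[OF x(2)] gal_cyclotomic_of_nat by simp
  then have "B.central_char x = 1" using B.character_on_char_center[OF x(2)] B.degree_pos by simp
  then show ?thesis using x(2) B.char_ker_iff by blast
qed

text \<open>
  If some \<open>x\<close> in the kernel lay outside \<open>G'\<close>, twisting by a linear character nontrivial at \<open>x\<close> would
  change the kernel.
\<close>

lemma GC_star_char_ker_subset_derived:
  assumes GC: "GC_star G" and r: "irrep G d \<rho>" and d: "d \<noteq> 1"
  shows "irrep.char_ker G d \<rho> \<subseteq> derived G (carrier G)"
proof (rule ccontr)
  interpret A: irrep G d \<rho> by fact
  assume "\<not> A.char_ker \<subseteq> derived G (carrier G)"
  then obtain x where x: "x \<in> A.char_ker" "x \<notin> derived G (carrier G)" by blast
  have xc: "x \<in> carrier G" using x(1) unfolding A.char_ker_def by blast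
  have "x \<in> center_mod G (derived G (carrier G))"
    unfolding center_mod_def using xc A.commutator_in_derived by blast
  then obtain f \<tau> where \<tau>: "irrep G f \<tau>" "derived G (carrier G) \<subseteq> irrep.char_ker G f \<tau>"
      "x \<notin> irrep.char_ker G f \<tau>"
    using A.irrep_separating[OF A.finite_carrier A.derived_self_is_normal _ x(2)] by blast
  interpret L: irrep G f \<tau> by fact
  have f: "f = 1" using L.degree_one_iff \<tau>(2) by blast
  have xL: "x \<in> L.char_center"
    using L.char_center_iff_commutator[OF xc] \<tau>(2) A.commutator_in_derived[OF xc] by blast
  define \<rho>' where "\<rho>' = (\<lambda>g. L.central_char g \<cdot>\<^sub>m \<rho> g)"
  have r': "irrep G d \<rho>'" unfolding \<rho>'_def using irrep_twist[OF r] \<tau>(1) f by simp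
  interpret B: irrep G d \<rho>' by fact
  have "\<rho>' x = L.central_char x \<cdot>\<^sub>m 1\<^sub>m d"
    unfolding \<rho>'_def using x(1) unfolding A.char_ker_def by simp
  then have "x \<in> B.char_center" "B.central_char x = L.central_char x"
    using B.char_centerI B.central_char_eqI xc by auto
  moreover have "L.central_char x \<noteq> 1" using \<tau>(3) xL L.char_ker_iff by blast
  ultimately show False using GC_star_char_ker[OF GC r r' d x(1)] B.char_ker_iff by simp
qed

lemma GC_star_Mod:
  assumes GC: "GC_star G" and M: "M \<lhd> G"
  shows "GC_star (G Mod M)"
  unfolding GC_star_def
proof (intro allI impI)
  fix \<chi> \<psi>
  assume chars: "irr_char (G Mod M) \<chi> \<and> irr_char (G Mod M) \<psi> \<and> \<chi> \<one>\<^bsub>G Mod M\<^esub> \<noteq> 1 \<and> \<psi> \<one>\<^bsub>G Mod M\<^esub> \<noteq> 1 \<and>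
    \<chi> \<one>\<^bsub>G Mod M\<^esub> = \<psi> \<one>\<^bsub>G Mod M\<^esub>"
  interpret M: normal M G by fact
  interpret h: group_hom G "G Mod M" "\<lambda>x. M #>\<^bsub>G\<^esub> x" by (rule M.group_hom_Mod)
  have inflate: "irr_char G (\<lambda>x. \<phi> (M #>\<^bsub>G\<^esub> x))" if \<phi>: "irr_char (G Mod M) \<phi>" for \<phi>
  proof -
    obtain d \<rho> where "is_irr_rep (G Mod M) d \<rho>" "\<forall>g \<in> carrier (G Mod M). \<phi> g = mat_trace (\<rho> g)"
      using \<phi> unfolding irr_char_def by blast
    then show ?thesis using is_irr_rep_inflate[OF M] h.hom_closed unfolding irr_char_def by blast
  qed
  have "galois_conjugate G (\<lambda>x. \<chi> (M #>\<^bsub>G\<^esub> x)) (\<lambda>x. \<psi> (M #>\<^bsub>G\<^esub> x))"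
    using GC chars inflate unfolding GC_star_def h.hom_one[symmetric] by blast
  then obtain n \<sigma> where n: "0 < n" "card (carrier G) dvd n" "\<sigma> \<in> gal_cyclotomic n"
    and \<sigma>: "\<forall>g \<in> carrier G. \<psi> (M #>\<^bsub>G\<^esub> g) = \<sigma> (\<chi> (M #>\<^bsub>G\<^esub> g))"
    unfolding galois_conjugate_def by blast
  have "card (carrier (G Mod M)) dvd n" using n(2) M.card_Mod by (metis dvd_mult_left)
  then show "galois_conjugate (G Mod M) \<chi> \<psi>"
    unfolding galois_conjugate_def using n \<sigma> unfolding carrier_FactGroup by blast
qed

lemma (in irrep) character_eq_central_char:
  assumes "derived G (carrier G) \<subseteq> char_center" "g \<in> carrier G"
  shows "mat_trace (\<rho> g) = (if g \<in> char_center then of_nat d * central_char g else 0)"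
  using character_on_char_center character_zero_off_char_center assms by simp

lemma galois_conjugate_if_central_chars:
  assumes "irrep G d \<rho>" and "irrep G d \<rho>'"
    and comm: "derived G (carrier G) \<subseteq> generate G {z}" and z: "z \<in> carrier G"
    and centers: "irrep.char_center G d \<rho> = generate G {z}"
      "irrep.char_center G d \<rho>' = generate G {z}"
    and \<sigma>: "\<sigma> \<in> gal_cyclotomic (card (carrier G))"
      "irrep.central_char \<rho> z \<in> cyclotomic_field (card (carrier G))"
      "\<sigma> (irrep.central_char \<rho> z) = irrep.central_char \<rho>' z"
  shows "galois_conjugate G (\<lambda>g. mat_trace (\<rho> g)) (\<lambda>g. mat_trace (\<rho>' g))"
proof -
  interpret A: irrep G d \<rho> by fact
  interpret B: irrep G d \<rho>' by fact
  let ?n = "card (carrier G)"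
  have zA: "z \<in> A.char_center" and zB: "z \<in> B.char_center"
    unfolding centers by (simp_all add: generate.incl)
  have "mat_trace (\<rho>' g) = \<sigma> (mat_trace (\<rho> g))" if g: "g \<in> carrier G" for g
  proof (cases "g \<in> generate G {z}")
    case True
    then obtain i where i: "g = z [^]\<^bsub>G\<^esub> (i::nat)"
      using A.generate_pow_on_finite_carrier[OF A.finite_carrier z] by blast
    note pow = gal_cyclotomic_power[OF \<sigma>(1,2)]
    have "\<sigma> (mat_trace (\<rho> g)) = \<sigma> (of_nat d * A.central_char z ^ i)"
      using A.character_eq_central_char[OF _ g] comm True A.char_center_nat_pow(2)[OF zA] centers i
      by simp
    also have "\<dots> = of_nat d * B.central_char z ^ i"
      using gal_cyclotomicD(2)[OF \<sigma>(1) of_nat_in_cyclotomic_field pow(1)]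
        gal_cyclotomic_of_nat[OF \<sigma>(1)] pow(2) \<sigma>(3)
      by simp
    also have "\<dots> = mat_trace (\<rho>' g)"
      using B.character_eq_central_char[OF _ g] comm True B.char_center_nat_pow(2)[OF zB] centers i
      by simp
    finally show ?thesis by simp
  next
    case False
    then show ?thesis
      using A.character_eq_central_char[OF _ g] B.character_eq_central_char[OF _ g] comm centers
        gal_cyclotomic_of_nat[OF \<sigma>(1), of 0] by simp
  qed
  moreover have "?n > 0" using A.finite_carrier A.one_closed by (auto simp: card_gt_0_iff)
  ultimately show ?thesis
    unfolding galois_conjugate_def using \<sigma>(1) by (intro exI[of _ ?n] exI[of _ \<sigma>]) auto
qed

section \<open>Derived subgroup of order \<open>p\<close>\<close>

lemma (in group) subgroup_of_cyclic_eq: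
  assumes fin: "finite (carrier G)" and z: "z \<in> carrier G"
    and A: "subgroup A G" "A \<subseteq> generate G {z}"
  shows "A = generate G {z [^] (ord z div card A)}"
proof -
  let ?q = "ord z div card A"
  have finA: "finite A" and card_A_pos: "card A > 0"
    using finite_subset[OF subgroup.subset[OF A(1)] fin]
      subgroup.finite_imp_card_positive[OF A(1) fin]
    by auto
  have cyc: "subgroup (generate G {z}) G" using generate_is_subgroup[of "{z}"] z by simp
  have ord_z: "ord z = card A * ?q" and ord_pos: "ord z > 0"
    using card_subgroup_dvd[OF A(1) cyc A(2)] generate_pow_card[OF z] ord_ge_1[OF fin z] by auto
  have "A \<subseteq> generate G {z [^] ?q}"
  proof
    fix x assume x: "x \<in> A"
    obtain t where t: "x = z [^] (t::nat)"
      using A(2) x generate_pow_on_finite_carrier[OF fin z] by blast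
    have "z [^] (t * card A) = \<one>"
      using pow_card_subgroup_eq_one[OF A(1) x] t z by (simp add: nat_pow_pow)
    then have "card A * ?q dvd card A * t" using pow_eq_id[OF z] ord_z by (simp add: mult.commute)
    then obtain s where "t = ?q * s" using card_A_pos by (auto elim: dvdE)
    then have "x = (z [^] ?q) [^] s" using t z by (simp add: nat_pow_pow)
    then show "x \<in> generate G {z [^] ?q}"
      using generate_pow_on_finite_carrier[OF fin, of "z [^] ?q"] z by blast
  qed
  moreover have "?q \<noteq> 0" using ord_z ord_pos by (intro notI) simp
  then have "ord (z [^] ?q) = card A"
    using ord_pow[OF z, of ?q] ord_z by (metis dvd_triv_right nonzero_mult_div_cancel_right)
  then have "card (generate G {z [^] ?q}) = card A" using generate_pow_card[of "z [^] ?q"] z by simp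
  ultimately show ?thesis using finA card_A_pos by (metis card_gt_0_iff card_subset_eq)
qed

context pgroup
begin

lemma char_ker_inter_derived_if_card_p:
  assumes D: "card (derived G (carrier G)) = p" and "irrep G d \<rho>" and d: "d \<noteq> 1"
  shows "irrep.char_ker G d \<rho> \<inter> derived G (carrier G) = {\<one>}"
proof -
  interpret A: irrep G d \<rho> by fact
  have "c = \<one>" if "c \<in> A.char_ker" "c \<in> derived G (carrier G)" for c
    using subset_if_card_p[OF derived_subgroup D A.char_ker_subgroup that(2,1)] A.degree_one_iff d
    by blast
  then show ?thesis
    using subgroup.one_closed[OF A.char_ker_subgroup] subgroup.one_closed[OF derived_subgroup]
    by blast
qed

lemma char_center_eq_group_center_if_card_p:
  assumes "card (derived G (carrier G)) = p" "irrep G d \<rho>" "d \<noteq> 1"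
  shows "irrep.char_center G d \<rho> = group_center G"
proof -
  interpret A: irrep G d \<rho> by fact
  have "x \<in> group_center G" if x: "x \<in> A.char_center" for x
  proof -
    have xc: "x \<in> carrier G" using A.char_centerD(1)[OF x] .
    have "commutator G x g = \<one>" if g: "g \<in> carrier G" for g
      using char_ker_inter_derived_if_card_p[OF assms] A.char_center_iff_commutator[OF xc] x g
        commutator_in_derived[OF xc g] by blast
    then show ?thesis unfolding group_center_eq_center_mod center_mod_def using xc by simp
  qed
  then show ?thesis using A.group_center_subset_char_center by blast
qed

lemma cyclic_center_if_GC_star:
  assumes D: "card (derived G (carrier G)) = p" and GC: "GC_star G"
  shows "cyclic_subset G (group_center G)"
proof -
  have "derived G (carrier G) \<noteq> {\<one>}" using D p_gt_1 by auto
  then obtain c where c: "c \<in> derived G (carrier G)" "c \<noteq> \<one>"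
    using subgroup.one_closed[OF derived_subgroup] by blast
  then have "c \<in> center_mod G {\<one>}"
    using derived_subset_center_if_card_p[OF D] group_center_eq_center_mod by blast
  then obtain d \<rho> where r: "irrep G d \<rho>" and ker: "c \<notin> irrep.char_ker G d \<rho>"
    using irrep_separating[OF finite_carrier one_is_normal] c(2) by blast
  interpret A: irrep G d \<rho> by fact
  have d: "d \<noteq> 1" using A.degree_one_iff c(1) ker by blast
  have "A.char_ker \<subseteq> {\<one>}"
    using GC_star_char_ker_subset_derived[OF GC r d] char_ker_inter_derived_if_card_p[OF D r d]
    by blast
  then show ?thesis
    using A.faithful_central_subgroup_cyclic[OF group_center_subgroup
          A.group_center_subset_char_center]
    by blast
qed

lemma central_char_primitive_root:
  assumes D: "card (derived G (carrier G)) = p"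
    and z: "z \<in> group_center G" "group_center G = generate G {z}"
    and r: "irrep G d \<rho>" and d: "d \<noteq> 1"
  shows "primitive_root_of_unity (ord z) (irrep.central_char \<rho> z)"
proof -
  interpret A: irrep G d \<rho> by fact
  have zc: "z \<in> carrier G" using group_center_closed[OF z(1)] .
  have zA: "z \<in> A.char_center" using A.group_center_subset_char_center z(1) by blast
  have kerZ: "subgroup (A.char_ker \<inter> group_center G) G"
    by (rule subgroups_Inter_pair[OF A.char_ker_subgroup group_center_subgroup])
  have faithful: "A.char_ker \<inter> group_center G = {\<one>}"
  proof (rule ccontr)
    assume "A.char_ker \<inter> group_center G \<noteq> {\<one>}"
    then obtain N where N: "N \<lhd> G" "N \<subseteq> A.char_ker \<inter> group_center G" "card N = p"
      using central_subgroup_of_prime_order_exists[OF central_subgroup_normal[OF kerZ Int_lower2]]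
      by metis
    note unique = subgroup_of_cyclic_eq[OF finite_carrier zc, unfolded z(2)[symmetric]]
    have "N = derived G (carrier G)"
      using unique[OF normal_imp_subgroup[OF N(1)]] unique[OF derived_subgroup] N(2,3) D
        derived_subset_center_if_card_p[OF D] by simp
    then have "N \<subseteq> {\<one>}" using char_ker_inter_derived_if_card_p[OF D r d] N(2) by blast
    then show False using card_mono[of "{\<one>}" N] N(3) p_gt_1 by simp
  qed
  have "A.central_char z ^ i = 1 \<longleftrightarrow> z [^] i = \<one>" for i :: nat
  proof -
    have "A.central_char z ^ i = 1 \<longleftrightarrow> z [^] i \<in> A.char_ker \<inter> group_center G"
      using A.char_center_nat_pow[OF zA] A.char_ker_iff
        subgroup_nat_pow_closed[OF group_center_subgroup z(1)]
      by auto
    then show ?thesis unfolding faithful by simp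
  qed
  then show ?thesis unfolding primitive_root_of_unity_def using pow_eq_id[OF zc] by blast
qed

lemma GC_star_if_cyclic_center:
  assumes D: "card (derived G (carrier G)) = p" and cyc: "cyclic_subset G (group_center G)"
  shows "GC_star G"
  unfolding GC_star_def
proof (intro allI impI, elim conjE)
  fix \<chi> \<psi>
  assume chars: "irr_char G \<chi>" "irr_char G \<psi>" and degrees: "\<chi> \<one> \<noteq> 1" "\<chi> \<one> = \<psi> \<one>"
  obtain d \<rho> where \<rho>: "is_irr_rep G d \<rho>" and \<chi>: "\<And>g. g \<in> carrier G \<Longrightarrow> \<chi> g = mat_trace (\<rho> g)"
    using chars(1) unfolding irr_char_def by blast
  obtain d' \<rho>' where \<rho>': "is_irr_rep G d' \<rho>'" and \<psi>: "\<And>g. g \<in> carrier G \<Longrightarrow> \<psi> g = mat_trace (\<rho>' g)"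
    using chars(2) unfolding irr_char_def by blast
  note r = irrepI[OF is_group finite_carrier \<rho>]
  have d: "d' = d" "d \<noteq> 1"
    using degrees \<chi> \<psi> irrep.character_one[OF r]
      irrep.character_one[OF irrepI[OF is_group finite_carrier \<rho>']]
    by auto
  have r': "irrep G d \<rho>'" using irrepI[OF is_group finite_carrier \<rho>'] d(1) by simp
  obtain z where z: "z \<in> group_center G" "group_center G = generate G {z}"
    using cyc unfolding cyclic_subset_def by blast
  have zc: "z \<in> carrier G" using group_center_closed[OF z(1)] .
  have "ord z dvd p ^ k"
    using ord_dvd_group_order[OF zc] card_carrier by (simp add: Coset.order_def)
  then obtain \<sigma> where "\<sigma> \<in> gal_cyclotomic (card (carrier G))"
      "irrep.central_char \<rho> z \<in> cyclotomic_field (card (carrier G))"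
      "\<sigma> (irrep.central_char \<rho> z) = irrep.central_char \<rho>' z"
    using gal_cyclotomic_maps_primitive_root[OF prime _ central_char_primitive_root[OF D z r d(2)]
        central_char_primitive_root[OF D z r' d(2)]] unfolding card_carrier by blast
  then have "galois_conjugate G (\<lambda>g. mat_trace (\<rho> g)) (\<lambda>g. mat_trace (\<rho>' g))"
    using galois_conjugate_if_central_chars[OF r r' _ zc] derived_subset_center_if_card_p[OF D]
      char_center_eq_group_center_if_card_p[OF D r d(2)]
      char_center_eq_group_center_if_card_p[OF D r' d(2)] z(2)
      by simp
  then show "galois_conjugate G \<chi> \<psi>" unfolding galois_conjugate_def using \<chi> \<psi> by simp
qed

end

section \<open>Derived subgroup of order \<open>p\<^sup>2\<close>\<close>

lemma prime_times_square_neq_square: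
  fixes p d e :: nat
  assumes p: "prime p" and d: "d > 0"
  shows "p * d\<^sup>2 \<noteq> e\<^sup>2"
proof
  assume eq: "p * d\<^sup>2 = e\<^sup>2"
  have p_pos: "p > 0" using p prime_gt_0_nat by blast
  have e: "e \<noteq> 0" using eq d p_pos by (intro notI) simp
  have pe: "prime_elem p" using p by simp
  have "multiplicity p (p * d\<^sup>2) = 1 + 2 * multiplicity p d"
    using pe p_pos d
    by (simp add: prime_elem_multiplicity_mult_distrib prime_elem_multiplicity_power_distrib)
  moreover have "multiplicity p (e\<^sup>2) = 2 * multiplicity p e"
    using pe e by (simp add: prime_elem_multiplicity_power_distrib)
  ultimately have "1 + 2 * multiplicity p d = 2 * multiplicity p e" using eq by simp
  then show False by presburger
qed

lemma eq_if_squares_prime_multiple: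
  fixes p d e m n :: nat
  assumes p: "prime p" and pos: "d > 0" "e > 0" "z > 0"
    and m: "m = z \<or> m = p * z" and n: "n = z \<or> n = p * z" and eq: "d\<^sup>2 * m = e\<^sup>2 * n"
  shows "d = e"
proof -
  have p_pos: "p > 0" using prime_gt_0_nat[OF p] .
  have "d\<^sup>2 = e\<^sup>2 \<or> d\<^sup>2 = p * e\<^sup>2 \<or> p * d\<^sup>2 = e\<^sup>2" using m n
  proof (elim disjE)
    assume "m = z" "n = p * z"
    then have "d\<^sup>2 * z = (p * e\<^sup>2) * z" using eq by (simp add: mult_ac)
    then show ?thesis using pos by simp
  next
    assume "m = p * z" "n = z"
    then have "(p * d\<^sup>2) * z = e\<^sup>2 * z" using eq by (simp add: mult_ac)
    then show ?thesis using pos by simp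
  qed (use eq pos p_pos in simp_all)
  then have "d\<^sup>2 = e\<^sup>2" using prime_times_square_neq_square[OF p] pos by metis
  then show ?thesis by simp
qed

context pgroup
begin

lemma card_char_center_cases:
  assumes "irrep G d \<rho>" and ker: "irrep.char_ker G d \<rho> \<subseteq> group_center G"
    and card_ker: "card (irrep.char_ker G d \<rho>) dvd p"
  shows "card (irrep.char_center G d \<rho>) = card (group_center G) \<or>
    card (irrep.char_center G d \<rho>) = p * card (group_center G)"
proof -
  interpret A: irrep G d \<rho> by fact
  obtain q where q: "p = card A.char_ker * q" using card_ker by (elim dvdE)
  have ker_pow: "y [^] p = \<one>" if y: "y \<in> A.char_ker" for y
  proof -
    have "y [^] p = (y [^] card A.char_ker) [^] q"
      using subgroup.mem_carrier[OF A.char_ker_subgroup y] by (subst q) (simp add: nat_pow_pow)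
    then show ?thesis using pow_card_subgroup_eq_one[OF A.char_ker_subgroup y] by simp
  qed
  have "x [^] p \<in> group_center G" if x: "x \<in> A.char_center" for x
  proof -
    have xc: "x \<in> carrier G" using A.char_centerD(1)[OF x] .
    have "commutator G (x [^] p) g = \<one>" if g: "g \<in> carrier G" for g
    proof -
      have c: "commutator G x g \<in> A.char_ker" using A.char_center_iff_commutator[OF xc] x g by blast
      then show ?thesis
        using commutator_nat_pow_left[OF xc g subsetD[OF ker c], of p] ker_pow by simp
    qed
    then show ?thesis unfolding group_center_eq_center_mod center_mod_def using xc by simp
  qed
  then have "card A.char_center \<le> p * card (group_center G)"
    using A.card_char_center_le[OF group_center_subgroup ker A.group_center_subset_char_center]
      p_gt_1
    by simp
  then show ?thesis
    using card_eq_or_p_times[OF group_center_subgroup A.char_center_subgroup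
          A.group_center_subset_char_center]
    by blast
qed

lemma degree_eq_if_derived_central:
  assumes D: "derived G (carrier G) \<subseteq> group_center G"
    and r: "irrep G d \<rho>" "irrep.char_ker G d \<rho> \<subseteq> group_center G" "card (irrep.char_ker G d \<rho>) dvd p"
    and s: "irrep G e \<theta>" "irrep.char_ker G e \<theta> \<subseteq> group_center G" "card (irrep.char_ker G e \<theta>) dvd p"
  shows "d = e"
proof -
  interpret A: irrep G d \<rho> by fact
  interpret B: irrep G e \<theta> by fact
  have "d\<^sup>2 * card A.char_center = e\<^sup>2 * card B.char_center"
    using A.degree_square B.degree_square D A.group_center_subset_char_center
      B.group_center_subset_char_center
    by (metis order.trans)
  then show ?thesis
    using eq_if_squares_prime_multiple[OF prime A.degree_pos B.degree_pos
          card_subgroup_pos[OF group_center_subgroup]]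
      card_char_center_cases[OF r] card_char_center_cases[OF s] by blast
qed

end

locale derived_p_square = pgroup G p k + A: irrep G d \<rho>
  for G :: "('a, 'b) monoid_scheme" (structure) and p k d \<rho> +
  fixes N :: "'a set"
  assumes N: "subgroup N G" "N \<subseteq> group_center G" "card N = p"
    and derived: "N \<subseteq> derived G (carrier G)" "derived G (carrier G) \<subseteq> center_mod G N"
    and card_derived: "card (derived G (carrier G)) = p * card N"
    and char_ker: "A.char_ker = N"
begin

abbreviation D :: "'a set" where "D \<equiv> derived G (carrier G)"

lemma derived_subset_char_center: "D \<subseteq> A.char_center"
  unfolding A.char_center_eq_center_mod char_ker by (rule derived(2))

lemma derived_not_subset_N: "\<not> D \<subseteq> N"
  using card_mono[OF finite_subgroup[OF N(1)], of D] card_derived N(3) p_gt_1 by auto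

lemma derived_subset_if_meets:
  assumes "subgroup H G" "N \<subseteq> H" "x \<in> D" "x \<in> H" "x \<notin> N"
  shows "D \<subseteq> H"
  using subset_if_prime_index[OF finite_carrier prime N(1) derived_subgroup derived(1) card_derived]
    assms
  by blast

lemma degree_square: "d\<^sup>2 * card A.char_center = card (carrier G)"
  by (rule A.degree_square[OF derived_subset_char_center])

lemma prime_dvd_degree: "p dvd d"
proof -
  have "\<not> D \<subseteq> A.char_ker" unfolding char_ker by (rule derived_not_subset_N)
  then obtain g x where "g \<in> carrier G" "x \<in> carrier G" "commutator G g x \<notin> A.char_ker"
    unfolding derived_subset_iff[OF A.char_ker_subgroup] by blast
  then show ?thesis
    using A.prime_dvd_degree[OF prime card_carrier] derived_subset_char_center commutator_in_derived
    by blast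
qed

end

locale derived_p_square_not_central = derived_p_square +
  fixes b
  assumes b: "b \<in> derived G (carrier G)" "b \<notin> group_center G"
begin

lemma b_closed: "b \<in> carrier G"
  using subgroup.mem_carrier[OF derived_subgroup b(1)] .

lemma derived_Int_center: "D \<inter> group_center G = N"
  using derived_subset_if_meets[OF group_center_subgroup N(2)] b N(2) derived(1) by blast

abbreviation C :: "'a set" where "C \<equiv> centralizer G b"

lemma C_subgroup: "subgroup C G"
  by (rule centralizer_subgroup[OF b_closed])

lemma card_carrier_eq: "card (carrier G) = p * card C"
  using card_centralizer_if_central_mod[OF N(1,3)] b derived(2) by blast

lemma index_C: "card (rcosets C) = p"
  using lagrange[OF C_subgroup] card_carrier_eq card_subgroup_pos[OF C_subgroup]
  by (simp add: Coset.order_def)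

lemma card_char_center: "card A.char_center = p * card (group_center G)"
proof -
  have "card A.char_center \<noteq> card (group_center G)"
  proof
    assume "card A.char_center = card (group_center G)"
    then have "group_center G = A.char_center"
      using A.group_center_subset_char_center finite_subgroup[OF A.char_center_subgroup]
      by (intro card_subset_eq) auto
    then show False using b derived_subset_char_center by blast
  qed
  then show ?thesis using card_char_center_cases[OF A.irrep_axioms] N char_ker by simp
qed

lemma char_center_subset_centralizer:
  assumes w: "w \<in> C"
  shows "A.char_center \<subseteq> centralizer G w"
proof -
  have wc: "w \<in> carrier G" using subgroup.mem_carrier[OF C_subgroup w] .
  have "b \<in> centralizer G w" using w centralizer_sym[OF b_closed wc] by blast
  then show ?thesis
    using subset_if_prime_index[OF finite_carrier prime group_center_subgroup A.char_center_subgroup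
        A.group_center_subset_char_center card_char_center centralizer_subgroup[OF wc]
        group_center_subset_centralizer[OF wc] _ b(2)] b(1) derived_subset_char_center by blast
qed

lemma char_center_subset_C: "A.char_center \<subseteq> C"
proof (rule char_center_subset_centralizer)
  show "b \<in> C" unfolding centralizer_def using b_closed by simp
qed

lemma commutator_C_in_N:
  assumes "x \<in> C" "y \<in> C"
  shows "commutator G x y \<in> N"
proof -
  have "commutator G x y \<in> group_center G"
    using commutator_central_if_derived_centralized[OF C_subgroup _ _ assms]
      derived_subset_char_center char_center_subset_C char_center_subset_centralizer by blast
  then show ?thesis
    using derived_Int_center commutator_in_derived subgroup.mem_carrier[OF C_subgroup] assms
    by blast
qed

lemma degree_eq_p: "d = p"
proof -
  have "d \<le> p"
    using A.degree_le_index[OF C_subgroup] commutator_C_in_N char_ker index_C by simp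
  then show ?thesis using prime_dvd_degree A.degree_pos by (meson dvd_imp_le le_antisym)
qed

lemma C_abelian:
  assumes "x \<in> C" "y \<in> C"
  shows "commutator G x y = \<one>"
proof (rule commute_if_central_prime_index[OF finite_carrier prime A.char_center_subgroup C_subgroup
      char_center_subset_C _ char_center_subset_centralizer assms])
  have "p * (p * card A.char_center) = p * card C"
    using degree_square card_carrier_eq unfolding degree_eq_p power2_eq_square
    by (simp only: mult.assoc)
  then show "card C = p * card A.char_center" using p_gt_1 by simp
qed

lemma other_degree_eq_p:
  assumes "irrep G e \<theta>" and ker: "\<not> N \<subseteq> irrep.char_ker G e \<theta>"
  shows "e = p"
proof -
  interpret B: irrep G e \<theta> by fact
  have "e \<le> p"
    using B.degree_le_index[OF C_subgroup] C_abelian subgroup.one_closed[OF B.char_ker_subgroup]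
      index_C
    by simp
  moreover have "p dvd e"
  proof -
    obtain g where g: "g \<in> carrier G" "commutator G b g \<noteq> \<one>"
      using b(2) b_closed unfolding group_center_eq_center_mod center_mod_def by blast
    let ?c = "commutator G g b"
    have c_not_one: "?c \<noteq> \<one>"
      using g commutator_eq_one_iff[OF g(1) b_closed] commutator_eq_one_iff[OF b_closed g(1)]
      by auto
    have cN: "?c \<in> N"
      using b(1) derived(2) g(1) commutator_in_subgroup_sym[OF N(1) g(1) b_closed]
      unfolding center_mod_def by blast
    have "?c \<in> B.char_center" using cN N(2) B.group_center_subset_char_center by blast
    moreover have "?c \<notin> B.char_ker"
      using subset_if_card_p[OF N(1,3) B.char_ker_subgroup cN _ c_not_one] ker by blast
    ultimately show ?thesis using B.prime_dvd_degree[OF prime card_carrier g(1) b_closed] by blast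
  qed
  ultimately show ?thesis using B.degree_pos by (meson dvd_imp_le le_antisym)
qed

end

lemma (in derived_p_square) other_degree_eq:
  assumes s: "irrep G e \<theta>" and ker: "\<not> N \<subseteq> irrep.char_ker G e \<theta>" "irrep.char_ker G e \<theta> \<subseteq> D"
  shows "e = d"
proof (cases "D \<subseteq> group_center G")
  case True
  interpret B: irrep G e \<theta> by fact
  have "card B.char_ker dvd p"
  proof -
    obtain j where j: "card B.char_ker = p ^ j"
      using card_subgroup_prime_power[OF B.char_ker_subgroup] .
    have "card B.char_ker dvd p\<^sup>2"
      using card_subgroup_dvd[OF B.char_ker_subgroup derived_subgroup ker(2)] card_derived N(3)
      by (simp add: power2_eq_square)
    then have "j \<le> 2" using j p_gt_1 power_dvd_imp_le by metis
    moreover have "card B.char_ker \<noteq> card D"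
      using card_subset_eq[OF finite_subgroup[OF derived_subgroup] ker(2)] ker(1) derived(1)
      by blast
    then have "j \<noteq> 2" using j card_derived N(3) by (auto simp: power2_eq_square)
    ultimately have "j \<le> 1" by simp
    then show ?thesis using j le_imp_power_dvd[of j 1 p] by simp
  qed
  then show ?thesis
    using degree_eq_if_derived_central[OF True s _ _ A.irrep_axioms] ker(2) True char_ker N by auto
next
  case False
  then obtain b where "b \<in> D" "b \<notin> group_center G" by blast
  then interpret derived_p_square_not_central G p k d \<rho> N b by unfold_locales
  show ?thesis using other_degree_eq_p[OF s ker(1)] degree_eq_p by simp
qed

context pgroup
begin

lemma GC_star_irrep_with_kernel:
  assumes GC: "GC_star G"
    and N: "N \<lhd> G" "N \<subseteq> derived G (carrier G)" "derived G (carrier G) \<subseteq> center_mod G N"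
    and card: "card (derived G (carrier G)) = p * card N"
  obtains d \<rho> where "irrep G d \<rho>" "d \<noteq> 1" "irrep.char_ker G d \<rho> = N"
proof -
  let ?D = "derived G (carrier G)"
  note Ns = normal_imp_subgroup[OF N(1)]
  have "?D \<noteq> N" using card card_subgroup_pos[OF Ns] p_gt_1 by auto
  then obtain b where b: "b \<in> ?D" "b \<notin> N" using N(2) by blast
  obtain d \<rho> where r: "irrep G d \<rho>" and ker: "N \<subseteq> irrep.char_ker G d \<rho>" "b \<notin> irrep.char_ker G d \<rho>"
    using irrep_separating[OF finite_carrier N(1) subsetD[OF N(3) b(1)] b(2)] .
  interpret A: irrep G d \<rho> by fact
  have d: "d \<noteq> 1" using A.degree_one_iff b(1) ker(2) by blast
  have "x \<in> N" if x: "x \<in> A.char_ker" for x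
  proof (rule ccontr)
    assume "x \<notin> N"
    moreover have "x \<in> ?D" using GC_star_char_ker_subset_derived[OF GC r d] x by blast
    ultimately have "?D \<subseteq> A.char_ker"
      using subset_if_prime_index[OF finite_carrier prime Ns derived_subgroup N(2) card
            A.char_ker_subgroup ker(1)] x
      by blast
    then show False using b(1) ker(2) by blast
  qed
  then show thesis using that[OF r d] ker(1) by blast
qed

lemma GC_star_card_derived_neq_p_square:
  assumes GC: "GC_star G"
  shows "card (derived G (carrier G)) \<noteq> p\<^sup>2"
proof
  let ?D = "derived G (carrier G)"
  assume card_D: "card ?D = p\<^sup>2"
  have "card ?D > 1" unfolding card_D using p_gt_1 by (rule one_less_power) simp
  then have "?D \<noteq> {\<one>}" by auto
  then obtain N where N: "N \<lhd> G" "N \<subseteq> ?D" "N \<subseteq> group_center G" "card N = p"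
    using central_subgroup_of_prime_order_exists[OF derived_self_is_normal] by metis
  note Ns = normal_imp_subgroup[OF N(1)]
  have card: "card ?D = p * card N" using card_D N(4) by (simp add: power2_eq_square)
  then have "N \<subset> ?D" using N(2,4) p_gt_1 by auto
  then obtain S where S: "S \<subseteq> ?D" "S \<subseteq> center_mod G N" "card S = p * card N"
    using normal_extend_by_p[OF N(1) derived_self_is_normal] by metis
  have "S = ?D" using card_subset_eq[OF finite_subgroup[OF derived_subgroup] S(1)] S(3) card by simp
  then have central: "?D \<subseteq> center_mod G N" using S(2) by simp
  obtain d \<rho> where r: "irrep G d \<rho>" and d: "d \<noteq> 1" and ker: "irrep.char_ker G d \<rho> = N"
    by (rule GC_star_irrep_with_kernel[OF GC N(1,2) central card])
  interpret A: irrep G d \<rho> by fact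
  interpret S: derived_p_square G p k d \<rho> N
    by (intro derived_p_square.intro derived_p_square_axioms.intro pgroup_axioms
        r Ns N central card ker)
  have "N \<noteq> {\<one>}" using N(4) p_gt_1 by auto
  then obtain a where a: "a \<in> N" "a \<noteq> \<one>" using subgroup.one_closed[OF Ns] by blast
  then have "a \<in> center_mod G {\<one>}" using N(3) group_center_eq_center_mod by blast
  then obtain e \<theta> where s: "irrep G e \<theta>" and a_ker: "a \<notin> irrep.char_ker G e \<theta>"
    using irrep_separating[OF finite_carrier one_is_normal] a(2) by blast
  interpret B: irrep G e \<theta> by fact
  have e: "e \<noteq> 1" using B.degree_one_iff a(1) N(2) a_ker by blast
  have "e = d"
    using S.other_degree_eq[OF s] GC_star_char_ker_subset_derived[OF GC s e] a(1) a_ker by blast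
  moreover have "a \<in> B.char_center" using a(1) N(3) B.group_center_subset_char_center by blast
  ultimately show False using GC_star_char_ker[OF GC r _ d, of \<theta> a] s a(1) a_ker ker by simp
qed

lemma card_derived_Mod:
  assumes M: "M \<lhd> G" "M \<subseteq> derived G (carrier G)"
  shows "card (derived (G Mod M) (carrier (G Mod M))) * card M = card (derived G (carrier G))"
proof -
  interpret M: normal M G by fact
  interpret h: group_hom G "G Mod M" "\<lambda>x. M #> x" by (rule M.group_hom_Mod)
  have "derived (G Mod M) (carrier (G Mod M)) = (\<lambda>x. M #> x) ` derived G (carrier G)"
    using h.derived_img[of "carrier G"] M.rcos_surj_Mod by simp
  then show ?thesis using M.card_image_Mod[OF derived_subgroup M(2)] by simp
qed

lemma GC_star_card_derived_le_p:
  assumes GC: "GC_star G"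
  shows "card (derived G (carrier G)) \<le> p"
proof (rule ccontr)
  let ?D = "derived G (carrier G)"
  assume gt: "\<not> card ?D \<le> p"
  obtain j where j: "card ?D = p ^ j" using card_subgroup_prime_power[OF derived_subgroup] .
  have "\<not> j \<le> 1"
  proof
    assume "j \<le> 1"
    then have "p ^ j \<le> p ^ 1" using p_gt_1 by (intro power_increasing) auto
    then show False using gt j by simp
  qed
  then obtain i where i: "j = i + 2" using le_Suc_ex[of 2 j] by auto
  obtain M where M: "M \<lhd> G" "M \<subseteq> ?D" "card M = p ^ i"
    using normal_subgroup_of_card_exists[OF derived_self_is_normal j, of i] i by auto
  obtain l where "pgroup (G Mod M) p l" using pgroup_Mod[OF M(1)] .
  then interpret Q: pgroup "G Mod M" p l .
  have "card (derived (G Mod M) (carrier (G Mod M))) * p ^ i = p\<^sup>2 * p ^ i"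
    using card_derived_Mod[OF M(1,2)] unfolding M(3) j i
    by (simp add: power_add mult.commute power2_eq_square)
  moreover have "p ^ i > 0" using p_gt_1 by simp
  ultimately have "card (derived (G Mod M) (carrier (G Mod M))) = p\<^sup>2"
    by (metis mult_right_cancel less_not_refl2)
  then show False using Q.GC_star_card_derived_neq_p_square[OF GC_star_Mod[OF GC M(1)]] by blast
qed

lemma card_derived_eq_p_if_GC_star:
  assumes "GC_star G" "\<not> comm_group G"
  shows "card (derived G (carrier G)) = p"
proof -
  obtain j where j: "card (derived G (carrier G)) = p ^ j"
    using card_subgroup_prime_power[OF derived_subgroup] .
  have "p ^ j \<le> p ^ 1" using GC_star_card_derived_le_p[OF assms(1)] j by simp
  then have "j \<le> 1" using p_gt_1 power_increasing_iff by blast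
  moreover have "j \<noteq> 0"
  proof
    assume "j = 0"
    then have "derived G (carrier G) = {\<one>}"
      using j card_1_singletonE subgroup.one_closed[OF derived_subgroup]
      by (metis power_0 singletonD)
    then have "comm_group G"
      using commutator_in_derived commutator_eq_one_iff by (intro group_comm_groupI) auto
    then show False using assms(2) by simp
  qed
  ultimately show ?thesis using j by (simp add: le_Suc_eq)
qed

end

theorem theorem3p1:
  fixes P :: "('a, 'b) monoid_scheme" and p :: nat
  assumes "group P" and "finite (carrier P)" and "prime p"
    and "\<exists>k. card (carrier P) = p ^ k"
    and "\<not> comm_group P"
  shows "GC_star P \<longleftrightarrow>
           cyclic_subset P (group_center P) \<and> card (derived P (carrier P)) = p"
proof -
  obtain k where "card (carrier P) = p ^ k" using assms(4) by blast
  then interpret pgroup P p k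
    using assms(1-3) unfolding pgroup_def pgroup_axioms_def by blast
  show ?thesis
    using card_derived_eq_p_if_GC_star[OF _ assms(5)] cyclic_center_if_GC_star
      GC_star_if_cyclic_center
    by blast
qed

end
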